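(* Given an arrangement $\mathcal{A}$ of cylindrically monotone pseudosegments and a pair of points $a,b$, it is NP-hard to decide whether $\mathcal{A}$ is $(a,b)$-extendable.
   Context: An arrangement of pseudosegments is a finite set of simple curves (homeomorphic images of a closed interval) such that every pair of curves intersects at most once, and every intersection point is a proper crossing or a common endpoint; each curve is called a pseudosegment. The cylinder is the surface $S^1 \times \mathbb{R}$ embedded in $\mathbb{R}^3$, where $S^1$ is the unit circle in the $xy$-plane. A simple curve on the cylinder is cylindrically monotone if it intersects every line parallel to the $z$-axis at most once. Given an arrangement $\mathcal{A}$ of cylindrically monotone pseudosegments and a pair of points $a,b$ not on the same vertical line and not on the same pseudosegment, $\mathcal{A}$ is $(a,b)$-extendable if there exists a cylindrically monotone simple curve with endpoints $a,b$ that intersects every curve of $\mathcal{A}$ at most once (there are two possible directions of the curve around the cylinder). *)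

theory Defs
  imports "HOL-Analysis.Analysis" "HOL-Computational_Algebra.Polynomial"
begin

section \<open>Turing machines, NP and NP-hardness\<close>

text \<open>
  A machine with \<open>k\<close> two-way infinite tapes is a finite set of transitions \<open>(q, rs, q', as)\<close>: in state
  \<open>q\<close>, reading the symbols \<open>rs\<close>, go to state \<open>q'\<close> and, on the \<open>i\<close>-th tape, write \<open>fst (as ! i)\<close> and
  move the head by \<open>snd (as ! i)\<close>. Since the set of transitions is finite, only finitely
  many states and symbols are in use. State 0 is initial, state 1 is accepting; symbol 0 is the
  blank, symbols 1 and 2 stand for the bits False and True. A machine halts when no transition
  applies.
\<close>

type_synonym transition = "nat \<times> nat list \<times> nat \<times> (nat \<times> int) list"
type_synonym config = "nat \<times> ((int \<Rightarrow> nat) \<times> int) list"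

definition turing_machine :: "nat \<Rightarrow> transition set \<Rightarrow> bool" where
  "turing_machine k \<delta> \<longleftrightarrow> k \<ge> 1 \<and> finite \<delta> \<and>
     (\<forall>(q, rs, q', as) \<in> \<delta>. length rs = k \<and> length as = k \<and> (\<forall>(s, m) \<in> set as. m \<in> {-1, 0, 1}))"

definition deterministic :: "transition set \<Rightarrow> bool" where
  "deterministic \<delta> \<longleftrightarrow> (\<forall>q rs x y. (q, rs, x) \<in> \<delta> \<longrightarrow> (q, rs, y) \<in> \<delta> \<longrightarrow> x = y)"

definition tm_step :: "transition set \<Rightarrow> (config \<times> config) set" where
  "tm_step \<delta> = {((q, ts), (q', map2 (\<lambda>(T, h) (s, m). (T(h := s), h + m)) ts as)) | q ts q' as.
     (q, map (\<lambda>(T, h). T h) ts, q', as) \<in> \<delta>}"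

definition halted :: "transition set \<Rightarrow> config \<Rightarrow> bool" where
  "halted \<delta> c \<longleftrightarrow> c \<notin> Domain (tm_step \<delta>)"

definition word_tape :: "bool list \<Rightarrow> int \<Rightarrow> nat" where
  "word_tape w i = (if 0 \<le> i \<and> i < int (length w) then (if w ! nat i then 2 else 1) else 0)"

definition start_config :: "nat \<Rightarrow> bool list \<Rightarrow> config" where
  "start_config k w = (0, (word_tape w, 0) # replicate (k - 1) (\<lambda>_. 0, 0))"

text \<open>Input is read from the first tape, output is left on the last one.\<close>

definition polytime_computable :: "(bool list \<Rightarrow> bool list) \<Rightarrow> bool" where
  "polytime_computable f \<longleftrightarrow> (\<exists>k \<delta> (p :: nat poly). turing_machine k \<delta> \<and> deterministic \<delta> \<and>
     (\<forall>x. \<exists>t c. t \<le> poly p (length x) \<and> (start_config k x, c) \<in> tm_step \<delta> ^^ t \<and>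
        halted \<delta> c \<and> fst (last (snd c)) = word_tape (f x)))"

definition NP :: "bool list set set" where
  "NP = {L. \<exists>k \<delta> (p :: nat poly). turing_machine k \<delta> \<and>
     (\<forall>x. (\<forall>t c. (start_config k x, c) \<in> tm_step \<delta> ^^ t \<longrightarrow> t \<le> poly p (length x)) \<and>
        (x \<in> L \<longleftrightarrow> (\<exists>c. (start_config k x, c) \<in> (tm_step \<delta>)\<^sup>* \<and> halted \<delta> c \<and> fst c = 1)))}"

text \<open>
  The problem of deciding \<open>Q\<close> for instances given by words, where \<open>enc w I\<close> says that \<open>w\<close>
  is a code of the instance \<open>I\<close>. Reductions have to produce codes of instances, so
  that recognising the codes plays no role for hardness. The inner universal quantifier is there
  because a word may be a code of several (isomorphic) instances.
\<close>

definition NP_hard :: "(bool list \<Rightarrow> 'i \<Rightarrow> bool) \<Rightarrow> ('i \<Rightarrow> bool) \<Rightarrow> bool" where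
  "NP_hard enc Q \<longleftrightarrow> (\<forall>L\<in>NP. \<exists>f. polytime_computable f \<and>
     (\<forall>x. (\<exists>I. enc (f x) I) \<and> (\<forall>I. enc (f x) I \<longrightarrow> (x \<in> L \<longleftrightarrow> Q I))))"


section \<open>Arrangements of pseudosegments\<close>

definition curve_between :: "'a::topological_space set \<Rightarrow> 'a \<Rightarrow> 'a \<Rightarrow> bool" where
  "curve_between C a b \<longleftrightarrow> (\<exists>g. arc g \<and> path_image g = C \<and> pathstart g = a \<and> pathfinish g = b)"

definition simple_curve :: "'a::topological_space set \<Rightarrow> bool" where
  "simple_curve C \<longleftrightarrow> (\<exists>a b. curve_between C a b)"

definition curve_endpoint :: "'a::topological_space set \<Rightarrow> 'a \<Rightarrow> bool" where
  "curve_endpoint C p \<longleftrightarrow> (\<exists>q. curve_between C p q)"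

definition meet_at_most_once :: "'a set \<Rightarrow> 'a set \<Rightarrow> bool" where
  "meet_at_most_once C D \<longleftrightarrow> (\<forall>p \<in> C \<inter> D. \<forall>q \<in> C \<inter> D. p = q)"

text \<open>Near a proper crossing the two curves look like the two coordinate axes of the plane.\<close>

definition proper_crossing ::
    "'a::topological_space set \<Rightarrow> 'a set \<Rightarrow> 'a set \<Rightarrow> 'a \<Rightarrow> bool" where
  "proper_crossing S C D p \<longleftrightarrow> (\<exists>U h h'. openin (top_of_set S) U \<and> p \<in> U \<and>
     homeomorphism U (UNIV :: (real \<times> real) set) h h' \<and> h p = (0, 0) \<and>
     h ` (C \<inter> U) = UNIV \<times> {0} \<and> h ` (D \<inter> U) = {0} \<times> UNIV)"

definition pseudosegment_arrangement ::
    "'a::topological_space set \<Rightarrow> 'a set set \<Rightarrow> bool" where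
  "pseudosegment_arrangement S A \<longleftrightarrow> finite A \<and> (\<forall>C\<in>A. C \<subseteq> S \<and> simple_curve C) \<and>
     (\<forall>C\<in>A. \<forall>D\<in>A. C \<noteq> D \<longrightarrow> meet_at_most_once C D \<and>
        (\<forall>p \<in> C \<inter> D. proper_crossing S C D p \<or> (curve_endpoint C p \<and> curve_endpoint D p)))"


section \<open>Cylindrically monotone arrangements and extendability\<close>

text \<open>Three-space is \<open>complex \<times> real\<close>, the first factor being the \<open>xy\<close>-plane.\<close>

definition cylinder :: "(complex \<times> real) set" where
  "cylinder = sphere 0 1 \<times> UNIV"

definition vertical_line :: "complex \<Rightarrow> (complex \<times> real) set" where
  "vertical_line u = {u} \<times> UNIV"

definition cylindrically_monotone :: "(complex \<times> real) set \<Rightarrow> bool" where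
  "cylindrically_monotone C \<longleftrightarrow> (\<forall>u. meet_at_most_once C (vertical_line u))"

definition extension_instance ::
    "(complex \<times> real) set set \<Rightarrow> complex \<times> real \<Rightarrow> complex \<times> real \<Rightarrow> bool" where
  "extension_instance A a b \<longleftrightarrow> pseudosegment_arrangement cylinder A \<and>
     (\<forall>C\<in>A. cylindrically_monotone C) \<and> a \<in> cylinder \<and> b \<in> cylinder \<and>
     \<not> (\<exists>u. a \<in> vertical_line u \<and> b \<in> vertical_line u) \<and> \<not> (\<exists>C\<in>A. a \<in> C \<and> b \<in> C)"

definition extendable ::
    "(complex \<times> real) set set \<Rightarrow> complex \<times> real \<Rightarrow> complex \<times> real \<Rightarrow> bool" where
  "extendable A a b \<longleftrightarrow> (\<exists>D. D \<subseteq> cylinder \<and> cylindrically_monotone D \<and> curve_between D a b \<and>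
     (\<forall>C\<in>A. meet_at_most_once C D))"


section \<open>Finite descriptions of arrangements\<close>

text \<open>
  The strip of width \<open>N\<close> is wrapped once around the cylinder. Curves are described by polygonal
  chains with vertices on the integer grid of the universal cover, so that it is
  clear which way round the cylinder each edge runs.
\<close>

type_synonym description = "nat \<times> (nat \<times> nat) list list \<times> (nat \<times> nat) \<times> (nat \<times> nat)"

definition wrap :: "nat \<Rightarrow> real \<times> real \<Rightarrow> complex \<times> real" where
  "wrap N = (\<lambda>(s, z). (cis (2 * pi * s / real N), z))"

definition grid_point :: "nat \<times> nat \<Rightarrow> real \<times> real" where
  "grid_point = (\<lambda>(i, j). (real i, real j))"

fun polygonal_chain :: "(real \<times> real) list \<Rightarrow> (real \<times> real) set" where
  "polygonal_chain (p # q # ps) = closed_segment p q \<union> polygonal_chain (q # ps)"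
| "polygonal_chain _ = {}"

definition drawn_curve :: "nat \<Rightarrow> (nat \<times> nat) list \<Rightarrow> (complex \<times> real) set" where
  "drawn_curve N ps = wrap N ` polygonal_chain (map grid_point ps)"

text \<open>
  A description determines an arrangement with two points only up to homeomorphisms of the cylinder
  that permute the vertical lines. Every arrangement of cylindrically monotone
  pseudosegments is of this form: straighten the curves between the (finitely many) vertical
  lines through the marked points, the endpoints and the intersection points.
\<close>

definition describes ::
    "description \<Rightarrow> (complex \<times> real) set set \<Rightarrow> complex \<times> real \<Rightarrow> complex \<times> real \<Rightarrow> bool" where
  "describes = (\<lambda>(N, Cs, u, v) A a b. \<exists>h h'. homeomorphism cylinder cylinder h h' \<and>
     (\<forall>p\<in>cylinder. \<forall>q\<in>cylinder. fst (h p) = fst (h q) \<longleftrightarrow> fst p = fst q) \<and>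
     A = (\<lambda>ps. h ` drawn_curve N ps) ` set Cs \<and>
     a = h (wrap N (grid_point u)) \<and> b = h (wrap N (grid_point v)))"

text \<open>
  Self-delimiting binary codes: numbers are written in base two, least significant digit first;
  every digit and every list entry is preceded by True, and False marks the end.
\<close>

definition code_list :: "('a \<Rightarrow> bool list) \<Rightarrow> 'a list \<Rightarrow> bool list" where
  "code_list c xs = concat (map (\<lambda>x. True # c x) xs) @ [False]"

fun binary_digits :: "nat \<Rightarrow> bool list" where
  "binary_digits n = (if n = 0 then [] else odd n # binary_digits (n div 2))"

declare binary_digits.simps [simp del]

definition code_nat :: "nat \<Rightarrow> bool list" where
  "code_nat n = code_list (\<lambda>b. [b]) (binary_digits n)"

definition code_point :: "nat \<times> nat \<Rightarrow> bool list" where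
  "code_point = (\<lambda>(i, j). code_nat i @ code_nat j)"

definition code_description :: "description \<Rightarrow> bool list" where
  "code_description = (\<lambda>(N, Cs, u, v).
     code_nat N @ code_list (code_list code_point) Cs @ code_point u @ code_point v)"

definition encodes_instance :: "bool list \<Rightarrow>
    (complex \<times> real) set set \<times> (complex \<times> real) \<times> (complex \<times> real) \<Rightarrow> bool" where
  "encodes_instance w = (\<lambda>(A, a, b). extension_instance A a b \<and>
     (\<exists>d. w = code_description d \<and> describes d A a b))"


subsection \<open>Unique readability of the codes\<close>

definition prefix_code :: "('a \<Rightarrow> bool list) \<Rightarrow> bool" where
  "prefix_code c \<longleftrightarrow> (\<forall>x y r s. c x @ r = c y @ s \<longrightarrow> x = y \<and> r = s)"

lemma prefix_codeD:
  assumes "prefix_code c" "c x @ r = c y @ s"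
  shows "x = y" "r = s"
  using assms unfolding prefix_code_def by blast+

lemma prefix_code_list:
  assumes "prefix_code c"
  shows "prefix_code (code_list c)"
proof -
  have "code_list c xs @ r = code_list c ys @ s \<Longrightarrow> xs = ys \<and> r = s" for xs ys r s
  proof (induction xs arbitrary: ys)
    case Nil
    then show ?case by (cases ys) (auto simp: code_list_def)
  next
    case (Cons x xs)
    then obtain y ys' where ys: "ys = y # ys'"
      by (cases ys) (auto simp: code_list_def)
    have "c x @ (code_list c xs @ r) = c y @ (code_list c ys' @ s)"
      using Cons.prems by (simp add: ys code_list_def)
    from prefix_codeD[OF assms this] Cons.IH[of ys'] show ?case
      by (simp add: ys)
  qed
  then show ?thesis unfolding prefix_code_def by blast
qed

lemma binary_digits_eq_Nil_iff: "binary_digits n = [] \<longleftrightarrow> n = 0"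
  by (subst binary_digits.simps) simp

lemma binary_digits_inject: "binary_digits m = binary_digits n \<Longrightarrow> m = n"
proof (induction m arbitrary: n rule: binary_digits.induct)
  case (1 m)
  show ?case
  proof (cases "m = 0 \<or> n = 0")
    case True
    with "1.prems" show ?thesis by (metis binary_digits_eq_Nil_iff)
  next
    case False
    with "1.prems" have "odd m = odd n" "binary_digits (m div 2) = binary_digits (n div 2)"
      by (auto simp: binary_digits.simps[of m] binary_digits.simps[of n])
    with "1.IH" False have "m div 2 = n div 2" "m mod 2 = n mod 2"
      by (auto simp: even_iff_mod_2_eq_zero odd_iff_mod_2_eq_one)
    then show ?thesis by (metis div_mult_mod_eq)
  qed
qed

lemma prefix_code_nat: "prefix_code code_nat"
proof -
  have "prefix_code (\<lambda>b. [b])"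
    by (simp add: prefix_code_def)
  note pc = prefix_codeD[OF prefix_code_list[OF this]]
  have "m = n \<and> r = s" if "code_nat m @ r = code_nat n @ s" for m n r s
    using pc[OF that[unfolded code_nat_def]] binary_digits_inject by simp
  then show ?thesis
    unfolding prefix_code_def by blast
qed

lemma prefix_code_point: "prefix_code code_point"
proof -
  have "i = i' \<and> j = j' \<and> r = s"
    if "code_nat i @ (code_nat j @ r) = code_nat i' @ (code_nat j' @ s)" for i i' j j' r s
    using prefix_codeD(1)[OF prefix_code_nat that]
      prefix_codeD[OF prefix_code_nat prefix_codeD(2)[OF prefix_code_nat that]] by simp
  then show ?thesis
    unfolding prefix_code_def code_point_def
    by (simp only: split_paired_All prod.case append_assoc prod.inject) blast
qed

lemma inj_code_description: "inj code_description"
proof -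
  note pc = prefix_codeD[OF prefix_code_nat] prefix_codeD[OF prefix_code_point]
    prefix_codeD[OF prefix_code_list[OF prefix_code_list[OF prefix_code_point]]]
  have "N = N' \<and> Cs = Cs' \<and> u = u' \<and> v = v'"
    if eq: "code_description (N, Cs, u, v) = code_description (N', Cs', u', v')"
    for N N' Cs Cs' u u' v v'
  proof -
    from eq have 1: "code_nat N @ (code_list (code_list code_point) Cs @ code_point u @ code_point v @ [])
      = code_nat N' @ (code_list (code_list code_point) Cs' @ code_point u' @ code_point v' @ [])"
      by (simp add: code_description_def)
    note 2 = pc(2)[OF 1]
    note 3 = pc(6)[OF 2]
    note 4 = pc(4)[OF 3]
    from pc(1)[OF 1] pc(5)[OF 2] pc(3)[OF 3] pc(3)[OF 4] show ?thesis by simp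
  qed
  then show ?thesis unfolding inj_def by (simp only: split_paired_All prod.inject) blast
qed

end

theory Submission
  imports Defs
begin

text \<open>
  The computations of a nondeterministic machine with polynomial running time are described by a CNF
  formula, and an arrangement is built that is extendable iff the formula is satisfiable.

  A curve that passes through an endpoint of the connecting curve, or that has to be crossed
  somewhere, may not be met anywhere else and thus acts as a barrier. Two barriers force the
  connecting curve to run from \<open>a\<close> through the clause gadgets and then through the variable gadgets to
  \<open>b\<close>. Every literal of every clause is a curve that starts in the gadget of its variable and runs
  around the cylinder to the gadget of its clause. In each clause gadget the connecting curve has to
  cross one of the literals; it must then stay below the other end of that literal, in
  the variable gadget. There the positive literals start in the left half and the negative ones in
  the right half, and a barrier lifts the connecting curve between the halves; since a
  further curve along the gadget may be crossed only once, the connecting curve is low in at most one half.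

  The arrangements are written down by programs with nested counting loops, which Turing machines
  execute in polynomial time.
\<close>

section \<open>A polynomial-time programming language\<close>

text \<open>The arrangement itself must consist of pairwise once-crossing curves, although its
  literals are ordered by variable at one end and by clause at the other. All this reordering
  happens in the strip between columns \<open>N - 1\<close> and \<open>N\<close>, where a pair of
  literals is swapped at most once. Curves are linear between consecutive integer columns, so a pair
  is checked by comparing heights at columns. The main heights are multiples of 8; residues 2, 4 and
  6 separate curves that share a level, and odd heights inside the gadgets are left to the
  connecting curve.

  That a clause forces the crossing of a literal rests on a chain of links. The guard of the clause
  presses the connecting curve below the level of literal 0. A curve that comes in above literal
  \<open>i\<close>, where link \<open>i\<close> begins, and is below that level later on has crossed
  link \<open>i\<close>; it must stay below it, and link \<open>i\<close> ends under the level of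
  literal \<open>i + 1\<close>. A curve avoiding all literals would end up both above and below the
  last one.

  The clauses are instances of finitely many templates over time and tape position, so that loops
  over arithmetic expressions suffice to write everything down.\<close>

datatype aexp = Cst nat | Var nat | Add aexp aexp | Mul aexp aexp | Sub aexp aexp | Inp aexp

text \<open>Conditionals are expressed by arithmetic: subtraction is truncated, which turns
  comparisons into 0 or 1, and products with these values select a branch. \<open>Inp\<close> yields
  the tape symbol 0, 1 or 2, with 0 beyond the end of the input.\<close>

fun aval :: "bool list \<Rightarrow> nat list \<Rightarrow> aexp \<Rightarrow> nat" where
  "aval x e (Cst n) = n"
| "aval x e (Var k) = (if k < length e then e ! k else 0)"
| "aval x e (Add a b) = aval x e a + aval x e b"
| "aval x e (Mul a b) = aval x e a * aval x e b"
| "aval x e (Sub a b) = aval x e a - aval x e b"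
| "aval x e (Inp a) = word_tape x (int (aval x e a))"

text \<open>A loop pushes two variables, the index and the number of iterations still to come: the
  latter is the register that drives the loop on the machine.\<close>

datatype emitter = EmitB bool | EmitN aexp | Seq emitter emitter | For aexp emitter

fun emitted :: "bool list \<Rightarrow> nat list \<Rightarrow> emitter \<Rightarrow> bool list" where
  "emitted x e (EmitB b) = [b]"
| "emitted x e (EmitN a) = code_nat (aval x e a)"
| "emitted x e (Seq p q) = emitted x e p @ emitted x e q"
| "emitted x e (For a p) =
     concat (map (\<lambda>i. emitted x (e @ [i, aval x e a - Suc i]) p) [0..<aval x e a])"

subsection \<open>Counter programs\<close>

datatype test = Pos nat | Bit | One

datatype com = Skip | Inc nat | Dec nat | Out bool | GoR | GoL | Then com com (infixr ";;" 60)
  | IfT test com com | WhileT test com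

type_synonym store = "(nat \<Rightarrow> nat) \<times> int \<times> bool list"

fun holds :: "bool list \<Rightarrow> test \<Rightarrow> store \<Rightarrow> bool" where
  "holds x (Pos r) (c, h, w) \<longleftrightarrow> c r > 0"
| "holds x Bit (c, h, w) \<longleftrightarrow> word_tape x h \<noteq> 0"
| "holds x One (c, h, w) \<longleftrightarrow> word_tape x h = 2"

text \<open>The counter is the exact number of machine steps after compilation: one for a test, and
  one more for the jump over the else branch or back to the head of a loop.\<close>

inductive exec :: "bool list \<Rightarrow> com \<Rightarrow> store \<Rightarrow> nat \<Rightarrow> store \<Rightarrow> bool" for x where
  Skip: "exec x Skip s 0 s"
| Inc: "exec x (Inc r) (c, h, w) 1 (c(r := Suc (c r)), h, w)"
| Dec: "exec x (Dec r) (c, h, w) 1 (c(r := c r - 1), h, w)"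
| Out: "exec x (Out b) (c, h, w) 1 (c, h, w @ [b])"
| GoR: "exec x GoR (c, h, w) 1 (c, h + 1, w)"
| GoL: "exec x GoL (c, h, w) 1 (c, h - 1, w)"
| Then: "exec x p s m s' \<Longrightarrow> exec x q s' n s'' \<Longrightarrow> exec x (p ;; q) s (m + n) s''"
| IfTrue: "holds x t s \<Longrightarrow> exec x p s n s' \<Longrightarrow> exec x (IfT t p q) s (n + 2) s'"
| IfFalse: "\<not> holds x t s \<Longrightarrow> exec x q s n s' \<Longrightarrow> exec x (IfT t p q) s (n + 1) s'"
| WhileFalse: "\<not> holds x t s \<Longrightarrow> exec x (WhileT t p) s 1 s"
| WhileTrue: "holds x t s \<Longrightarrow> exec x p s m s' \<Longrightarrow> exec x (WhileT t p) s' n s'' \<Longrightarrow>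
     exec x (WhileT t p) s (m + n + 2) s''"

definition runs :: "bool list \<Rightarrow> com \<Rightarrow> store \<Rightarrow> nat \<Rightarrow> store \<Rightarrow> bool" where
  "runs x p s b s' \<longleftrightarrow> (\<exists>n\<le>b. exec x p s n s')"

lemma runs_mono: "runs x p s b s' \<Longrightarrow> b \<le> b' \<Longrightarrow> runs x p s b' s'"
  unfolding runs_def by (meson order_trans)

lemma runs_eq: "runs x p s b s' \<Longrightarrow> s' = s'' \<Longrightarrow> runs x p s b s''"
  by simp

lemma runs_atom:
  "runs x Skip s 0 s"
  "runs x (Inc r) (c, h, w) 1 (c(r := Suc (c r)), h, w)"
  "runs x (Dec r) (c, h, w) 1 (c(r := c r - 1), h, w)"
  "runs x (Out b) (c, h, w) 1 (c, h, w @ [b])"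
  "runs x GoR (c, h, w) 1 (c, h + 1, w)"
  "runs x GoL (c, h, w) 1 (c, h - 1, w)"
  unfolding runs_def by (rule exI, rule conjI[OF order_refl], rule exec.intros)+

lemma runs_Then: "runs x p s m s' \<Longrightarrow> runs x q s' n s'' \<Longrightarrow> runs x (p ;; q) s (m + n) s''"
  unfolding runs_def by (meson add_mono exec.Then)

lemma runs_If:
  assumes "holds x t s \<Longrightarrow> runs x p s n s'" "\<not> holds x t s \<Longrightarrow> runs x q s n s'"
  shows "runs x (IfT t p q) s (n + 2) s'"
proof (cases "holds x t s")
  case True
  then obtain k where "k \<le> n" "exec x p s k s'" using assms unfolding runs_def by blast
  then show ?thesis unfolding runs_def using exec.IfTrue[OF True]
    by (meson add_le_mono1)
next
  case False
  then obtain k where "k \<le> n" "exec x q s k s'" using assms unfolding runs_def by blast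
  then show ?thesis unfolding runs_def using exec.IfFalse[OF False, of q k s' p]
    by (intro exI[of _ "k + 1"]) auto
qed

lemma runs_While_step:
  assumes "holds x t s" "runs x p s m s'" "runs x (WhileT t p) s' n s''"
  shows "runs x (WhileT t p) s (m + n + 2) s''"
proof -
  obtain i j where "i \<le> m" "exec x p s i s'" "j \<le> n" "exec x (WhileT t p) s' j s''"
    using assms unfolding runs_def by blast
  then show ?thesis unfolding runs_def using exec.WhileTrue[OF assms(1)]
    by (intro exI[of _ "i + j + 2"]) auto
qed

lemma runs_While_stop: "\<not> holds x t s \<Longrightarrow> runs x (WhileT t p) s 1 s"
  unfolding runs_def using exec.WhileFalse by blast

lemma runs_While:
  assumes "\<And>i. i < n \<Longrightarrow> holds x t (I i)" "\<And>i. i < n \<Longrightarrow> runs x p (I i) b (I (Suc i))"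
    and "\<not> holds x t (I n)"
  shows "runs x (WhileT t p) (I 0) (n * (b + 2) + 1) (I n)"
  using assms
proof (induction n arbitrary: I)
  case 0
  then show ?case by (simp add: runs_While_stop[unfolded One_nat_def])
next
  case (Suc n)
  have "runs x (WhileT t p) (I (Suc 0)) (n * (b + 2) + 1) (I (Suc n))"
    using Suc.prems Suc.IH[of "\<lambda>i. I (Suc i)"] by simp
  from runs_While_step[OF Suc.prems(1)[of 0] Suc.prems(2)[of 0] this] show ?case
    by (simp add: algebra_simps)
qed

text \<open>All loops except the two that convert to binary count a register down.\<close>

lemma runs_countdown:
  assumes "I 0 = (f 0, h 0, w 0)" "\<And>i. i \<le> n \<Longrightarrow> I i = (f i, h i, w i)"
    and "\<And>i. i \<le> n \<Longrightarrow> f i d = n - i"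
    and "\<And>i. i < n \<Longrightarrow> runs x p ((f i)(d := n - Suc i), h i, w i) b (I (Suc i))"
  shows "runs x (WhileT (Pos d) (Dec d ;; p)) (I 0) (n * (b + 3) + 1) (I n)"
proof -
  have "runs x (WhileT (Pos d) (Dec d ;; p)) (I 0) (n * ((1 + b) + 2) + 1) (I n)"
  proof (rule runs_While)
    fix i assume i: "i < n"
    then show "holds x (Pos d) (I i)" using assms(2,3)[of i] by simp
    have "runs x (Dec d) (I i) 1 ((f i)(d := n - Suc i), h i, w i)"
      using runs_atom(3)[of x d "f i" "h i" "w i"] i assms(2,3)[of i] by simp
    from runs_Then[OF this assms(4)[OF i]] show "runs x (Dec d ;; p) (I i) (1 + b) (I (Suc i))" .
  next
    show "\<not> holds x (Pos d) (I n)" using assms(2,3)[of n] by simp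
  qed
  then show ?thesis by (rule runs_mono) (simp add: distrib_left)
qed

subsection \<open>Evaluating expressions\<close>

fun incs :: "nat \<Rightarrow> nat \<Rightarrow> com" where
  "incs r 0 = Skip"
| "incs r (Suc n) = Inc r ;; incs r n"

lemma runs_incs: "runs x (incs r n) (c, h, w) n (c(r := c r + n), h, w)"
proof (induction n arbitrary: c)
  case 0
  show ?case unfolding incs.simps by (rule runs_eq[OF runs_atom(1)]) (auto simp: fun_eq_iff)
next
  case (Suc n)
  show ?case unfolding incs.simps
    by (rule runs_mono[OF runs_eq[OF runs_Then[OF runs_atom(2) Suc]]]) (auto simp: fun_eq_iff)
qed

text \<open>\<open>acc n a r d\<close> adds the value of \<open>a\<close> to register \<open>r\<close>; registers below \<open>n\<close> hold the
  variables, those from \<open>d\<close> on are scratch registers holding 0.\<close>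

fun acc :: "nat \<Rightarrow> aexp \<Rightarrow> nat \<Rightarrow> nat \<Rightarrow> com" where
  "acc n (Cst m) r d = incs r m"
| "acc n (Var k) r d = (if k < n then WhileT (Pos k) (Dec k ;; Inc r ;; Inc d) ;;
     WhileT (Pos d) (Dec d ;; Inc k) else Skip)"
| "acc n (Add a b) r d = acc n a r d ;; acc n b r d"
| "acc n (Mul a b) r d = acc n a d (d + 1) ;; WhileT (Pos d) (Dec d ;; acc n b r (d + 1))"
| "acc n (Sub a b) r d = acc n a d (d + 2) ;; acc n b (d + 1) (d + 2) ;;
     WhileT (Pos (d + 1)) (Dec (d + 1) ;; Dec d) ;; WhileT (Pos d) (Dec d ;; Inc r)"
| "acc n (Inp a) r d = acc n a d (d + 1) ;;
     WhileT (Pos d) (Dec d ;; Inc (d + 1) ;; GoR) ;;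
     IfT Bit (IfT One (incs r 2) (Inc r)) Skip ;;
     WhileT (Pos (d + 1)) (Dec (d + 1) ;; GoL)"

text \<open>A polynomial in a common bound on the environment entries. The coefficients are natural
  numbers, so nothing has to be said about monotonicity; a difference is bounded by its
  minuend.\<close>

fun value_bound :: "aexp \<Rightarrow> nat poly" where
  "value_bound (Cst n) = [:n:]"
| "value_bound (Var k) = [:0, 1:]"
| "value_bound (Add a b) = value_bound a + value_bound b"
| "value_bound (Mul a b) = value_bound a * value_bound b"
| "value_bound (Sub a b) = value_bound a"
| "value_bound (Inp a) = [:2:]"

text \<open>The constants are loop overheads. For a variable, moving it out costs 5 steps per unit,
  restoring it 4, and leaving the two loops 2.\<close>

fun acc_bound :: "aexp \<Rightarrow> nat poly" where
  "acc_bound (Cst n) = [:n:]"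
| "acc_bound (Var k) = [:2, 9:]"
| "acc_bound (Add a b) = acc_bound a + acc_bound b"
| "acc_bound (Mul a b) = acc_bound a + value_bound a * (acc_bound b + [:3:]) + [:1:]"
| "acc_bound (Sub a b) = acc_bound a + acc_bound b + value_bound a * [:4:] + value_bound b * [:4:] + [:2:]"
| "acc_bound (Inp a) = acc_bound a + value_bound a * [:9:] + [:8:]"

lemma aval_le_value_bound:
  assumes "\<forall>i\<in>set e. i \<le> B"
  shows "aval x e a \<le> poly (value_bound a) B"
  using assms
proof (induction a)
  case (Var k)
  then show ?case by (auto dest: nth_mem)
next
  case (Mul a b)
  then show ?case by (simp add: mult_mono)
next
  case (Sub a b)
  then show ?case by (simp add: le_diff_conv trans_le_add1)
qed (auto simp: word_tape_def add_mono)

lemma runs_acc: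
  assumes "\<forall>i\<in>set e. i \<le> B" "length e = n" "\<forall>i<n. c i = e ! i" "n \<le> r" "r < d" "\<forall>i\<ge>d. c i = 0"
  shows "runs x (acc n a r d) (c, 0, w) (poly (acc_bound a) B) (c(r := c r + aval x e a), 0, w)"
  using assms(3-)
proof (induction a arbitrary: c r d)
  case (Cst m)
  have "poly (acc_bound (Cst m)) B = m" by simp
  then show ?case by (simp only: acc.simps aval.simps runs_incs)
next
  case (Var k)
  show ?case
  proof (cases "k < n")
    case False
    then show ?thesis using assms(2) runs_mono[OF runs_atom(1)] by simp
  next
    case True
    let ?m = "e ! k"
    have ck: "c k = ?m" and k: "k < r" "k < d" "k \<noteq> r" "k \<noteq> d" "r \<noteq> d" and cd: "c d = 0"
      using Var True by auto
    let ?f = "\<lambda>i. c(k := ?m - i, r := c r + i, d := i)"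
    have 1: "runs x (WhileT (Pos k) (Dec k ;; Inc r ;; Inc d)) (?f 0, 0, w) (?m * ((1 + 1) + 3) + 1) (?f ?m, 0, w)"
    proof (rule runs_countdown[where f = ?f and h = "\<lambda>_. 0" and w = "\<lambda>_. w"])
      fix i assume i: "i < ?m"
      show "runs x (Inc r ;; Inc d) ((?f i)(k := ?m - Suc i), 0, w) (1 + 1) (?f (Suc i), 0, w)"
        by (rule runs_eq[OF runs_Then[OF runs_atom(2) runs_atom(2)]]) (use k in \<open>auto simp: fun_eq_iff\<close>)
    qed (use k in auto)
    let ?g = "\<lambda>i. c(k := i, r := c r + ?m, d := ?m - i)"
    have 2: "runs x (WhileT (Pos d) (Dec d ;; Inc k)) (?g 0, 0, w) (?m * (1 + 3) + 1) (?g ?m, 0, w)"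
    proof (rule runs_countdown[where f = ?g and h = "\<lambda>_. 0" and w = "\<lambda>_. w"])
      fix i assume i: "i < ?m"
      show "runs x (Inc k) ((?g i)(d := ?m - Suc i), 0, w) 1 (?g (Suc i), 0, w)"
        by (rule runs_eq[OF runs_atom(2)]) (use k in \<open>auto simp: fun_eq_iff\<close>)
    qed (use k in auto)
    have eq: "?f 0 = c" "?f ?m = ?g 0" "?g ?m = c(r := c r + ?m)"
      using k ck cd by (auto simp: fun_eq_iff)
    from runs_Then[OF 1[unfolded eq] 2[unfolded eq]]
    have "runs x (acc n (Var k) r d) (c, 0, w) (9 * ?m + 2) (c(r := c r + ?m), 0, w)"
      using True by simp
    moreover have "?m \<le> B" using True assms by (metis nth_mem)
    then have "9 * ?m + 2 \<le> poly (acc_bound (Var k)) B" by simp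
    moreover have "aval x e (Var k) = ?m" using True assms(2) by simp
    ultimately show ?thesis using runs_mono by metis
  qed
next
  case (Add a b)
  from Add.prems have 1: "runs x (acc n a r d) (c, 0, w) (poly (acc_bound a) B) (c(r := c r + aval x e a), 0, w)"
    by (intro Add.IH)
  have "runs x (acc n b r d) (c(r := c r + aval x e a), 0, w) (poly (acc_bound b) B)
    ((c(r := c r + aval x e a))(r := (c(r := c r + aval x e a)) r + aval x e b), 0, w)"
    using Add.prems by (intro Add.IH) auto
  from runs_eq[OF runs_Then[OF 1 this]] show ?case
    by (simp only: acc.simps aval.simps acc_bound.simps poly_add fun_upd_upd fun_upd_same add.assoc)
next
  case (Mul a b)
  let ?m = "aval x e a"
  have 1: "runs x (acc n a d (d + 1)) (c, 0, w) (poly (acc_bound a) B) (c(d := c d + ?m), 0, w)"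
    using Mul.prems by (intro Mul.IH) auto
  let ?f = "\<lambda>i. c(r := c r + i * aval x e b, d := ?m - i)"
  have 2: "runs x (WhileT (Pos d) (Dec d ;; acc n b r (d + 1))) (?f 0, 0, w)
      (?m * (poly (acc_bound b) B + 3) + 1) (?f ?m, 0, w)"
  proof (rule runs_countdown[where f = ?f and h = "\<lambda>_. 0" and w = "\<lambda>_. w"])
    fix i assume i: "i < ?m"
    let ?c = "(?f i)(d := ?m - Suc i)"
    have "runs x (acc n b r (d + 1)) (?c, 0, w) (poly (acc_bound b) B) (?c(r := ?c r + aval x e b), 0, w)"
      using Mul.prems by (intro Mul.IH) auto
    then show "runs x (acc n b r (d + 1)) (?c, 0, w) (poly (acc_bound b) B) (?f (Suc i), 0, w)"
      by (rule runs_eq) (use Mul.prems in \<open>auto simp: fun_eq_iff\<close>)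
  qed auto
  have eq: "c(d := c d + ?m) = ?f 0" "?f ?m = c(r := c r + ?m * aval x e b)"
    using Mul.prems by (auto simp: fun_eq_iff)
  have "?m * (poly (acc_bound b) B + 3) \<le> poly (value_bound a) B * (poly (acc_bound b) B + 3)"
    using aval_le_value_bound[OF assms(1), of x a] by (rule mult_le_mono1)
  then show ?case unfolding acc.simps aval.simps
    by (intro runs_mono[OF runs_Then[OF 1[unfolded eq] 2[unfolded eq]]]) simp
next
  case (Sub a b)
  let ?m = "aval x e a" and ?k = "aval x e b"
  have 1: "runs x (acc n a d (d + 2)) (c, 0, w) (poly (acc_bound a) B) (c(d := c d + ?m), 0, w)"
    using Sub.prems by (intro Sub.IH) auto
  have 2: "runs x (acc n b (d + 1) (d + 2)) (c(d := c d + ?m), 0, w) (poly (acc_bound b) B)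
     ((c(d := c d + ?m))(d + 1 := (c(d := c d + ?m)) (d + 1) + ?k), 0, w)"
    using Sub.prems by (intro Sub.IH) auto
  let ?f = "\<lambda>i. c(d := ?m - i, d + 1 := ?k - i)"
  have 3: "runs x (WhileT (Pos (d + 1)) (Dec (d + 1) ;; Dec d)) (?f 0, 0, w) (?k * (1 + 3) + 1) (?f ?k, 0, w)"
  proof (rule runs_countdown[where f = ?f and h = "\<lambda>_. 0" and w = "\<lambda>_. w"])
    fix i assume i: "i < ?k"
    let ?c = "(?f i)(d + 1 := ?k - Suc i)"
    show "runs x (Dec d) (?c, 0, w) 1 (?f (Suc i), 0, w)"
      by (rule runs_eq[OF runs_atom(3)]) (auto simp: fun_eq_iff)
  qed auto
  let ?n = "?m - ?k"
  let ?g = "\<lambda>i. c(d := ?n - i, r := c r + i)"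
  have 4: "runs x (WhileT (Pos d) (Dec d ;; Inc r)) (?g 0, 0, w) (?n * (1 + 3) + 1) (?g ?n, 0, w)"
  proof (rule runs_countdown[where f = ?g and h = "\<lambda>_. 0" and w = "\<lambda>_. w"])
    fix i assume i: "i < ?n"
    let ?c = "(?g i)(d := ?n - Suc i)"
    show "runs x (Inc r) (?c, 0, w) 1 (?g (Suc i), 0, w)"
      by (rule runs_eq[OF runs_atom(2)]) (use Sub.prems in \<open>auto simp: fun_eq_iff\<close>)
  qed (use Sub.prems in auto)
  have eq: "(c(d := c d + ?m))(d + 1 := (c(d := c d + ?m)) (d + 1) + ?k) = ?f 0"
    "?f ?k = ?g 0" "?g ?n = c(r := c r + ?n)"
    using Sub.prems by (auto simp: fun_eq_iff)
  have "?k \<le> poly (value_bound b) B" "?n \<le> poly (value_bound a) B"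
    using aval_le_value_bound[OF assms(1), of x a] aval_le_value_bound[OF assms(1), of x b] by auto
  then show ?case unfolding acc.simps aval.simps
    by (intro runs_mono[OF runs_Then[OF 1 runs_Then[OF 2[unfolded eq] runs_Then[OF 3[unfolded eq] 4[unfolded eq]]]]]) simp
next
  case (Inp a)
  let ?m = "aval x e a"
  have 1: "runs x (acc n a d (d + 1)) (c, 0, w) (poly (acc_bound a) B) (c(d := c d + ?m), 0, w)"
    using Inp.prems by (intro Inp.IH) auto
  let ?f = "\<lambda>i. c(d := ?m - i, d + 1 := i)"
  have 2: "runs x (WhileT (Pos d) (Dec d ;; Inc (d + 1) ;; GoR)) (?f 0, int 0, w) (?m * ((1 + 1) + 3) + 1) (?f ?m, int ?m, w)"
  proof (rule runs_countdown[where f = ?f and h = int and w = "\<lambda>_. w"])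
    fix i assume i: "i < ?m"
    let ?c = "(?f i)(d := ?m - Suc i)"
    show "runs x (Inc (d + 1) ;; GoR) (?c, int i, w) (1 + 1) (?f (Suc i), int (Suc i), w)"
      by (rule runs_eq[OF runs_Then[OF runs_atom(2) runs_atom(5)]]) (auto simp: fun_eq_iff)
  qed auto
  let ?g = "\<lambda>i. (?f ?m)(r := c r + aval x e (Inp a), d + 1 := ?m - i)"
  have 3: "runs x (IfT Bit (IfT One (incs r 2) (Inc r)) Skip) (?f ?m, int ?m, w) (2 + 2 + 2) (?g 0, int ?m, w)"
  proof (intro runs_If)
    assume "holds x One (?f ?m, int ?m, w)"
    then show "runs x (incs r 2) (?f ?m, int ?m, w) 2 (?g 0, int ?m, w)"
      by (intro runs_eq[OF runs_incs]) (use Inp.prems in \<open>auto simp: fun_eq_iff\<close>)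
  next
    assume "\<not> holds x One (?f ?m, int ?m, w)" "holds x Bit (?f ?m, int ?m, w)"
    then show "runs x (Inc r) (?f ?m, int ?m, w) 2 (?g 0, int ?m, w)"
      by (intro runs_eq[OF runs_mono[OF runs_atom(2)]])
        (use Inp.prems in \<open>auto simp: fun_eq_iff word_tape_def split: if_splits\<close>)
  next
    assume "\<not> holds x Bit (?f ?m, int ?m, w)"
    then show "runs x Skip (?f ?m, int ?m, w) (2 + 2) (?g 0, int ?m, w)"
      by (intro runs_eq[OF runs_mono[OF runs_atom(1)]]) (use Inp.prems in \<open>auto simp: fun_eq_iff\<close>)
  qed
  have 4: "runs x (WhileT (Pos (d + 1)) (Dec (d + 1) ;; GoL)) (?g 0, int ?m - int 0, w) (?m * (1 + 3) + 1) (?g ?m, int ?m - int ?m, w)"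
  proof (rule runs_countdown[where f = ?g and h = "\<lambda>i. int ?m - int i" and w = "\<lambda>_. w"])
    fix i assume i: "i < ?m"
    let ?c = "(?g i)(d + 1 := ?m - Suc i)"
    show "runs x GoL (?c, int ?m - int i, w) 1 (?g (Suc i), int ?m - int (Suc i), w)"
      by (rule runs_eq[OF runs_atom(6)]) (auto simp: fun_eq_iff)
  qed auto
  have eq: "c(d := c d + ?m) = ?f 0" "?g ?m = c(r := c r + aval x e (Inp a))"
    using Inp.prems by (auto simp: fun_eq_iff)
  have "?m \<le> poly (value_bound a) B"
    using aval_le_value_bound[OF assms(1), of x a] by auto
  then show ?case unfolding acc.simps
    by (intro runs_mono[OF runs_Then[OF 1[unfolded eq] runs_Then[OF 2[unfolded of_nat_0]
      runs_Then[OF 3 4[unfolded eq of_nat_0 diff_0_right diff_self]]]]]) simp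
qed


subsection \<open>Compiling emitters\<close>

text \<open>Numbers are written by repeated halving: register \<open>n\<close> holds the number,
  \<open>n + 1\<close> collects the quotient and \<open>n + 2\<close> the parity. In a loop,
  \<open>n\<close> is the index and \<open>n + 1\<close> the countdown; the final loop clears
  \<open>n\<close>, so that all registers from \<open>n\<close> on are zero again.\<close>

fun emit :: "nat \<Rightarrow> emitter \<Rightarrow> com" where
  "emit n (EmitB b) = Out b"
| "emit n (EmitN a) = acc n a n (n + 1) ;;
     WhileT (Pos n) (Out True ;;
       WhileT (Pos n) (Dec n ;; IfT (Pos (n + 2)) (Dec (n + 2) ;; Inc (n + 1)) (Inc (n + 2))) ;;
       IfT (Pos (n + 2)) (Out True ;; Dec (n + 2)) (Out False) ;;
       WhileT (Pos (n + 1)) (Dec (n + 1) ;; Inc n)) ;;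
     Out False"
| "emit n (Seq p q) = emit n p ;; emit n q"
| "emit n (For a p) = acc n a (n + 1) (n + 2) ;;
     WhileT (Pos (n + 1)) (Dec (n + 1) ;; emit (n + 2) p ;; Inc n) ;;
     WhileT (Pos n) (Dec n ;; Skip)"

text \<open>The body of a loop sees two more variables, both bounded by the value of
  \<open>a\<close>; hence its bound is taken at \<open>B + value_bound a\<close>.\<close>

fun emit_bound :: "emitter \<Rightarrow> nat poly" where
  "emit_bound (EmitB b) = [:1:]"
| "emit_bound (EmitN a) = acc_bound a + value_bound a * (value_bound a * [:11:] + [:9:]) + [:2:]"
| "emit_bound (Seq p q) = emit_bound p + emit_bound q"
| "emit_bound (For a p) = acc_bound a +
     value_bound a * (pcompose (emit_bound p) ([:0, 1:] + value_bound a) + [:7:]) + [:2:]"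

lemma runs_halve:
  assumes "c n = 0" "c (Suc n) = 0" "c (Suc (Suc n)) = 0"
  shows "runs x (WhileT (Pos n) (Dec n ;; IfT (Pos (n + 2)) (Dec (n + 2) ;; Inc (n + 1)) (Inc (n + 2))))
    (c(n := m), h, w) (m * 7 + 1) (c(n := 0, n + 1 := m div 2, n + 2 := m mod 2), h, w)"
proof -
  let ?f = "\<lambda>i. c(n := m - i, n + 1 := i div 2, n + 2 := i mod 2)"
  have "runs x (WhileT (Pos n) (Dec n ;; IfT (Pos (n + 2)) (Dec (n + 2) ;; Inc (n + 1)) (Inc (n + 2))))
    (?f 0, h, w) (m * ((1 + 1 + 2) + 3) + 1) (?f m, h, w)"
  proof (rule runs_countdown[where f = ?f and h = "\<lambda>_. h" and w = "\<lambda>_. w"])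
    fix i assume i: "i < m"
    let ?c = "(?f i)(n := m - Suc i)"
    show "runs x (IfT (Pos (n + 2)) (Dec (n + 2) ;; Inc (n + 1)) (Inc (n + 2))) (?c, h, w) (1 + 1 + 2) (?f (Suc i), h, w)"
    proof (rule runs_If)
      assume "holds x (Pos (n + 2)) (?c, h, w)"
      then have "i mod 2 = 1" by simp
      then show "runs x (Dec (n + 2) ;; Inc (n + 1)) (?c, h, w) (1 + 1) (?f (Suc i), h, w)"
        by (intro runs_eq[OF runs_Then[OF runs_atom(3) runs_atom(2)]])
          (auto simp: fun_eq_iff div_Suc mod_Suc)
    next
      assume "\<not> holds x (Pos (n + 2)) (?c, h, w)"
      then have "i mod 2 = 0" by simp
      then show "runs x (Inc (n + 2)) (?c, h, w) (1 + 1) (?f (Suc i), h, w)"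
        by (intro runs_eq[OF runs_mono[OF runs_atom(2)]])
          (auto simp: fun_eq_iff div_Suc mod_Suc)
    qed
  qed auto
  moreover have "?f 0 = c(n := m)" "?f m = c(n := 0, n + 1 := m div 2, n + 2 := m mod 2)"
    using assms by (auto simp: fun_eq_iff)
  ultimately show ?thesis by simp
qed

text \<open>One round costs a number of steps linear in the current value, which is at most
  \<open>b\<close>. Halving a positive number decreases it, so the crude count of \<open>m\<close>
  rounds is enough for a polynomial bound.\<close>

lemma runs_binary:
  assumes "c n = 0" "c (Suc n) = 0" "c (Suc (Suc n)) = 0" "m \<le> b"
  shows "runs x (WhileT (Pos n) (Out True ;;
       WhileT (Pos n) (Dec n ;; IfT (Pos (n + 2)) (Dec (n + 2) ;; Inc (n + 1)) (Inc (n + 2))) ;;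
       IfT (Pos (n + 2)) (Out True ;; Dec (n + 2)) (Out False) ;;
       WhileT (Pos (n + 1)) (Dec (n + 1) ;; Inc n)))
    (c(n := m), h, w) (m * (b * 11 + 9) + 1) (c, h, w @ concat (map (\<lambda>d. [True, d]) (binary_digits m)))"
    (is "runs x ?loop _ _ _")
  using assms(4)
proof (induction m arbitrary: w rule: less_induct)
  case (less m)
  show ?case
  proof (cases "m = 0")
    case True
    have stop: "runs x ?loop (c(n := m), h, w) 1 (c(n := m), h, w)"
      by (rule runs_While_stop) (use True in auto)
    show ?thesis using True assms(1)
      by (intro runs_mono[OF runs_eq[OF stop]]) (auto simp: binary_digits.simps[of 0] fun_eq_iff)
  next
    case False
    let ?k = "m div 2"
    have 1: "runs x (Out True) (c(n := m), h, w) 1 (c(n := m), h, w @ [True])"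
      by (rule runs_atom)
    note 2 = runs_halve[OF assms(1-3), of x m h "w @ [True]"]
    let ?c = "c(n := 0, n + 1 := ?k, n + 2 := m mod 2)" and ?w = "w @ [True, odd m]"
    let ?g = "\<lambda>i. c(n := i, n + 1 := ?k - i)"
    have 3: "runs x (IfT (Pos (n + 2)) (Out True ;; Dec (n + 2)) (Out False)) (?c, h, w @ [True])
      (1 + 1 + 2) (?g 0, h, ?w)"
    proof (rule runs_If)
      assume "holds x (Pos (n + 2)) (?c, h, w @ [True])"
      then have "odd m" by (simp add: odd_iff_mod_2_eq_one)
      then show "runs x (Out True ;; Dec (n + 2)) (?c, h, w @ [True]) (1 + 1) (?g 0, h, ?w)"
        by (intro runs_eq[OF runs_Then[OF runs_atom(4) runs_atom(3)]]) (use assms in \<open>auto simp: fun_eq_iff\<close>)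
    next
      assume "\<not> holds x (Pos (n + 2)) (?c, h, w @ [True])"
      then have "even m" by (simp add: even_iff_mod_2_eq_zero)
      then show "runs x (Out False) (?c, h, w @ [True]) (1 + 1) (?g 0, h, ?w)"
        by (intro runs_eq[OF runs_mono[OF runs_atom(4)]]) (use assms in \<open>auto simp: fun_eq_iff\<close>)
    qed
    have 4: "runs x (WhileT (Pos (n + 1)) (Dec (n + 1) ;; Inc n)) (?g 0, h, ?w) (?k * (1 + 3) + 1) (?g ?k, h, ?w)"
    proof (rule runs_countdown[where f = ?g and h = "\<lambda>_. h" and w = "\<lambda>_. ?w"])
      fix i assume i: "i < ?k"
      show "runs x (Inc n) ((?g i)(n + 1 := ?k - Suc i), h, ?w) 1 (?g (Suc i), h, ?w)"
        by (rule runs_eq[OF runs_atom(2)]) (auto simp: fun_eq_iff)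
    qed auto
    have g: "?g ?k = c(n := ?k)" using assms by (auto simp: fun_eq_iff)
    have "?k < m" "?k \<le> b" using False less.prems by auto
    from less.IH[OF this, of ?w]
    have 5: "runs x ?loop (c(n := ?k), h, ?w) (?k * (b * 11 + 9) + 1)
       (c, h, ?w @ concat (map (\<lambda>d. [True, d]) (binary_digits ?k)))" .
    have H: "holds x (Pos n) (c(n := m), h, w)" using False by simp
    have le: "(1 + (m * 7 + 1 + (1 + 1 + 2 + (?k * (1 + 3) + 1)))) + (?k * (b * 11 + 9) + 1) + 2 \<le> m * (b * 11 + 9) + 1"
    proof -
      have "Suc ?k \<le> m" using False by linarith
      from mult_le_mono1[OF this] have "Suc ?k * (b * 11 + 9) \<le> m * (b * 11 + 9)" .
      moreover have "m * 7 + ?k * 4 \<le> b * 11" using less.prems by linarith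
      ultimately show ?thesis by simp
    qed
    show ?thesis
      by (rule runs_mono[OF runs_eq[OF runs_While_step[OF H
            runs_Then[OF 1 runs_Then[OF 2 runs_Then[OF 3 4[unfolded g]]]] 5]] le])
         (use False in \<open>simp add: binary_digits.simps[of m]\<close>)
  qed
qed

lemma runs_emit:
  assumes "\<forall>i\<in>set e. i \<le> B" "length e = n" "\<forall>i<n. c i = e ! i" "\<forall>i\<ge>n. c i = 0"
  shows "runs x (emit n p) (c, 0, w) (poly (emit_bound p) B) (c, 0, w @ emitted x e p)"
  using assms
proof (induction p arbitrary: e n c w B)
  case (EmitB b)
  show ?case by (simp add: runs_atom[unfolded One_nat_def])
next
  case (EmitN a)
  let ?m = "aval x e a" and ?b = "poly (value_bound a) B"
  have m: "?m \<le> ?b" using EmitN.prems aval_le_value_bound by simp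
  have 1: "runs x (acc n a n (n + 1)) (c, 0, w) (poly (acc_bound a) B) (c(n := c n + ?m), 0, w)"
    using EmitN.prems by (intro runs_acc) auto
  have c: "c n = 0" "c (Suc n) = 0" "c (Suc (Suc n)) = 0" using EmitN.prems by auto
  have "poly (acc_bound a) B + ((?m * (?b * 11 + 9) + 1) + 1) \<le> poly (emit_bound (EmitN a)) B"
    using mult_le_mono1[OF m, of "?b * 11 + 9"] by (simp add: algebra_simps)
  then show ?case unfolding emit.simps emitted.simps
    by (rule runs_mono[rotated, OF _ runs_eq[OF runs_Then[OF 1[unfolded c add_0]
       runs_Then[OF runs_binary[OF c m] runs_atom(4)]]]])
     (simp add: code_nat_def code_list_def)
next
  case (Seq p q)
  show ?case unfolding emit.simps
    by (rule runs_mono[OF runs_eq[OF runs_Then[OF Seq.IH(1)[OF Seq.prems] Seq.IH(2)[OF Seq.prems]]]]) auto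
next
  case (For a p)
  let ?m = "aval x e a"
  have m: "?m \<le> poly (value_bound a) B" using For.prems aval_le_value_bound by simp
  have 1: "runs x (acc n a (n + 1) (n + 2)) (c, 0, w) (poly (acc_bound a) B)
     (c(n + 1 := c (n + 1) + ?m), 0, w)"
    using For.prems by (intro runs_acc) auto
  let ?t = "poly (pcompose (emit_bound p) ([:0, 1:] + value_bound a)) B"
  let ?f = "\<lambda>i. c(n := i, n + 1 := ?m - i)"
  let ?w = "\<lambda>i. w @ concat (map (\<lambda>i. emitted x (e @ [i, ?m - Suc i]) p) [0..<i])"
  have 2: "runs x (WhileT (Pos (n + 1)) (Dec (n + 1) ;; emit (n + 2) p ;; Inc n)) (?f 0, 0, ?w 0)
     (?m * ((?t + 1) + 3) + 1) (?f ?m, 0, ?w ?m)"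
  proof (rule runs_countdown[where f = ?f and h = "\<lambda>_. 0" and w = ?w])
    fix i assume i: "i < ?m"
    let ?c = "(?f i)(n + 1 := ?m - Suc i)"
    have "runs x (emit (n + 2) p) (?c, 0, ?w i) (poly (emit_bound p) (B + poly (value_bound a) B))
      (?c, 0, ?w i @ emitted x (e @ [i, ?m - Suc i]) p)"
    proof (rule For.IH)
      show "\<forall>k\<in>set (e @ [i, ?m - Suc i]). k \<le> B + poly (value_bound a) B"
        using For.prems i m by (auto intro: trans_le_add1)
      show "\<forall>k<n + 2. ?c k = (e @ [i, ?m - Suc i]) ! k"
        using For.prems by (auto simp: nth_append nth_Cons' less_Suc_eq)
    qed (use For.prems in auto)
    then have body: "runs x (emit (n + 2) p ;; Inc n) (?c, 0, ?w i) (poly (emit_bound p) (B + poly (value_bound a) B) + 1)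
       (?c(n := Suc (?c n)), 0, ?w i @ emitted x (e @ [i, ?m - Suc i]) p)"
      using runs_atom(2) by (rule runs_Then)
    show "runs x (emit (n + 2) p ;; Inc n) (?c, 0, ?w i) (?t + 1) (?f (Suc i), 0, ?w (Suc i))"
      by (rule runs_mono[OF runs_eq[OF body]]) (auto simp: fun_eq_iff poly_pcompose)
  qed auto
  let ?g = "\<lambda>i. c(n := ?m - i)"
  have 3: "runs x (WhileT (Pos n) (Dec n ;; Skip)) (?g 0, 0, ?w ?m) (?m * (0 + 3) + 1) (?g ?m, 0, ?w ?m)"
  proof (rule runs_countdown[where f = ?g and h = "\<lambda>_. 0" and w = "\<lambda>_. ?w ?m"])
    fix i
    show "runs x Skip ((?g i)(n := ?m - Suc i), 0, ?w ?m) 0 (?g (Suc i), 0, ?w ?m)"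
      by (rule runs_eq[OF runs_atom(1)]) (auto simp: fun_eq_iff)
  qed auto
  have eq: "c(n + 1 := c (n + 1) + ?m) = ?f 0" "?w 0 = w" "?f ?m = ?g 0" "?g ?m = c"
    using For.prems by (auto simp: fun_eq_iff)
  have 12: "runs x (acc n a (n + 1) (n + 2)) (c, 0, w) (poly (acc_bound a) B) (?f 0, 0, w)"
    by (rule runs_eq[OF 1]) (simp only: eq)
  have 22: "runs x (WhileT (Pos (n + 1)) (Dec (n + 1) ;; emit (n + 2) p ;; Inc n)) (?f 0, 0, w)
     (?m * ((?t + 1) + 3) + 1) (?g 0, 0, ?w ?m)"
    using 2 by (simp only: eq)
  have 32: "runs x (WhileT (Pos n) (Dec n ;; Skip)) (?g 0, 0, ?w ?m) (?m * (0 + 3) + 1) (c, 0, ?w ?m)"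
    by (rule runs_eq[OF 3]) (simp only: eq)
  have "poly (acc_bound a) B + ((?m * ((?t + 1) + 3) + 1) + (?m * (0 + 3) + 1)) \<le> poly (emit_bound (For a p)) B"
    using mult_le_mono1[OF m, of "?t + 7"] by (simp add: algebra_simps)
  then show ?case unfolding emit.simps emitted.simps
    by (rule runs_mono[rotated]) (rule runs_Then[OF 12 runs_Then[OF 22 32]])
qed

subsection \<open>From counter programs to Turing machines\<close>

text \<open>A register is a tape with a mark in cell 0; its value is the position of the head.\<close>

datatype instr = IInc nat | IDec nat | IOut bool | IR | IL | IJmp nat | IJmpNot test nat | IMark

fun comp_len :: "com \<Rightarrow> nat" where
  "comp_len Skip = 0"
| "comp_len (p ;; q) = comp_len p + comp_len q"
| "comp_len (IfT t p q) = comp_len p + comp_len q + 2"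
| "comp_len (WhileT t p) = comp_len p + 2"
| "comp_len _ = 1"

fun compile :: "nat \<Rightarrow> com \<Rightarrow> instr list" where
  "compile a Skip = []"
| "compile a (Inc r) = [IInc r]"
| "compile a (Dec r) = [IDec r]"
| "compile a (Out b) = [IOut b]"
| "compile a GoR = [IR]"
| "compile a GoL = [IL]"
| "compile a (p ;; q) = compile a p @ compile (a + comp_len p) q"
| "compile a (IfT t p q) = IJmpNot t (a + comp_len p + 2) # compile (a + 1) p @
     IJmp (a + comp_len p + comp_len q + 2) # compile (a + comp_len p + 2) q"
| "compile a (WhileT t p) = IJmpNot t (a + comp_len p + 2) # compile (a + 1) p @ [IJmp a]"

lemma length_compile [simp]: "length (compile a p) = comp_len p"
  by (induction p arbitrary: a) auto

fun test_regs :: "test \<Rightarrow> nat set" where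
  "test_regs (Pos r) = {r}"
| "test_regs _ = {}"

fun regs :: "com \<Rightarrow> nat set" where
  "regs (Inc r) = {r}"
| "regs (Dec r) = {r}"
| "regs (p ;; q) = regs p \<union> regs q"
| "regs (IfT t p q) = test_regs t \<union> regs p \<union> regs q"
| "regs (WhileT t p) = test_regs t \<union> regs p"
| "regs _ = {}"

lemma finite_regs: "finite (regs p)"
proof -
  have "finite (test_regs t)" for t by (cases t) auto
  then show ?thesis by (induction p) auto
qed

text \<open>The head of a register tape stands on the mark exactly when the register is 0, so a
  blank means positive. The input is tape 0 and register \<open>r\<close> is tape
  \<open>Suc r\<close>.\<close>

fun test_read :: "nat list \<Rightarrow> test \<Rightarrow> bool" where
  "test_read rs (Pos r) \<longleftrightarrow> rs ! Suc r = 0"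
| "test_read rs Bit \<longleftrightarrow> rs ! 0 \<noteq> 0"
| "test_read rs One \<longleftrightarrow> rs ! 0 = 2"

fun next_state :: "instr \<Rightarrow> nat \<Rightarrow> nat list \<Rightarrow> nat" where
  "next_state (IJmp a) q rs = a"
| "next_state (IJmpNot t a) q rs = (if test_read rs t then Suc q else a)"
| "next_state _ q rs = Suc q"

fun input_move :: "instr \<Rightarrow> int" where
  "input_move IR = 1"
| "input_move IL = - 1"
| "input_move _ = 0"

text \<open>A decrement moves left only from a blank cell, which realises truncated subtraction
  without a branch.\<close>

fun reg_action :: "instr \<Rightarrow> nat list \<Rightarrow> nat \<Rightarrow> nat \<times> int" where
  "reg_action (IInc r) rs i = (rs ! Suc i, if i = r then 1 else 0)"
| "reg_action (IDec r) rs i = (rs ! Suc i, if i = r \<and> rs ! Suc i = 0 then - 1 else 0)"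
| "reg_action IMark rs i = (1, 0)"
| "reg_action _ rs i = (rs ! Suc i, 0)"

fun output_action :: "nat \<Rightarrow> instr \<Rightarrow> nat list \<Rightarrow> nat \<times> int" where
  "output_action k (IOut b) rs = (if b then 2 else 1, 1)"
| "output_action k _ rs = (rs ! Suc k, 0)"

definition instr_actions :: "nat \<Rightarrow> instr \<Rightarrow> nat list \<Rightarrow> (nat \<times> int) list" where
  "instr_actions k I rs =
     (rs ! 0, input_move I) # map (reg_action I rs) [0..<k] @ [output_action k I rs]"

definition reads :: "nat \<Rightarrow> nat list set" where
  "reads k = {rs. set rs \<subseteq> {0, 1, 2} \<and> length rs = k + 2}"

text \<open>The state is the program counter. Addresses from \<open>length P\<close> on have no
  transitions, so running off the end of the program is halting.\<close>

definition program_tm :: "nat \<Rightarrow> instr list \<Rightarrow> transition set" where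
  "program_tm k P = (\<lambda>(q, rs). (q, rs, next_state (P ! q) q rs, instr_actions k (P ! q) rs)) `
     ({..<length P} \<times> reads k)"

lemma turing_machine_program_tm: "turing_machine (k + 2) (program_tm k P)"
proof -
  have "finite (reads k)" unfolding reads_def by (rule finite_lists_length_eq) simp
  then have fin: "finite (program_tm k P)" unfolding program_tm_def by simp
  have acts: "\<forall>(s, m) \<in> set (instr_actions k I rs). m \<in> {-1, 0, 1}" for I rs
  proof -
    have "snd (reg_action I rs i) \<in> {-1, 0, 1}" "snd (output_action k I rs) \<in> {-1, 0, 1}"
      "input_move I \<in> {-1, 0, 1}" for i
      by (cases I; simp)+
    then have "\<forall>p \<in> set (instr_actions k I rs). snd p \<in> {-1, 0, 1}"
      unfolding instr_actions_def by (simp del: insert_iff)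
    then show ?thesis by (simp add: case_prod_beta del: insert_iff)
  qed
  have wf: "length rs = k + 2 \<and> length as = k + 2 \<and> (\<forall>(s, m) \<in> set as. m \<in> {-1, 0, 1})"
    if "(q, rs, q', as) \<in> program_tm k P" for q rs q' as
  proof -
    have "rs \<in> reads k" "as = instr_actions k (P ! q) rs"
      using that unfolding program_tm_def by auto
    then show ?thesis using acts by (simp add: reads_def instr_actions_def del: insert_iff)
  qed
  have "\<forall>(q, rs, q', as) \<in> program_tm k P. length rs = k + 2 \<and> length as = k + 2 \<and>
      (\<forall>(s, m) \<in> set as. m \<in> {-1, 0, 1})"
  proof
    fix tr assume tr: "tr \<in> program_tm k P"
    obtain q rs q' as where eq: "tr = (q, rs, q', as)" by (cases tr)
    show "case tr of (q, rs, q', as) \<Rightarrow> length rs = k + 2 \<and> length as = k + 2 \<and>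
      (\<forall>(s, m) \<in> set as. m \<in> {-1, 0, 1})"
      using wf[OF tr[unfolded eq]] unfolding eq prod.case .
  qed
  with fin show ?thesis unfolding turing_machine_def by simp
qed

lemma deterministic_program_tm: "deterministic (program_tm k P)"
  unfolding deterministic_def program_tm_def by auto

definition mark_tape :: "int \<Rightarrow> nat" where
  "mark_tape i = (if i = 0 then 1 else 0)"

fun config_of :: "nat \<Rightarrow> bool list \<Rightarrow> nat \<Rightarrow> store \<Rightarrow> config" where
  "config_of k x q (c, h, w) = (q, (word_tape x, h) # map (\<lambda>r. (mark_tape, int (c r))) [0..<k] @
     [(word_tape w, int (length w))])"

definition read_store :: "nat \<Rightarrow> bool list \<Rightarrow> store \<Rightarrow> nat list" where
  "read_store k x = (\<lambda>(c, h, w). word_tape x h # map (\<lambda>r. if c r = 0 then 1 else 0) [0..<k] @ [0])"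

lemma word_tape_end: "word_tape w (int (length w)) = 0"
  by (simp add: word_tape_def)

lemma word_tape_snoc: "(word_tape w)(int (length w) := if b then 2 else 1) = word_tape (w @ [b])"
  by (auto simp: word_tape_def fun_eq_iff nth_append nat_less_iff)

lemma read_store_reads: "read_store k x s \<in> reads k"
  by (cases s) (auto simp: read_store_def reads_def word_tape_def)

fun instr_effect :: "instr \<Rightarrow> store \<Rightarrow> store" where
  "instr_effect (IInc r) (c, h, w) = (c(r := Suc (c r)), h, w)"
| "instr_effect (IDec r) (c, h, w) = (c(r := c r - 1), h, w)"
| "instr_effect (IOut b) (c, h, w) = (c, h, w @ [b])"
| "instr_effect IR (c, h, w) = (c, h + 1, w)"
| "instr_effect IL (c, h, w) = (c, h - 1, w)"
| "instr_effect _ s = s"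

text \<open>\<open>IMark\<close> is left out because it is the bootstrap instruction: it acts once
  on the start configuration, whose register tapes carry no marks yet and are therefore not of the
  form \<open>config_of\<close>.\<close>

lemma program_tm_step:
  assumes "q < length P" "P ! q \<noteq> IMark"
  shows "(config_of k x q s, config_of k x (next_state (P ! q) q (read_store k x s)) (instr_effect (P ! q) s))
    \<in> tm_step (program_tm k P)"
proof -
  obtain c h w where s: "s = (c, h, w)" by (cases s)
  let ?ts = "snd (config_of k x q s)" and ?rs = "read_store k x s"
  have rs: "map (\<lambda>(T, h). T h) ?ts = ?rs"
    by (simp add: s read_store_def mark_tape_def word_tape_end)
  have step: "((q, ?ts), (next_state (P ! q) q ?rs,
      map2 (\<lambda>(T, h) (s, m). (T(h := s), h + m)) ?ts (instr_actions k (P ! q) ?rs))) \<in> tm_step (program_tm k P)"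
    unfolding tm_step_def program_tm_def using assms(1) read_store_reads rs by fastforce
  have reg: "?rs ! Suc i = (if c i = 0 then 1 else 0)" if "i < k" for i
    using that by (simp add: s read_store_def nth_append)
  have last: "?rs ! Suc k = 0" and first: "?rs ! 0 = word_tape x h"
    by (simp_all add: s read_store_def nth_append)
  have mark: "mark_tape(0 := Suc 0) = mark_tape" "m > 0 \<Longrightarrow> mark_tape(int m := 0) = mark_tape" for m
    by (auto simp: mark_tape_def fun_eq_iff)
  have w: "(word_tape w)(int (length w) := 0) = word_tape w"
    by (simp add: word_tape_end fun_upd_idem)
  have "map2 (\<lambda>(T, h) (s, m). (T(h := s), h + m)) ?ts (instr_actions k (P ! q) ?rs)
    = snd (config_of k x q (instr_effect (P ! q) s))"
    using assms(2)
    by (cases "P ! q")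
      (auto simp: s instr_actions_def map2_map_map reg[unfolded s] last[unfolded s] first[unfolded s] mark w word_tape_snoc
        word_tape_snoc[where b = True, simplified] word_tape_snoc[where b = False, simplified])
  with step show ?thesis by (cases "instr_effect (P ! q) s") (simp add: s)
qed


definition code_at :: "instr list \<Rightarrow> nat \<Rightarrow> instr list \<Rightarrow> bool" where
  "code_at P a is \<longleftrightarrow> (\<forall>i<length is. a + i < length P \<and> P ! (a + i) = is ! i)"

lemma code_at_append: "code_at P a (is @ js) \<longleftrightarrow> code_at P a is \<and> code_at P (a + length is) js"
proof -
  have "(\<forall>i<m + n. Q i) \<longleftrightarrow> (\<forall>i<m. Q i) \<and> (\<forall>i<n. Q (m + i))" for m n :: nat and Q
    by (metis add_less_cancel_left le_add_diff_inverse linorder_le_less_linear trans_less_add1)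
  then show ?thesis by (simp add: code_at_def nth_append add.assoc)
qed

lemma code_at_Cons: "code_at P a (I # is) \<longleftrightarrow> a < length P \<and> P ! a = I \<and> code_at P (Suc a) is"
  using code_at_append[of P a "[I]" "is"] by (simp add: code_at_def)

lemma test_read_store: "test_regs t \<subseteq> {..<k} \<Longrightarrow> test_read (read_store k x s) t = holds x t s"
  by (cases s; cases t) (auto simp: read_store_def nth_append)

text \<open>Rule induction along the execution. The costs in \<open>exec\<close> already include the
  jumps inserted by \<open>compile\<close>, so the step counts agree exactly.\<close>

lemma exec_program_tm:
  assumes "exec x p s n s'" "code_at P a (compile a p)" "regs p \<subseteq> {..<k}"
  shows "(config_of k x a s, config_of k x (a + comp_len p) s') \<in> tm_step (program_tm k P) ^^ n"
  using assms
proof (induction arbitrary: a)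
  case (Then p s m s' q n s'')
  have "(config_of k x a s, config_of k x (a + comp_len p) s') \<in> tm_step (program_tm k P) ^^ m"
    using Then.prems by (intro Then.IH(1)) (auto simp: code_at_append)
  moreover have "(config_of k x (a + comp_len p) s', config_of k x (a + comp_len p + comp_len q) s'')
      \<in> tm_step (program_tm k P) ^^ n"
    using Then.prems by (intro Then.IH(2)) (auto simp: code_at_append)
  ultimately show ?case by (simp add: relpow_trans add.assoc)
next
  case (IfTrue t s p n s' q)
  have 1: "(config_of k x a s, config_of k x (a + 1) s) \<in> tm_step (program_tm k P)"
    using program_tm_step[of a P k x s] IfTrue.prems IfTrue.hyps
    by (simp add: code_at_Cons test_read_store)
  have 2: "(config_of k x (a + 1) s, config_of k x (a + 1 + comp_len p) s') \<in> tm_step (program_tm k P) ^^ n"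
    using IfTrue.prems by (intro IfTrue.IH) (auto simp: code_at_append code_at_Cons)
  have 3: "(config_of k x (a + 1 + comp_len p) s', config_of k x (a + comp_len (IfT t p q)) s') \<in> tm_step (program_tm k P)"
    using program_tm_step[of "a + 1 + comp_len p" P k x s'] IfTrue.prems
    by (simp add: code_at_Cons code_at_append add.assoc)
  show ?case using relpow_Suc_I[OF relpow_Suc_I2[OF 1 2] 3] by simp
next
  case (IfFalse t s q n s' p)
  have 1: "(config_of k x a s, config_of k x (a + comp_len p + 2) s) \<in> tm_step (program_tm k P)"
    using program_tm_step[of a P k x s] IfFalse.prems IfFalse.hyps
    by (simp add: code_at_Cons test_read_store)
  have 2: "(config_of k x (a + comp_len p + 2) s, config_of k x (a + comp_len p + 2 + comp_len q) s') \<in> tm_step (program_tm k P) ^^ n"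
    using IfFalse.prems by (intro IfFalse.IH) (auto simp: code_at_append code_at_Cons)
  show ?case using relpow_Suc_I2[OF 1 2] by (simp add: algebra_simps)
next
  case (WhileFalse t s p)
  show ?case
    using program_tm_step[of a P k x s] WhileFalse
    by (simp add: code_at_Cons test_read_store)
next
  case (WhileTrue t s p m s' n s'')
  have 1: "(config_of k x a s, config_of k x (a + 1) s) \<in> tm_step (program_tm k P)"
    using program_tm_step[of a P k x s] WhileTrue.prems WhileTrue.hyps
    by (simp add: code_at_Cons test_read_store)
  have 2: "(config_of k x (a + 1) s, config_of k x (a + 1 + comp_len p) s') \<in> tm_step (program_tm k P) ^^ m"
    using WhileTrue.prems by (intro WhileTrue.IH(1)) (auto simp: code_at_append code_at_Cons)
  have 3: "(config_of k x (a + 1 + comp_len p) s', config_of k x a s') \<in> tm_step (program_tm k P)"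
    using program_tm_step[of "a + 1 + comp_len p" P k x s'] WhileTrue.prems
    by (simp add: code_at_Cons code_at_append)
  have 4: "(config_of k x a s', config_of k x (a + comp_len (WhileT t p)) s'') \<in> tm_step (program_tm k P) ^^ n"
    using WhileTrue.prems by (intro WhileTrue.IH(2))
  show ?case using relpow_trans[OF relpow_Suc_I[OF relpow_Suc_I2[OF 1 2] 3] 4] by (simp add: add_ac)
next
  case (Inc r c h w)
  then show ?case using program_tm_step[of a P k x "(c, h, w)"] by (simp add: code_at_Cons)
next
  case (Dec r c h w)
  then show ?case using program_tm_step[of a P k x "(c, h, w)"] by (simp add: code_at_Cons)
next
  case (Out b c h w)
  then show ?case using program_tm_step[of a P k x "(c, h, w)"] by (simp add: code_at_Cons)
next
  case (GoR c h w)
  then show ?case using program_tm_step[of a P k x "(c, h, w)"] by (simp add: code_at_Cons)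
next
  case (GoL c h w)
  then show ?case using program_tm_step[of a P k x "(c, h, w)"] by (simp add: code_at_Cons)
qed simp

lemma start_config_step:
  assumes "length P > 0" "P ! 0 = IMark"
  shows "(start_config (k + 2) x, config_of k x 1 (\<lambda>_. 0, 0, [])) \<in> tm_step (program_tm k P)"
proof -
  let ?ts = "snd (start_config (k + 2) x)" and ?rs = "word_tape x 0 # replicate (k + 1) 0"
  have rs: "map (\<lambda>(T, h). T h) ?ts = ?rs"
    by (simp add: start_config_def)
  have "?rs \<in> reads k" by (auto simp: reads_def word_tape_def)
  then have "(0, map (\<lambda>(T, h). T h) ?ts, next_state IMark 0 ?rs, instr_actions k IMark ?rs) \<in> program_tm k P"
    unfolding program_tm_def rs using assms by (intro image_eqI[of _ _ "(0, ?rs)"]) auto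
  then have step: "((0, ?ts), (next_state IMark 0 ?rs,
      map2 (\<lambda>(T, h) (s, m). (T(h := s), h + m)) ?ts (instr_actions k IMark ?rs))) \<in> tm_step (program_tm k P)"
    unfolding tm_step_def by blast
  have "?ts = (word_tape x, 0) # map (\<lambda>_. (\<lambda>_. 0, 0)) [0..<k] @ [(\<lambda>_. 0, 0)]"
    by (simp add: start_config_def map_replicate_const replicate_append_same)
  moreover have "(\<lambda>_. 0)(0 := Suc 0) = mark_tape" "word_tape [] = (\<lambda>_. 0)"
    by (auto simp: mark_tape_def word_tape_def fun_eq_iff)
  moreover have "?rs ! Suc k = 0" by (simp add: nth_Cons')
  ultimately have "map2 (\<lambda>(T, h) (s, m). (T(h := s), h + m)) ?ts (instr_actions k IMark ?rs) =
      snd (config_of k x 1 (\<lambda>_. 0, 0, []))"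
    by (simp add: instr_actions_def map2_map_map fun_upd_idem)
  with step show ?thesis by (simp add: start_config_def)
qed

theorem polytime_computable_emitted: "polytime_computable (\<lambda>x. emitted x [length x] p)"
proof -
  \<comment> \<open>Register 0 receives the input length and becomes variable 0 of the emitter; the
    copy in register 1 is used up in bringing the input head back to cell 0.\<close>
  define main where "main = WhileT Bit (GoR ;; Inc 0 ;; Inc 1) ;; WhileT (Pos 1) (Dec 1 ;; GoL) ;; emit 1 p"
  define P where "P = IMark # compile 1 main"
  obtain k where k: "regs main \<subseteq> {..<k}" using finite_regs[of main] finite_nat_bounded by blast
  have main: "runs x main (\<lambda>_. 0, 0, []) (9 * length x + 2 + poly (emit_bound p) (length x))
     ((\<lambda>_. 0)(0 := length x), 0, emitted x [length x] p)" for x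
  proof -
    let ?n = "length x"
    let ?I = "\<lambda>i. ((\<lambda>_ :: nat. 0 :: nat)(0 := i, 1 := i), int i, [])"
    have 1: "runs x (WhileT Bit (GoR ;; Inc 0 ;; Inc 1)) (?I 0) (?n * (3 + 2) + 1) (?I ?n)"
    proof (rule runs_While)
      fix i assume i: "i < ?n"
      then show "holds x Bit (?I i)" by (simp add: word_tape_def)
      have "runs x (GoR ;; Inc 0 ;; Inc 1) (?I i) (1 + (1 + 1)) (?I (Suc i))"
        by (rule runs_eq[OF runs_Then[OF runs_atom(5) runs_Then[OF runs_atom(2) runs_atom(2)]]])
          (auto simp: fun_eq_iff)
      then show "runs x (GoR ;; Inc 0 ;; Inc 1) (?I i) 3 (?I (Suc i))" by (simp add: numeral_3_eq_3)
    qed (simp add: word_tape_def)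
    let ?f = "\<lambda>i. (\<lambda>_ :: nat. 0 :: nat)(0 := ?n, 1 := ?n - i)"
    have 2: "runs x (WhileT (Pos 1) (Dec 1 ;; GoL)) (?f 0, int ?n - int 0, []) (?n * (1 + 3) + 1) (?f ?n, int ?n - int ?n, [])"
    proof (rule runs_countdown[where f = ?f and h = "\<lambda>i. int ?n - int i" and w = "\<lambda>_. []"])
      fix i assume i: "i < ?n"
      show "runs x GoL ((?f i)(1 := ?n - Suc i), int ?n - int i, []) 1 (?f (Suc i), int ?n - int (Suc i), [])"
        by (rule runs_eq[OF runs_atom(6)]) (auto simp: fun_eq_iff)
    qed auto
    have 3: "runs x (emit 1 p) ((\<lambda>_. 0)(0 := ?n), 0, []) (poly (emit_bound p) ?n)
        ((\<lambda>_. 0)(0 := ?n), 0, [] @ emitted x [?n] p)"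
      by (rule runs_emit) auto
    have eq: "?I 0 = (\<lambda>_. 0, 0, [])" "?I ?n = (?f 0, int ?n - int 0, [])"
      "(?f ?n, int ?n - int ?n, []) = ((\<lambda>_. 0)(0 := ?n), 0, [] :: bool list)"
      by (auto simp: fun_eq_iff)
    show ?thesis unfolding main_def
      by (rule runs_mono[OF runs_eq[OF runs_Then[OF 1[unfolded eq(1,2)] runs_Then[OF 2[unfolded eq(3)] 3]]]]) simp_all
  qed
  let ?poly = "emit_bound p + [:3, 9:]"
  have "\<exists>t c. t \<le> poly ?poly (length x) \<and> (start_config (k + 2) x, c) \<in> tm_step (program_tm k P) ^^ t \<and>
        halted (program_tm k P) c \<and> fst (last (snd c)) = word_tape (emitted x [length x] p)" for x
  proof -
    obtain n where n: "n \<le> 9 * length x + 2 + poly (emit_bound p) (length x)"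
      and ex: "exec x main (\<lambda>_. 0, 0, []) n ((\<lambda>_. 0)(0 := length x), 0, emitted x [length x] p)"
      using main[of x] unfolding runs_def by blast
    let ?c = "config_of k x (1 + comp_len main) ((\<lambda>_. 0)(0 := length x), 0, emitted x [length x] p)"
    have "code_at P 1 (compile 1 main)" by (auto simp: code_at_def P_def)
    from exec_program_tm[OF ex this k] start_config_step[of P k x]
    have "(start_config (k + 2) x, ?c) \<in> tm_step (program_tm k P) ^^ Suc n"
      by (intro relpow_Suc_I2) (auto simp: P_def)
    moreover have "halted (program_tm k P) ?c"
      by (auto simp: halted_def tm_step_def program_tm_def P_def)
    ultimately show ?thesis using n by (intro exI[of _ "Suc n"] exI[of _ ?c]) (auto simp: algebra_simps)
  qed
  then show ?thesis unfolding polytime_computable_def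
    using turing_machine_program_tm deterministic_program_tm by blast
qed

section \<open>Tableaux of nondeterministic machines\<close>

lemma config_step_cells:
  assumes "length ts = k" "length as = k" "i < k"
  shows "map2 (\<lambda>(T, h) (s, m). (T(h := s), h + m)) ts as ! i =
    ((fst (ts ! i))(snd (ts ! i) := fst (as ! i)), snd (ts ! i) + snd (as ! i))"
  using assms by (simp add: case_prod_beta)

lemma config_step_stay:
  "map2 (\<lambda>(T, h) (s, m). (T(h := s), h + m)) ts (map (\<lambda>s. (s, 0 :: int)) (map (\<lambda>(T, h). T h) ts)) = ts"
  by (induction ts) auto

definition tapes_below :: "nat \<Rightarrow> nat \<Rightarrow> config \<Rightarrow> bool" where
  "tapes_below k G c \<longleftrightarrow> length (snd c) = k \<and> (\<forall>i<k. \<forall>z. fst (snd c ! i) z < G)"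

definition writes_below :: "nat \<Rightarrow> nat \<Rightarrow> transition set \<Rightarrow> bool" where
  "writes_below k G \<delta> \<longleftrightarrow> (\<forall>q rs q' as. (q, rs, q', as) \<in> \<delta> \<longrightarrow>
     length rs = k \<and> length as = k \<and> (\<forall>i<k. fst (as ! i) < G \<and> snd (as ! i) \<in> {-1, 0, 1}))"

lemma tapes_below_start: "k \<ge> 1 \<Longrightarrow> G \<ge> 3 \<Longrightarrow> tapes_below k G (start_config k x)"
  by (auto simp: tapes_below_def start_config_def word_tape_def nth_Cons')

lemma tapes_below_step:
  assumes "(c, c') \<in> tm_step \<delta>" "tapes_below k G c" "writes_below k G \<delta>"
  shows "tapes_below k G c'"
proof -
  obtain q ts q' as where c: "c = (q, ts)" "c' = (q', map2 (\<lambda>(T, h) (s, m). (T(h := s), h + m)) ts as)"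
    and d: "(q, map (\<lambda>(T, h). T h) ts, q', as) \<in> \<delta>"
    using assms(1) unfolding tm_step_def by auto
  have "length ts = k" "length as = k" "\<forall>i<k. fst (as ! i) < G"
    using assms(2,3) d unfolding c tapes_below_def writes_below_def by auto
  then show ?thesis using assms(2) unfolding c tapes_below_def
    by (simp add: case_prod_beta)
qed

lemma tapes_below_steps:
  assumes "(c, c') \<in> tm_step \<delta> ^^ n" "tapes_below k G c" "writes_below k G \<delta>"
  shows "tapes_below k G c'"
  using assms(1)
proof (induction n arbitrary: c')
  case (Suc n)
  then show ?case using tapes_below_step[OF _ _ assms(3)] by (meson relpow_Suc_E)
qed (use assms in simp)

text \<open>Adding moves that lead from every halted configuration in state 1 into a fresh idling
  state turns acceptance into reachability of that state in a number of steps known in advance.\<close>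

lemma NP_clocked:
  assumes "L \<in> NP"
  obtains k ds qf G and p :: "nat poly" where "k \<ge> 1" "G \<ge> 3" "ds \<noteq> []" "writes_below k G (set ds)"
    "\<And>x. x \<in> L \<longleftrightarrow> (\<exists>c. (start_config k x, c) \<in> tm_step (set ds) ^^ Suc (poly p (length x)) \<and> fst c = qf)"
proof -
  obtain k \<delta> and p :: "nat poly" where tm: "turing_machine k \<delta>"
    and time: "\<And>x t c. (start_config k x, c) \<in> tm_step \<delta> ^^ t \<Longrightarrow> t \<le> poly p (length x)"
    and acc: "\<And>x. x \<in> L \<longleftrightarrow> (\<exists>c. (start_config k x, c) \<in> (tm_step \<delta>)\<^sup>* \<and> halted \<delta> c \<and> fst c = 1)"
    using assms unfolding NP_def mem_Collect_eq by blast
  have k: "k \<ge> 1" and fin: "finite \<delta>" using tm unfolding turing_machine_def by auto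
  define symbols where "symbols = (\<lambda>(q, rs, q', as). Max (fst ` set as \<union> {0})) ` \<delta>"
  have "finite symbols" unfolding symbols_def using fin by simp
  then obtain G0 where G0: "symbols \<subseteq> {..<G0}" using finite_nat_bounded by blast
  define G where "G = G0 + 3"
  have wb: "writes_below k G \<delta>"
    unfolding writes_below_def
  proof (intro allI impI)
    fix q rs q' as assume d: "(q, rs, q', as) \<in> \<delta>"
    have "\<forall>tr\<in>\<delta>. case tr of (q, rs, q', as) \<Rightarrow> length rs = k \<and> length as = k \<and> (\<forall>(s, m) \<in> set as. m \<in> {-1, 0, 1})"
      using tm unfolding turing_machine_def by blast
    from bspec[OF this d] have l: "length rs = k" "length as = k"
      and m: "\<forall>(s, m) \<in> set as. m \<in> {-1, 0, 1}" by auto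
    have "Max (fst ` set as \<union> {0}) \<in> symbols" unfolding symbols_def using d by force
    then have "Max (fst ` set as \<union> {0}) < G" using G0 unfolding G_def by fastforce
    then have "s < G" if "s \<in> fst ` set as" for s using that by auto
    then have "fst (as ! i) < G" if "i < k" for i using that l by simp
    moreover have "snd (as ! i) \<in> {-1, 0, 1}" if "i < k" for i
      using m l that nth_mem[of i as] by (cases "as ! i") fastforce
    ultimately show "length rs = k \<and> length as = k \<and> (\<forall>i<k. fst (as ! i) < G \<and> snd (as ! i) \<in> {-1, 0, 1})"
      using l by blast
  qed
  have "finite ((\<lambda>(q, rs, q', as). max q q') ` \<delta>)" using fin by simp
  then obtain q0 where q0: "(\<lambda>(q, rs, q', as). max q q') ` \<delta> \<subseteq> {..<q0}" using finite_nat_bounded by blast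
  \<comment> \<open>Above all states of the machine, and different from the special states 0 and
    1.\<close>
  define qf where "qf = q0 + 2"
  have fresh: "q < qf \<and> q' < qf" if "(q, rs, q', as) \<in> \<delta>" for q rs q' as
    using subsetD[OF q0 imageI[OF that]] unfolding qf_def by simp
  define R where "R = {rs :: nat list. set rs \<subseteq> {..<G} \<and> length rs = k}"
  have finR: "finite R" unfolding R_def by (rule finite_lists_length_eq) simp
  define stay where "stay = (\<lambda>rs :: nat list. map (\<lambda>s. (s, 0 :: int)) rs)"
  \<comment> \<open>Only readings for which state 1 has no transition, that is, exactly the halted
    accepting situations. The symbols read are written back unchanged.\<close>
  define final where "final = {(1 :: nat, rs, qf, stay rs) | rs. rs \<in> R \<and> \<not> (\<exists>y. (1, rs, y) \<in> \<delta>)}"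
  define idle where "idle = (\<lambda>rs. (qf, rs, qf, stay rs)) ` R"
  define \<epsilon> where "\<epsilon> = \<delta> \<union> final \<union> idle"
  have "final \<subseteq> (\<lambda>rs. (1, rs, qf, stay rs)) ` R" unfolding final_def by auto
  then have "finite \<epsilon>" unfolding \<epsilon>_def idle_def using fin finR by (auto intro: finite_subset)
  then obtain ds where ds: "set ds = \<epsilon>" using finite_list by blast
  have "replicate k 0 \<in> R" unfolding R_def by (auto simp: G_def)
  then have "ds \<noteq> []" using ds unfolding \<epsilon>_def idle_def by auto
  have wb': "writes_below k G \<epsilon>"
    unfolding writes_below_def
  proof (intro allI impI)
    fix q rs q' as assume "(q, rs, q', as) \<in> \<epsilon>"
    then consider "(q, rs, q', as) \<in> \<delta>" | "rs \<in> R" "as = stay rs"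
      unfolding \<epsilon>_def final_def idle_def by auto
    then show "length rs = k \<and> length as = k \<and> (\<forall>i<k. fst (as ! i) < G \<and> snd (as ! i) \<in> {-1, 0, 1})"
    proof cases
      case 1
      then show ?thesis using wb unfolding writes_below_def by blast
    next
      case 2
      then have "rs ! i < G" if "i < k" for i using that nth_mem[of i rs] unfolding R_def by blast
      then show ?thesis using 2 by (simp add: R_def stay_def)
    qed
  qed
  have read: "map (\<lambda>(T, h). T h) ts \<in> R" if "tapes_below k G (q, ts)" for q ts
    using that unfolding R_def tapes_below_def by (force simp: in_set_conv_nth)
  have start: "tapes_below k G (start_config k x)" for x
    using tapes_below_start k by (simp add: G_def)
  have fwd: "\<exists>c. (start_config k x, c) \<in> tm_step \<epsilon> ^^ Suc (poly p (length x)) \<and> fst c = qf" if xL: "x \<in> L" for x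
  proof -
    obtain c where reach: "(start_config k x, c) \<in> (tm_step \<delta>)\<^sup>*" and h: "halted \<delta> c" and c1: "fst c = 1"
      using iffD1[OF acc xL] by (elim exE conjE)
    obtain n where n: "(start_config k x, c) \<in> tm_step \<delta> ^^ n"
      using rtrancl_imp_relpow[OF reach] by (elim exE)
    have "n \<le> poly p (length x)" by (rule time[OF n])
    obtain ts where c: "c = (1, ts)" using c1 by (cases c) simp
    have rd: "map (\<lambda>(T, h). T h) ts \<in> R"
      by (rule read[OF tapes_below_steps[OF n start wb, unfolded c]])
    have "\<nexists>y. (1, map (\<lambda>(T, h). T h) ts, y) \<in> \<delta>"
    proof
      assume "\<exists>y. (1, map (\<lambda>(T, h). T h) ts, y) \<in> \<delta>"
      then obtain q' as where "(1, map (\<lambda>(T, h). T h) ts, q', as) \<in> \<delta>" by auto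
      then have "(c, (q', map2 (\<lambda>(T, h) (s, m). (T(h := s), h + m)) ts as)) \<in> tm_step \<delta>"
        unfolding tm_step_def c by blast
      then show False using h unfolding halted_def by blast
    qed
    then have "(1, map (\<lambda>(T, h). T h) ts, qf, stay (map (\<lambda>(T, h). T h) ts)) \<in> \<epsilon>"
      using rd unfolding \<epsilon>_def final_def by blast
    then have "(c, (qf, map2 (\<lambda>(T, h) (s, m). (T(h := s), h + m)) ts (stay (map (\<lambda>(T, h). T h) ts)))) \<in> tm_step \<epsilon>"
      unfolding tm_step_def c by blast
    then have s1: "(c, (qf, ts)) \<in> tm_step \<epsilon>" unfolding stay_def config_step_stay .
    have "(qf, map (\<lambda>(T, h). T h) ts, qf, stay (map (\<lambda>(T, h). T h) ts)) \<in> \<epsilon>"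
      using rd unfolding \<epsilon>_def idle_def by blast
    then have "((qf, ts), (qf, map2 (\<lambda>(T, h) (s, m). (T(h := s), h + m)) ts (stay (map (\<lambda>(T, h). T h) ts)))) \<in> tm_step \<epsilon>"
      unfolding tm_step_def by blast
    then have s2: "((qf, ts), (qf, ts)) \<in> tm_step \<epsilon>" unfolding stay_def config_step_stay .
    have s3: "((qf, ts), (qf, ts)) \<in> tm_step \<epsilon> ^^ m" for m
      by (induction m) (use s2 in auto)
    have "tm_step \<delta> \<subseteq> tm_step \<epsilon>" unfolding tm_step_def \<epsilon>_def by blast
    then have "tm_step \<delta> ^^ m \<subseteq> tm_step \<epsilon> ^^ m" for m by (induction m) auto
    then have "(start_config k x, c) \<in> tm_step \<epsilon> ^^ n" using n by blast
    from relpow_trans[OF relpow_Suc_I[OF this s1] s3[of "poly p (length x) - n"]]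
    have "(start_config k x, (qf, ts)) \<in> tm_step \<epsilon> ^^ (Suc n + (poly p (length x) - n))" .
    moreover have "Suc n + (poly p (length x) - n) = Suc (poly p (length x))" using \<open>n \<le> _\<close> by simp
    ultimately show ?thesis by (metis fst_conv)
  qed
  \<comment> \<open>Follow the run up to its first new move. This cannot be an idling move, since
    the start is not in \<open>qf\<close>; so it comes from a halted configuration in state
    1.\<close>
  have bwd: "\<exists>c'. (c0, c') \<in> (tm_step \<delta>)\<^sup>* \<and> halted \<delta> c' \<and> fst c' = 1"
    if "(c0, c) \<in> tm_step \<epsilon> ^^ n" "fst c = qf" "fst c0 \<noteq> qf" for c0 c n
    using that
  proof (induction n arbitrary: c0)
    case 0
    then show ?case by simp
  next
    case (Suc n)
    then obtain c1 where s: "(c0, c1) \<in> tm_step \<epsilon>" and r: "(c1, c) \<in> tm_step \<epsilon> ^^ n"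
      by (meson relpow_Suc_E2)
    obtain q ts q' as where c: "c0 = (q, ts)" "c1 = (q', map2 (\<lambda>(T, h) (s, m). (T(h := s), h + m)) ts as)"
      and d: "(q, map (\<lambda>(T, h). T h) ts, q', as) \<in> \<epsilon>"
      using s unfolding tm_step_def by auto
    from d consider "(q, map (\<lambda>(T, h). T h) ts, q', as) \<in> \<delta>"
      | "q = 1" "\<nexists>y. (1, map (\<lambda>(T, h). T h) ts, y) \<in> \<delta>" | "q = qf"
      unfolding \<epsilon>_def final_def idle_def by auto
    then show ?case
    proof cases
      case 1
      then have "(c0, c1) \<in> tm_step \<delta>" unfolding tm_step_def c by blast
      moreover have "fst c1 \<noteq> qf" using fresh[OF 1] by (simp add: c)
      ultimately show ?thesis using Suc.IH[OF r Suc.prems(2)] by (meson converse_rtrancl_into_rtrancl)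
    next
      case 2
      then have "halted \<delta> c0" unfolding halted_def tm_step_def c by auto
      then show ?thesis using 2 c by auto
    next
      case 3
      then show ?thesis using Suc.prems c by simp
    qed
  qed
  have iff: "x \<in> L \<longleftrightarrow> (\<exists>c. (start_config k x, c) \<in> tm_step \<epsilon> ^^ Suc (poly p (length x)) \<and> fst c = qf)" for x
  proof
    assume "\<exists>c. (start_config k x, c) \<in> tm_step \<epsilon> ^^ Suc (poly p (length x)) \<and> fst c = qf"
    then obtain c where "(start_config k x, c) \<in> tm_step \<epsilon> ^^ Suc (poly p (length x))" "fst c = qf" by blast
    moreover have "fst (start_config k x) \<noteq> qf" by (simp add: start_config_def qf_def)
    ultimately show "x \<in> L" using bwd acc by blast
  qed (rule fwd)
  have "G \<ge> 3" by (simp add: G_def)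
  show thesis by (rule that[OF k \<open>G \<ge> 3\<close> \<open>ds \<noteq> []\<close> wb'[folded ds] iff[folded ds]])
qed

section \<open>Computations as constraints on moves and tape cells\<close>

definition cell :: "config \<Rightarrow> nat \<Rightarrow> int \<Rightarrow> nat" where
  "cell c i z = fst (snd c ! i) (snd (snd c ! i) + z)"

text \<open>\<open>Y t d\<close>: move \<open>d\<close> is made at time \<open>t\<close>. \<open>C t i P s\<close>: at time \<open>t\<close>, tape \<open>i\<close> has symbol \<open>s\<close> in
  position \<open>P\<close>, where positions are relative to the head, which stays in position \<open>T + 1\<close>.\<close>

locale clocked_machine =
  fixes k :: nat and ds :: "transition list" and qf G :: nat
  assumes k: "k \<ge> 1" and G: "G \<ge> 3" and ds: "ds \<noteq> []" and wb: "writes_below k G (set ds)"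
begin

definition src :: "nat \<Rightarrow> nat" where "src d = fst (ds ! d)"
definition rd :: "nat \<Rightarrow> nat list" where "rd d = fst (snd (ds ! d))"
definition dst :: "nat \<Rightarrow> nat" where "dst d = fst (snd (snd (ds ! d)))"
definition wr :: "nat \<Rightarrow> nat \<Rightarrow> nat" where "wr d i = fst (snd (snd (snd (ds ! d))) ! i)"
definition mv :: "nat \<Rightarrow> nat \<Rightarrow> int" where "mv d i = snd (snd (snd (snd (ds ! d))) ! i)"

text \<open>Both subtractions are truncated: the factor \<open>1 - ((T + 1) - P)\<close> is 1 from
  the head position \<open>T + 1\<close> on and 0 to the left of it, where the tape is
  blank.\<close>

definition init_cell :: "nat \<Rightarrow> bool list \<Rightarrow> nat \<Rightarrow> nat \<Rightarrow> nat" where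
  "init_cell T x i P = (if i = 0 then word_tape x (int (P - (T + 1))) * (1 - ((T + 1) - P)) else 0)"

text \<open>No clause demands that only one move is made or that a cell has only one symbol. All
  clauses push truth forward from the initial cells, so additional true variables can only make the
  constraints harder to satisfy. Since positions are relative to the head, a move by
  \<open>m\<close> shifts position \<open>P + 1\<close> to \<open>P + (1 - m)\<close>, which is
  never negative.\<close>

definition tableau :: "nat \<Rightarrow> bool list \<Rightarrow> (nat \<Rightarrow> nat \<Rightarrow> bool) \<Rightarrow> (nat \<Rightarrow> nat \<Rightarrow> nat \<Rightarrow> nat \<Rightarrow> bool) \<Rightarrow> bool" where
  "tableau T x Y C \<longleftrightarrow>
     (\<forall>t<T. \<exists>d<length ds. Y t d) \<and>
     (\<forall>t<T. \<forall>d<length ds. \<forall>d'<length ds. dst d \<noteq> src d' \<longrightarrow> \<not> Y t d \<or> \<not> Y (t + 1) d') \<and>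
     (\<forall>d<length ds. src d \<noteq> 0 \<longrightarrow> \<not> Y 0 d) \<and>
     (\<forall>d<length ds. dst d \<noteq> qf \<longrightarrow> \<not> Y (T - 1) d) \<and>
     (\<forall>t<T. \<forall>d<length ds. \<forall>i<k. \<forall>s<G. s \<noteq> rd d ! i \<longrightarrow> \<not> Y t d \<or> \<not> C t i (T + 1) s) \<and>
     (\<forall>t<T. \<forall>P<2 * T + 1. \<forall>d<length ds. \<forall>i<k. \<forall>s<G. \<not> Y t d \<or> \<not> C t i (P + 1) s \<or>
        C (t + 1) i (P + nat (1 - mv d i)) (if P + 1 = T + 1 then wr d i else s)) \<and>
     (\<forall>P<2 * T + 1. \<forall>i<k. C 0 i (P + 1) (init_cell T x i (P + 1)))"

lemma move_facts:
  assumes "d < length ds"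
  shows "length (rd d) = k" "i < k \<Longrightarrow> wr d i < G" "i < k \<Longrightarrow> mv d i \<in> {-1, 0, 1}"
    "ds ! d = (src d, rd d, dst d, snd (snd (snd (ds ! d))))" "length (snd (snd (snd (ds ! d)))) = k"
proof -
  obtain q rs q' as where e: "ds ! d = (q, rs, q', as)" by (cases "ds ! d")
  then have "(q, rs, q', as) \<in> set ds" using assms nth_mem by metis
  then have "length rs = k \<and> length as = k \<and> (\<forall>i<k. fst (as ! i) < G \<and> snd (as ! i) \<in> {-1, 0, 1})"
    using wb unfolding writes_below_def by blast
  then show "length (rd d) = k" "i < k \<Longrightarrow> wr d i < G" "i < k \<Longrightarrow> mv d i \<in> {-1, 0, 1}"
    "ds ! d = (src d, rd d, dst d, snd (snd (snd (ds ! d))))" "length (snd (snd (snd (ds ! d)))) = k"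
    unfolding rd_def wr_def mv_def src_def dst_def by (simp_all add: e)
qed

definition move :: "nat \<Rightarrow> config \<Rightarrow> config" where
  "move d c = (dst d, map2 (\<lambda>(T, h) (s, m). (T(h := s), h + m)) (snd c) (snd (snd (snd (ds ! d)))))"

lemma cell_move:
  assumes "d < length ds" "i < k" "length (snd c) = k"
  shows "cell (move d c) i z = (if z + mv d i = 0 then wr d i else cell c i (z + mv d i))"
  using config_step_cells[OF assms(3) move_facts(5)[OF assms(1)] assms(2)] assms
  by (auto simp: cell_def move_def mv_def wr_def add_ac)

lemma cell_start:
  assumes "i < k" "P < 2 * T + 1"
  shows "cell (start_config k x) i (int (P + 1) - int (T + 1)) = init_cell T x i (P + 1)"
proof (cases "i = 0")
  case True
  then show ?thesis
    by (auto simp: cell_def start_config_def init_cell_def word_tape_def of_nat_diff)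
next
  case False
  then show ?thesis using assms by (simp add: cell_def start_config_def init_cell_def nth_Cons')
qed

lemma step_iff_move:
  assumes "length (snd c) = k"
  shows "(c, c') \<in> tm_step (set ds) \<longleftrightarrow>
    (\<exists>d<length ds. fst c = src d \<and> (\<forall>i<k. cell c i 0 = rd d ! i) \<and> c' = move d c)"
proof -
  have rd: "map (\<lambda>(T, h). T h) (snd c) = rd d \<longleftrightarrow> (\<forall>i<k. cell c i 0 = rd d ! i)" if "d < length ds" for d
    using move_facts(1)[OF that] assms by (auto simp: list_eq_iff_nth_eq cell_def case_prod_beta)
  have "(c, c') \<in> tm_step (set ds) \<longleftrightarrow>
    (\<exists>d<length ds. fst c = src d \<and> map (\<lambda>(T, h). T h) (snd c) = rd d \<and> c' = move d c)" (is "?l \<longleftrightarrow> ?r")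
  proof
    assume ?l
    then obtain q ts q' as where c: "c = (q, ts)" "c' = (q', map2 (\<lambda>(T, h) (s, m). (T(h := s), h + m)) ts as)"
      and d: "(q, map (\<lambda>(T, h). T h) ts, q', as) \<in> set ds"
      unfolding tm_step_def by auto
    obtain n where "n < length ds" "ds ! n = (q, map (\<lambda>(T, h). T h) ts, q', as)"
      using d unfolding in_set_conv_nth by blast
    then show ?r by (intro exI[of _ n]) (simp add: c src_def rd_def dst_def move_def)
  next
    assume ?r
    then obtain d where d: "d < length ds" "fst c = src d" "map (\<lambda>(T, h). T h) (snd c) = rd d" "c' = move d c"
      by blast
    have "(fst c, map (\<lambda>(T, h). T h) (snd c), dst d, snd (snd (snd (ds ! d)))) \<in> set ds"
      using nth_mem[OF d(1)] unfolding d(2,3) by (subst (asm) move_facts(4)[OF d(1)])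
    then have "((fst c, snd c), move d c) \<in> tm_step (set ds)" unfolding move_def tm_step_def by blast
    then show ?l unfolding d(4) prod.collapse .
  qed
  then show ?thesis using rd by auto
qed

text \<open>Select any true move at each time and run the machine with these moves. The variables of
  the symbols that really occur are true in a window that loses one position on either side per
  step. Up to time \<open>T\<close> the window contains the head position \<open>T + 1\<close>, so
  every selected move is applicable.\<close>

lemma tableau_sound:
  assumes "tableau T x Y C" "T > 0"
  shows "\<exists>c. (start_config k x, c) \<in> tm_step (set ds) ^^ T \<and> fst c = qf"
proof -
  note tab = assms(1)[unfolded tableau_def]
  have tab1: "\<And>t. t < T \<Longrightarrow> \<exists>d<length ds. Y t d"
    and tab2: "\<And>t d d'. t < T \<Longrightarrow> d < length ds \<Longrightarrow> d' < length ds \<Longrightarrow> Y t d \<Longrightarrow> Y (t + 1) d' \<Longrightarrow> dst d = src d'"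
    and tab3: "\<And>d. d < length ds \<Longrightarrow> Y 0 d \<Longrightarrow> src d = 0"
    and tab4: "\<And>d. d < length ds \<Longrightarrow> Y (T - 1) d \<Longrightarrow> dst d = qf"
    and tab5: "\<And>t d i s. t < T \<Longrightarrow> d < length ds \<Longrightarrow> i < k \<Longrightarrow> s < G \<Longrightarrow> Y t d \<Longrightarrow> C t i (T + 1) s \<Longrightarrow> s = rd d ! i"
    and tab6: "\<And>t P d i s. t < T \<Longrightarrow> P < 2 * T + 1 \<Longrightarrow> d < length ds \<Longrightarrow> i < k \<Longrightarrow> s < G \<Longrightarrow> Y t d \<Longrightarrow> C t i (P + 1) s \<Longrightarrow>
        C (t + 1) i (P + nat (1 - mv d i)) (if P + 1 = T + 1 then wr d i else s)"
    and tab7: "\<And>P i. P < 2 * T + 1 \<Longrightarrow> i < k \<Longrightarrow> C 0 i (P + 1) (init_cell T x i (P + 1))"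
    using tab by meson+
  obtain f where f: "\<And>t. t < T \<Longrightarrow> f t < length ds \<and> Y t (f t)" using tab1 by metis
  define \<rho> where "\<rho> = rec_nat (start_config k x) (\<lambda>t c. move (f t) c)"
  have \<rho>: "\<rho> 0 = start_config k x" "\<rho> (Suc t) = move (f t) (\<rho> t)" for t
    by (simp_all add: \<rho>_def)
  have inv: "tapes_below k G (\<rho> t) \<and> (\<forall>i<k. \<forall>P. t < P \<longrightarrow> P + t \<le> 2 * T + 1 \<longrightarrow> C t i P (cell (\<rho> t) i (int P - int (T + 1))))
     \<and> (t < T \<longrightarrow> fst (\<rho> t) = src (f t)) \<and> (start_config k x, \<rho> t) \<in> tm_step (set ds) ^^ t" if "t \<le> T" for t
    using that
  proof (induction t)
    case 0
    have "C 0 i P (cell (start_config k x) i (int P - int (T + 1)))" if "i < k" "0 < P" "P \<le> 2 * T + 1" for i P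
    proof -
      have "C 0 i (P - 1 + 1) (init_cell T x i (P - 1 + 1))" using that by (intro tab7) auto
      then show ?thesis using cell_start[of i "P - 1" T x] that by simp
    qed
    moreover have "fst (\<rho> 0) = src (f 0)" using tab3[of "f 0"] f[of 0] assms(2) by (simp add: \<rho> start_config_def)
    ultimately show ?case using tapes_below_start[OF k G] by (simp add: \<rho>)
  next
    case (Suc t)
    then have t: "t < T" and tb: "tapes_below k G (\<rho> t)" and len: "length (snd (\<rho> t)) = k"
      and C: "\<And>i P. i < k \<Longrightarrow> t < P \<Longrightarrow> P + t \<le> 2 * T + 1 \<Longrightarrow> C t i P (cell (\<rho> t) i (int P - int (T + 1)))"
      and src: "fst (\<rho> t) = src (f t)" and reach: "(start_config k x, \<rho> t) \<in> tm_step (set ds) ^^ t"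
      unfolding tapes_below_def by auto
    note ft = f[OF t]
    have below: "cell (\<rho> t) i z < G" if "i < k" for i z using tb that unfolding tapes_below_def cell_def by blast
    have "cell (\<rho> t) i 0 = rd (f t) ! i" if "i < k" for i
    proof -
      have "C t i (T + 1) (cell (\<rho> t) i 0)" using C[OF that, of "T + 1"] t by simp
      then show ?thesis using tab5 t ft that below by blast
    qed
    then have step: "(\<rho> t, \<rho> (Suc t)) \<in> tm_step (set ds)"
      using step_iff_move[OF len] ft src \<rho> by blast
    have "C (Suc t) i P (cell (\<rho> (Suc t)) i (int P - int (T + 1)))"
      if i: "i < k" and P: "Suc t < P" "P + Suc t \<le> 2 * T + 1" for i P
    proof -
      let ?m = "mv (f t) i"
      have m: "?m \<in> {-1, 0, 1}" using move_facts(3) ft i by blast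
      \<comment> \<open>\<open>P' + 1\<close> is the position before the move of the cell that is
        now in position \<open>P\<close>.\<close>
      define P' where "P' = nat (int P + ?m - 1)"
      have P': "int P' = int P + ?m - 1" "P' + nat (1 - ?m) = P" "P' < 2 * T + 1" "t < P' + 1" "P' + 1 + t \<le> 2 * T + 1"
        using m P by (auto simp: P'_def)
      let ?s = "cell (\<rho> t) i (int (P' + 1) - int (T + 1))"
      have "C (t + 1) i P (if P' + 1 = T + 1 then wr (f t) i else ?s)"
        using tab6[OF t P'(3) _ i below[OF i] _ C[OF i P'(4,5)], of "f t"] ft unfolding P'(2) by blast
      moreover have "(int P - int (T + 1) + ?m = 0) = (P' + 1 = T + 1)"
        "int P - int (T + 1) + ?m = int (P' + 1) - int (T + 1)" using P'(1) by linarith+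
      then have "cell (\<rho> (Suc t)) i (int P - int (T + 1)) = (if P' + 1 = T + 1 then wr (f t) i else ?s)"
        by (simp only: \<rho> cell_move[OF conjunct1[OF ft] i len])
      ultimately show ?thesis by simp
    qed
    moreover have "fst (\<rho> (Suc t)) = src (f (Suc t))" if "Suc t < T"
      using tab2[OF t, of "f t" "f (Suc t)"] ft f[OF that] by (simp add: \<rho> move_def)
    ultimately show ?case using tapes_below_step[OF step tb wb] relpow_Suc_I[OF reach step] by blast
  qed
  obtain t where t: "T = Suc t" using assms(2) by (cases T) auto
  have "dst (f t) = qf" using tab4[of "f t"] f[of t] t by auto
  then have "fst (\<rho> T) = qf" by (simp add: t \<rho> move_def)
  then show ?thesis using inv[of T] by blast
qed

text \<open>Making \<open>Y\<close> false from time \<open>T\<close> on satisfies the clauses on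
  successive states at the last step, which mention a move at time \<open>T\<close>.\<close>

lemma tableau_complete:
  assumes "(start_config k x, c) \<in> tm_step (set ds) ^^ T" "fst c = qf" "T > 0"
  shows "\<exists>f \<rho>. tableau T x (\<lambda>t d. t < T \<and> d = f t) (\<lambda>t i P s. cell (\<rho> t) i (int P - int (T + 1)) = s)"
proof -
  obtain \<rho> where \<rho>: "\<rho> 0 = start_config k x" "\<rho> T = c" "\<And>t. t < T \<Longrightarrow> (\<rho> t, \<rho> (Suc t)) \<in> tm_step (set ds)"
    using assms(1) unfolding relpow_fun_conv by blast
  have len: "tapes_below k G (\<rho> t)" if "t \<le> T" for t
    using that
  proof (induction t)
    case 0
    then show ?case using tapes_below_start k G by (simp add: \<rho>)
  next
    case (Suc t)
    then show ?case using tapes_below_step[OF \<rho>(3)[of t] _ wb] by simp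
  qed
  have "\<exists>d<length ds. fst (\<rho> t) = src d \<and> (\<forall>i<k. cell (\<rho> t) i 0 = rd d ! i) \<and> \<rho> (Suc t) = move d (\<rho> t)"
    if "t < T" for t
    using step_iff_move[of "\<rho> t"] len[of t] \<rho>(3)[OF that] that by (simp add: tapes_below_def)
  then obtain f where f: "\<And>t. t < T \<Longrightarrow> f t < length ds \<and> fst (\<rho> t) = src (f t) \<and>
      (\<forall>i<k. cell (\<rho> t) i 0 = rd (f t) ! i) \<and> \<rho> (Suc t) = move (f t) (\<rho> t)" by metis
  have dst: "fst (\<rho> (Suc t)) = dst (f t)" if "t < T" for t using f[OF that] by (simp add: move_def)
  have cell: "cell (\<rho> (Suc t)) i (int (P + nat (1 - mv (f t) i)) - int (T + 1)) =
     (if P + 1 = T + 1 then wr (f t) i else cell (\<rho> t) i (int (P + 1) - int (T + 1)))"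
    if "t < T" "i < k" for t i P
  proof -
    have "mv (f t) i \<in> {-1, 0, 1}" using move_facts(3) f that by blast
    then have "int (P + nat (1 - mv (f t) i)) - int (T + 1) + mv (f t) i = int (P + 1) - int (T + 1)"
      by auto
    then show ?thesis using f[OF that(1)] cell_move[of "f t" i "\<rho> t"] that len[of t]
      by (auto simp: tapes_below_def)
  qed
  have "fst (\<rho> 0) = 0" by (simp add: \<rho> start_config_def)
  moreover have "dst (f (T - 1)) = qf" using dst[of "T - 1"] assms \<rho> by simp
  ultimately have "tableau T x (\<lambda>t d. t < T \<and> d = f t) (\<lambda>t i P s. cell (\<rho> t) i (int P - int (T + 1)) = s)"
    unfolding tableau_def
  proof (intro conjI allI impI)
    fix t assume "t < T"
    then show "\<exists>d<length ds. t < T \<and> d = f t" using f by blast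
  next
    fix t d d' assume "t < T" "dst d \<noteq> src d'"
    then show "\<not> (t < T \<and> d = f t) \<or> \<not> (t + 1 < T \<and> d' = f (t + 1))"
      using dst[of t] f[of "t + 1"] by auto
  next
    fix d assume "fst (\<rho> 0) = 0" "src d \<noteq> 0"
    then show "\<not> (0 < T \<and> d = f 0)" using f[of 0] by auto
  next
    fix d assume "dst (f (T - 1)) = qf" "dst d \<noteq> qf"
    then show "\<not> (T - 1 < T \<and> d = f (T - 1))" by auto
  next
    fix t d i s assume "t < T" "i < k" "s \<noteq> rd d ! i"
    then show "\<not> (t < T \<and> d = f t) \<or> cell (\<rho> t) i (int (T + 1) - int (T + 1)) \<noteq> s"
      using f[of t] by auto
  next
    fix t P d i s assume "t < T" "i < k"
    then show "\<not> (t < T \<and> d = f t) \<or> cell (\<rho> t) i (int (P + 1) - int (T + 1)) \<noteq> s \<or>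
      cell (\<rho> (t + 1)) i (int (P + nat (1 - mv d i)) - int (T + 1)) = (if P + 1 = T + 1 then wr d i else s)"
      using cell[of t i P] by auto
  next
    fix P i assume "P < 2 * T + 1" "i < k"
    then show "cell (\<rho> 0) i (int (P + 1) - int (T + 1)) = init_cell T x i (P + 1)"
      using cell_start by (simp add: \<rho>)
  qed
  then show ?thesis by blast
qed


text \<open>A number in mixed radix with digits kind, time and position. Kinds below
  \<open>length ds\<close> are moves, used with position 0; then come the pairs of tape and symbol.
  Radix \<open>T + 2\<close> leaves room for the time \<open>t + 1\<close>.\<close>

definition var_id :: "nat \<Rightarrow> nat \<Rightarrow> nat \<Rightarrow> nat \<Rightarrow> nat" where
  "var_id T \<kappa> t P = \<kappa> + (length ds + k * G) * (t + (T + 2) * P)"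

lemma add_mult_div_mod: "a < b \<Longrightarrow> (a + b * c) mod b = a" "a < b \<Longrightarrow> (a + b * c) div b = c" for a b c :: nat
  by simp_all

lemma var_id_decode:
  assumes "\<kappa> < length ds + k * G" "t < T + 2"
  shows "var_id T \<kappa> t P mod (length ds + k * G) = \<kappa>"
    "var_id T \<kappa> t P div (length ds + k * G) mod (T + 2) = t"
    "var_id T \<kappa> t P div (length ds + k * G) div (T + 2) = P"
  unfolding var_id_def add_mult_div_mod[OF assms(1)] add_mult_div_mod[OF assms(2)] by (rule refl)+

lemma var_id_less:
  assumes "\<kappa> < length ds + k * G" "t < T + 2" "P < 2 * T + 3"
  shows "var_id T \<kappa> t P < (length ds + k * G) * ((T + 2) * (2 * T + 3))"
proof -
  have nest: "a + A * b < A * B" if "a < A" "b < B" for a A b B :: nat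
  proof -
    have "a + A * b < A * Suc b" using that by simp
    also have "\<dots> \<le> A * B" using that by (intro mult_le_mono) auto
    finally show ?thesis .
  qed
  show ?thesis unfolding var_id_def using assms by (intro nest)
qed

lemma symbol_index_less: "i < k \<Longrightarrow> s < G \<Longrightarrow> length ds + i * G + s < length ds + k * G"
proof -
  assume "i < k" "s < G"
  then have "i * G + s < Suc i * G" by simp
  also have "\<dots> \<le> k * G" using \<open>i < k\<close> by (intro mult_le_mono) auto
  finally show ?thesis by simp
qed

end

section \<open>Clause templates as arithmetic expressions\<close>

fun poly_aexp :: "nat list \<Rightarrow> aexp" where
  "poly_aexp [] = Cst 0"
| "poly_aexp (c # cs) = Add (Cst c) (Mul (Var 0) (poly_aexp cs))"

text \<open>The added step is the move into the idling state; \<open>poly_aexp\<close> is Horner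
  evaluation at the input length.\<close>

definition clock :: "nat poly \<Rightarrow> aexp" where
  "clock p = Add (poly_aexp (coeffs p)) (Cst 1)"

lemma aval_clock [simp]: "aval x (n # e) (clock p) = Suc (poly p n)"
proof -
  have "aval x (n # e) (poly_aexp cs) = foldr (\<lambda>a b. a + n * b) cs 0" for cs
    by (induction cs) auto
  then show ?thesis by (simp add: clock_def poly_def fold_coeffs_def horner_sum_foldr)
qed

text \<open>The sum of the two truncated differences is the absolute difference, so the outer
  subtraction gives 1 for equality and 0 otherwise.\<close>

definition eqx :: "aexp \<Rightarrow> aexp \<Rightarrow> aexp" where
  "eqx a b = Sub (Cst 1) (Add (Sub a b) (Sub b a))"

definition ifx :: "aexp \<Rightarrow> aexp \<Rightarrow> aexp \<Rightarrow> aexp" where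
  "ifx c a b = Add (Mul c a) (Mul (Sub (Cst 1) c) b)"

lemma aval_eqx [simp]: "aval x e (eqx a b) = (if aval x e a = aval x e b then 1 else 0)"
  by (simp add: eqx_def)

lemma aval_ifx: "aval x e c = (if P then 1 else 0) \<Longrightarrow> aval x e (ifx c a b) = (if P then aval x e a else aval x e b)"
  by (simp add: ifx_def)

text \<open>Clause templates: \<open>Var 1\<close> is the time and \<open>Var 3\<close> the tape position.\<close>

definition cnf_env :: "bool list \<Rightarrow> nat \<Rightarrow> nat \<Rightarrow> nat \<Rightarrow> nat list" where
  "cnf_env x T t P = [length x, t, T - Suc t, P, 2 * T + 1 - Suc P]"

definition clause_holds :: "bool list \<Rightarrow> nat list \<Rightarrow> (nat \<Rightarrow> bool) \<Rightarrow> (bool \<times> aexp) list \<Rightarrow> bool" where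
  "clause_holds x e v cl \<longleftrightarrow> (\<exists>(b, a)\<in>set cl. v (aval x e a) = b)"

definition cnf_holds :: "bool list \<Rightarrow> nat \<Rightarrow> (bool \<times> aexp) list list \<Rightarrow> (nat \<Rightarrow> bool) \<Rightarrow> bool" where
  "cnf_holds x T tmpl v \<longleftrightarrow> (\<forall>t<T. \<forall>P<2 * T + 1. \<forall>cl\<in>set tmpl. clause_holds x (cnf_env x T t P) v cl)"

context clocked_machine
begin

definition move_var :: "nat \<Rightarrow> aexp \<Rightarrow> aexp" where
  "move_var d t = Add (Cst d) (Mul (Cst (length ds + k * G)) t)"

definition cell_var :: "nat poly \<Rightarrow> nat \<Rightarrow> aexp \<Rightarrow> aexp \<Rightarrow> aexp \<Rightarrow> aexp" where
  "cell_var p i s t P = Add (Add (Cst (length ds + i * G)) s)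
     (Mul (Cst (length ds + k * G)) (Add t (Mul (Add (clock p) (Cst 2)) P)))"

definition init_expr :: "nat poly \<Rightarrow> nat \<Rightarrow> aexp" where
  "init_expr p i = (if i = 0 then Mul (Inp (Sub (Add (Var 3) (Cst 1)) (Add (clock p) (Cst 1))))
     (Sub (Cst 1) (Sub (Add (clock p) (Cst 1)) (Add (Var 3) (Cst 1)))) else Cst 0)"

text \<open>One group per conjunct of \<open>tableau\<close>. Every template is instantiated at
  every time and position, so a clause that depends on only one of them, or on neither, is simply
  repeated.\<close>

definition templates :: "nat poly \<Rightarrow> (bool \<times> aexp) list list" where
  "templates p =
     [map (\<lambda>d. (True, move_var d (Var 1))) [0..<length ds]] @
     [[(False, move_var d (Var 1)), (False, move_var d' (Add (Var 1) (Cst 1)))].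
        d \<leftarrow> [0..<length ds], d' \<leftarrow> [0..<length ds], dst d \<noteq> src d'] @
     [[(False, move_var d (Cst 0))]. d \<leftarrow> [0..<length ds], src d \<noteq> 0] @
     [[(False, move_var d (Sub (clock p) (Cst 1)))]. d \<leftarrow> [0..<length ds], dst d \<noteq> qf] @
     [[(False, move_var d (Var 1)), (False, cell_var p i (Cst s) (Var 1) (Add (clock p) (Cst 1)))].
        d \<leftarrow> [0..<length ds], i \<leftarrow> [0..<k], s \<leftarrow> [0..<G], s \<noteq> rd d ! i] @
     [[(False, move_var d (Var 1)), (False, cell_var p i (Cst s) (Var 1) (Add (Var 3) (Cst 1))),
       (True, cell_var p i (ifx (eqx (Add (Var 3) (Cst 1)) (Add (clock p) (Cst 1))) (Cst (wr d i)) (Cst s))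
          (Add (Var 1) (Cst 1)) (Add (Var 3) (Cst (nat (1 - mv d i)))))].
        d \<leftarrow> [0..<length ds], i \<leftarrow> [0..<k], s \<leftarrow> [0..<G]] @
     [[(True, cell_var p i (init_expr p i) (Cst 0) (Add (Var 3) (Cst 1)))]. i \<leftarrow> [0..<k]]"

lemma aval_move_var: "aval x e (move_var d t) = var_id T d (aval x e t) 0"
  by (simp add: move_var_def var_id_def)

lemma aval_cell_var: "aval x (n # e) (cell_var p i s t P) =
    var_id (Suc (poly p n)) (length ds + i * G + aval x (n # e) s) (aval x (n # e) t) (aval x (n # e) P)"
  by (simp add: cell_var_def var_id_def)

lemma cnf_holds_templates:
  assumes T: "T = Suc (poly p (length x))"
  shows "cnf_holds x T (templates p) v \<longleftrightarrow>
    tableau T x (\<lambda>t d. v (var_id T d t 0)) (\<lambda>t i P s. v (var_id T (length ds + i * G + s) t P))"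
proof -
  let ?Y = "\<lambda>t d. v (var_id T d t 0)" and ?C = "\<lambda>t i P s. v (var_id T (length ds + i * G + s) t P)"
  have hd: "cnf_env x T t P = length x # [t, T - Suc t, P, 2 * T + 1 - Suc P]" for t P
    by (simp add: cnf_env_def)
  have "aval x (cnf_env x T t P) (cell_var p i s t' P') = var_id T (length ds + i * G +
      aval x (cnf_env x T t P) s) (aval x (cnf_env x T t P) t') (aval x (cnf_env x T t P) P')" for t P i s t' P'
    unfolding hd aval_cell_var by (simp only: T)
  note vars = aval_move_var[where T = T] this
  have "(\<forall>cl\<in>set (templates p). clause_holds x (cnf_env x T t P) v cl) \<longleftrightarrow>
     (\<exists>d<length ds. ?Y t d) \<and>
     (\<forall>d<length ds. \<forall>d'<length ds. dst d \<noteq> src d' \<longrightarrow> \<not> ?Y t d \<or> \<not> ?Y (t + 1) d') \<and>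
     (\<forall>d<length ds. src d \<noteq> 0 \<longrightarrow> \<not> ?Y 0 d) \<and>
     (\<forall>d<length ds. dst d \<noteq> qf \<longrightarrow> \<not> ?Y (T - 1) d) \<and>
     (\<forall>d<length ds. \<forall>i<k. \<forall>s<G. s \<noteq> rd d ! i \<longrightarrow> \<not> ?Y t d \<or> \<not> ?C t i (T + 1) s) \<and>
     (\<forall>d<length ds. \<forall>i<k. \<forall>s<G. \<not> ?Y t d \<or> \<not> ?C t i (P + 1) s \<or>
        ?C (t + 1) i (P + nat (1 - mv d i)) (if P + 1 = T + 1 then wr d i else s)) \<and>
     (\<forall>i<k. ?C 0 i (P + 1) (init_cell T x i (P + 1)))" for t P
  proof -
    let ?e = "cnf_env x T t P"
    have e: "aval x ?e (Var 1) = t" "aval x ?e (Var 3) = P" "aval x ?e (clock p) = T"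
      using T by (simp_all add: cnf_env_def)
    have if': "aval x ?e (ifx (eqx (Add (Var 3) (Cst 1)) (Add (clock p) (Cst 1))) (Cst w) (Cst s)) =
        (if P + 1 = T + 1 then w else s)" for w s
      by (subst aval_ifx[where P = "P + 1 = T + 1"]) (simp_all add: e del: aval.simps(2))
    have init: "aval x ?e (init_expr p i) = init_cell T x i (P + 1)" for i
      by (simp add: init_expr_def init_cell_def e del: aval.simps(2))
    show ?thesis
      unfolding templates_def set_append ball_Un
      by (intro arg_cong2[where f = "(\<and>)"])
        (auto simp: clause_holds_def vars e e[unfolded One_nat_def] if' if'[unfolded One_nat_def] init
          simp del: aval.simps(2) split del: if_split)
  qed
  note clauses = this
  \<comment> \<open>Nonempty ranges are needed to drop the quantifiers over times and positions that
    a conjunct does not mention.\<close>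
  have distribute: "(\<forall>t<T. \<forall>P<R. A t \<and> B t \<and> C \<and> D \<and> E t \<and> F t P \<and> H P) \<longleftrightarrow>
    (\<forall>t<T. A t) \<and> (\<forall>t<T. B t) \<and> C \<and> D \<and> (\<forall>t<T. E t) \<and> (\<forall>t<T. \<forall>P<R. F t P) \<and> (\<forall>P<R. H P)"
    if "0 < T" "0 < R" for T R :: nat and A B C D E F H
    using that by blast
  show ?thesis
    unfolding cnf_holds_def tableau_def clauses by (rule distribute) (simp_all add: T)
qed


lemma satisfiable_templates_iff:
  assumes T: "T = Suc (poly p (length x))"
  shows "(\<exists>v. cnf_holds x T (templates p) v) \<longleftrightarrow>
    (\<exists>c. (start_config k x, c) \<in> tm_step (set ds) ^^ T \<and> fst c = qf)"
proof
  assume "\<exists>v. cnf_holds x T (templates p) v"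
  then show "\<exists>c. (start_config k x, c) \<in> tm_step (set ds) ^^ T \<and> fst c = qf"
    using tableau_sound T unfolding cnf_holds_templates[OF T] by blast
next
  assume "\<exists>c. (start_config k x, c) \<in> tm_step (set ds) ^^ T \<and> fst c = qf"
  then obtain f \<rho> where tab: "tableau T x (\<lambda>t d. t < T \<and> d = f t) (\<lambda>t i P s. cell (\<rho> t) i (int P - int (T + 1)) = s)"
    using tableau_complete T by blast
  define K where "K = length ds + k * G"
  \<comment> \<open>The assignment decodes the number of a variable: kind \<open>m mod K\<close>,
    time \<open>m div K mod (T + 2)\<close>, and the remaining quotient as position.\<close>
  define v where "v = (\<lambda>m. if m mod K < length ds then m div K mod (T + 2) < T \<and> m mod K = f (m div K mod (T + 2))
     else cell (\<rho> (m div K mod (T + 2))) ((m mod K - length ds) div G) (int (m div K div (T + 2)) - int (T + 1))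
       = (m mod K - length ds) mod G)"
  have Y: "v (var_id T d t 0) \<longleftrightarrow> t < T \<and> d = f t" if "d < length ds" "t < T + 2" for d t
    using var_id_decode[of d t T 0] that by (simp add: v_def K_def)
  have C: "v (var_id T (length ds + i * G + s) t P) \<longleftrightarrow> cell (\<rho> t) i (int P - int (T + 1)) = s"
    if "i < k" "s < G" "t < T + 2" for i s t P
    using var_id_decode[of "length ds + i * G + s" t T P] symbol_index_less[OF that(1,2)] that
    by (simp add: v_def K_def add_mult_div_mod[of s G i, simplified mult.commute[of G]] add.commute[of "i * G"])
  have init: "init_cell T x i P < G" for i P
    using G by (auto simp: init_cell_def word_tape_def)
  have "tableau T x (\<lambda>t d. v (var_id T d t 0)) (\<lambda>t i P s. v (var_id T (length ds + i * G + s) t P))"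
    using tab unfolding tableau_def
  proof (elim conjE, intro conjI, goal_cases)
    case 1
    then show ?case using Y by (metis trans_less_add1)
  next
    case 2
    then show ?case using Y by simp
  next
    case 3
    then show ?case using Y by simp
  next
    case 4
    then show ?case using Y by simp
  next
    case 5
    then show ?case using Y C by simp
  next
    case 6
    show ?case
    proof (intro allI impI)
      fix t P d i s assume a: "t < T" "P < 2 * T + 1" "d < length ds" "i < k" "s < G"
      have "(if P + 1 = T + 1 then wr d i else s) < G" using a move_facts(2) by simp
      then show "\<not> v (var_id T d t 0) \<or> \<not> v (var_id T (length ds + i * G + s) t (P + 1)) \<or>
        v (var_id T (length ds + i * G + (if P + 1 = T + 1 then wr d i else s)) (t + 1) (P + nat (1 - mv d i)))"
        using 6(6) a Y[of d t] C[of i s t "P + 1"] C[of i _ "t + 1" "P + nat (1 - mv d i)"] by auto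
    qed
  next
    case 7
    then show ?case using C init by simp
  qed
  then show "\<exists>v. cnf_holds x T (templates p) v" unfolding cnf_holds_templates[OF T] by blast
qed

text \<open>Fixes how many variable gadgets are needed. A left move takes position
  \<open>P + 1\<close> to \<open>P + 2\<close>, which is at most \<open>2 * T + 2\<close>; hence
  \<open>2 * T + 3\<close> positions.\<close>

lemma literal_less:
  assumes T: "T = Suc (poly p (length x))" and "t < T" "P < 2 * T + 1" "cl \<in> set (templates p)" "(b, a) \<in> set cl"
  shows "aval x (cnf_env x T t P) a < (length ds + k * G) * ((T + 2) * (2 * T + 3))"
proof -
  define M where "M = (length ds + k * G) * ((T + 2) * (2 * T + 3))"
  let ?e = "cnf_env x T t P"
  have e: "aval x ?e (Var 1) = t" "aval x ?e (Var 3) = P" "aval x ?e (clock p) = T"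
    using T by (simp_all add: cnf_env_def)
  have Y: "aval x ?e (move_var d \<tau>) < M"
    if "d < length ds" "aval x ?e \<tau> < T + 2" for d \<tau>
    unfolding M_def aval_move_var[where T = T] using that by (intro var_id_less) auto
  have C: "aval x ?e (cell_var p i s \<tau> P') < M"
    if "i < k" "aval x ?e s < G" "aval x ?e \<tau> < T + 2" "aval x ?e P' < 2 * T + 3" for i s \<tau> P'
    using var_id_less[OF symbol_index_less[OF that(1,2)] that(3,4)] unfolding M_def
    by (simp only: cnf_env_def aval_cell_var T)
  have mv: "P + nat (1 - mv d i) < 2 * T + 3" if "d < length ds" "i < k" for d i
    using move_facts(3)[OF that] assms(3) by auto
  have wr: "aval x ?e (ifx (eqx (Add (Var 3) (Cst 1)) (Add (clock p) (Cst 1))) (Cst (wr d i)) (Cst s)) < G"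
    if "d < length ds" "i < k" "s < G" for d i s
    using aval_ifx[where P = "P + 1 = T + 1"] move_facts(2)[OF that(1,2)] that(3) e by simp
  have init: "aval x ?e (init_expr p i) < G" for i
    using G by (auto simp: init_expr_def e word_tape_def simp del: aval.simps(2))
  have "aval x ?e a < M"
    using assms(2-5) unfolding templates_def
    by (auto simp del: aval.simps One_nat_def intro!: Y C wr init)
      (use mv in \<open>auto simp: e e[unfolded One_nat_def] simp del: aval.simps(2)\<close>)
  then show ?thesis by (simp only: M_def)
qed

lemma length_templates:
  assumes "cl \<in> set (templates p)"
  shows "cl \<noteq> []" "length cl \<le> length ds + 3"
  using assms ds unfolding templates_def by auto

end

text \<open>Every clause can be given the same number of literals by repeating its first one.\<close>

theorem NP_templates:
  assumes "L \<in> NP"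
  obtains p tmpl w K where "w \<ge> 2" "tmpl \<noteq> []" "\<And>cl. cl \<in> set tmpl \<Longrightarrow> length cl = w"
    "\<And>x. x \<in> L \<longleftrightarrow> (\<exists>v. cnf_holds x (Suc (poly p (length x))) tmpl v)"
    "\<And>x T t P cl b a. T = Suc (poly p (length x)) \<Longrightarrow> t < T \<Longrightarrow> P < 2 * T + 1 \<Longrightarrow> cl \<in> set tmpl \<Longrightarrow> (b, a) \<in> set cl \<Longrightarrow>
       aval x (cnf_env x T t P) a < K * ((T + 2) * (2 * T + 3))"
proof -
  obtain k ds qf G and p :: "nat poly" where m: "k \<ge> 1" "G \<ge> 3" "ds \<noteq> []" "writes_below k G (set ds)"
    and L: "\<And>x. x \<in> L \<longleftrightarrow> (\<exists>c. (start_config k x, c) \<in> tm_step (set ds) ^^ Suc (poly p (length x)) \<and> fst c = qf)"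
    using NP_clocked[OF assms] by metis
  interpret clocked_machine k ds qf G by unfold_locales (fact m)+
  \<comment> \<open>Enough for the clause listing all moves and for the other clauses, which have at
    most three literals.\<close>
  define w where "w = length ds + 3"
  define pad where "pad = (\<lambda>cl :: (bool \<times> aexp) list. cl @ replicate (w - length cl) (hd cl))"
  have pad: "set (pad cl) = set cl" "length (pad cl) = w" if "cl \<in> set (templates p)" for cl
    using length_templates[OF that] by (auto simp: pad_def w_def hd_in_set)
  have "cnf_holds x T (map pad (templates p)) v \<longleftrightarrow> cnf_holds x T (templates p) v" for x T v
    unfolding cnf_holds_def clause_holds_def using pad by simp
  then have L': "x \<in> L \<longleftrightarrow> (\<exists>v. cnf_holds x (Suc (poly p (length x))) (map pad (templates p)) v)" for x
    using L satisfiable_templates_iff[OF refl] by simp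
  have less: "aval x (cnf_env x T t P) a < (length ds + k * G) * ((T + 2) * (2 * T + 3))"
    if r: "T = Suc (poly p (length x))" "t < T" "P < 2 * T + 1"
      and cl: "cl \<in> set (map pad (templates p))" "(b, a) \<in> set cl"
    for x T t P cl b a
  proof -
    obtain cl' where "cl' \<in> set (templates p)" "(b, a) \<in> set cl'" using cl pad(1) by auto
    then show ?thesis using literal_less r by blast
  qed
  show thesis
  proof (rule that[of w "map pad (templates p)" p "length ds + k * G"])
    show "w \<ge> 2" "map pad (templates p) \<noteq> []" by (simp_all add: w_def templates_def)
    show "length cl = w" if "cl \<in> set (map pad (templates p))" for cl using that pad(2) by auto
  qed (fact L' less)+
qed

section \<open>Graphs on the cylinder\<close>

lemma cis_eq_cis_iff: "cis x = cis y \<longleftrightarrow> (\<exists>k::int. x = y + 2 * pi * k)"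
  using sin_cos_eq_iff[of x y] by (auto simp: complex_eq_iff)

lemma wrap_eq_iff:
  assumes "N > 0"
  shows "wrap N (s, z) = wrap N (s', z') \<longleftrightarrow> z = z' \<and> (\<exists>k::int. s = s' + k * real N)"
proof -
  have "2 * pi * s / real N = 2 * pi * s' / real N + 2 * pi * k \<longleftrightarrow> s = s' + k * real N" for k :: int
  proof -
    have "2 * pi * s' / real N + 2 * pi * k = 2 * pi * (s' + k * real N) / real N"
      using assms by (simp add: field_simps)
    then show ?thesis using assms by simp
  qed
  then show ?thesis by (auto simp: wrap_def cis_eq_cis_iff)
qed

lemma of_int_mult_small:
  assumes "\<bar>k * real N\<bar> < real N"
  shows "(k::int) = 0"
proof (rule ccontr)
  assume "k \<noteq> 0"
  then have "1 * real N \<le> \<bar>real_of_int k\<bar> * real N" by (intro mult_right_mono) auto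
  then show False using assms by (simp add: abs_mult)
qed

lemma wrap_in_cylinder: "wrap N p \<in> cylinder"
  by (cases p) (simp add: wrap_def cylinder_def)

lemma continuous_on_wrap: "continuous_on A (wrap N)"
  unfolding wrap_def case_prod_beta divide_inverse by (intro continuous_intros)

definition graph_curve :: "nat \<Rightarrow> real \<Rightarrow> real \<Rightarrow> (real \<Rightarrow> real) \<Rightarrow> (complex \<times> real) set" where
  "graph_curve N a b f = (\<lambda>s. wrap N (s, f s)) ` {a..b}"

lemma graph_curve_subset_cylinder: "graph_curve N a b f \<subseteq> cylinder"
  by (auto simp: graph_curve_def wrap_in_cylinder)

lemma wrap_mem_graph_curve:
  assumes "N > 0" "b - a < real N" "s \<in> {a..b}"
  shows "wrap N (s, z) \<in> graph_curve N a b f \<longleftrightarrow> z = f s"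
proof
  assume "wrap N (s, z) \<in> graph_curve N a b f"
  then obtain s' where "s' \<in> {a..b}" "wrap N (s, z) = wrap N (s', f s')"
    unfolding graph_curve_def by blast
  then obtain k where s': "s' \<in> {a..b}" "z = f s'" "s = s' + of_int k * real N"
    using wrap_eq_iff[OF assms(1)] by blast
  then have "\<bar>of_int k * real N\<bar> < real N" using assms by auto
  then have "k = 0" by (rule of_int_mult_small)
  then show "z = f s" using s' by simp
next
  assume "z = f s"
  then show "wrap N (s, z) \<in> graph_curve N a b f" using assms by (auto simp: graph_curve_def)
qed

lemma curve_between_graph_curve:
  assumes "a < b" "b - a < real N" "continuous_on {a..b} f"
  shows "curve_between (graph_curve N a b f) (wrap N (a, f a)) (wrap N (b, f b))"
proof -
  have N: "N > 0" using assms by (cases N) auto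
  let ?h = "\<lambda>t. a + t * (b - a)"
  let ?g = "\<lambda>t. wrap N (?h t, f (?h t))"
  have h: "?h ` {0..1} = {a..b}"
  proof -
    have "?h ` {0..1} = (\<lambda>x. (b - a) * x + a) ` {0..1}" by (intro image_cong) (auto simp: algebra_simps)
    also have "\<dots> = {a..b}" using assms(1) by (subst image_affinity_atLeastAtMost) auto
    finally show ?thesis .
  qed
  have "continuous_on {0..1} (\<lambda>t. (?h t, f (?h t)))"
    by (intro continuous_intros continuous_on_compose2[OF assms(3)]) (use h in auto)
  then have "continuous_on {0..1} ?g"
    by (rule continuous_on_compose2[OF continuous_on_wrap]) auto
  then have "path ?g" by (simp add: path_def)
  moreover have "inj_on ?g {0..1}"
  proof (rule inj_onI)
    fix t t' assume t: "t \<in> {0..1}" "t' \<in> {0..1}" and eq: "?g t = ?g t'"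
    then obtain k :: int where k: "?h t = ?h t' + k * real N" using wrap_eq_iff[OF N] by blast
    have "?h t \<in> {a..b}" "?h t' \<in> {a..b}" using h t by blast+
    then have "\<bar>of_int k * real N\<bar> < real N" using k assms by auto
    then have "k = 0" by (rule of_int_mult_small)
    then show "t = t'" using k assms(1) by simp
  qed
  ultimately have "arc ?g" by (simp add: arc_def)
  moreover have "path_image ?g = graph_curve N a b f"
    unfolding path_image_def graph_curve_def h[symmetric] image_image ..
  ultimately show ?thesis unfolding curve_between_def
    by (intro exI[of _ ?g]) (auto simp: pathstart_def pathfinish_def)
qed

lemma curve_between_commute: "curve_between C p q \<Longrightarrow> curve_between C q p"
  unfolding curve_between_def by (metis arc_reversepath path_image_reversepath pathfinish_reversepath pathstart_reversepath)

lemma cylindrically_monotone_graph_curve: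
  assumes "N > 0" "b - a < real N"
  shows "cylindrically_monotone (graph_curve N a b f)"
  unfolding cylindrically_monotone_def meet_at_most_once_def
proof (intro allI ballI)
  fix u p q assume p: "p \<in> graph_curve N a b f \<inter> vertical_line u" and q: "q \<in> graph_curve N a b f \<inter> vertical_line u"
  obtain s where s: "s \<in> {a..b}" "p = wrap N (s, f s)" using p by (auto simp: graph_curve_def)
  have "fst q = fst p" using p q by (auto simp: vertical_line_def)
  then have "q = wrap N (s, snd q)" using s by (cases q) (simp add: wrap_def)
  then show "p = q" using q s wrap_mem_graph_curve[OF assms s(1)] by (metis IntD1)
qed

subsection \<open>Monotone curves are graphs\<close>

text \<open>A continuous logarithm lifts the angle along the curve to \<open>\<theta>\<close>. As no
  vertical line is met twice, \<open>\<theta>\<close> is injective even modulo \<open>N\<close>. So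
  the curve makes less than a full turn and ends at \<open>\<beta>\<close> or at
  \<open>\<beta> - N\<close>, which are the two directions around the cylinder; over the range of
  \<open>\<theta>\<close> it is a graph.\<close>

lemma monotone_curve_lift:
  assumes D: "D \<subseteq> cylinder" "cylindrically_monotone D"
    and cb: "curve_between D (wrap N (0, za)) (wrap N (\<beta>, zb))" and \<beta>: "0 < \<beta>" "\<beta> < real N"
  obtains d where "continuous_on {0..\<beta>} d" "d 0 = za" "d \<beta> = zb" "\<And>s. s \<in> {0..\<beta>} \<Longrightarrow> wrap N (s, d s) \<in> D"
  | d where "continuous_on {\<beta>..real N} d" "d \<beta> = zb" "d (real N) = za" "\<And>s. s \<in> {\<beta>..real N} \<Longrightarrow> wrap N (s, d s) \<in> D"
proof -
  have N: "N > 0" using \<beta> by (cases N) auto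
  obtain g where g: "arc g" "path_image g = D" "g 0 = wrap N (0, za)" "g 1 = wrap N (\<beta>, zb)"
    using cb unfolding curve_between_def pathstart_def pathfinish_def by blast
  have cg: "continuous_on {0..1} g" and inj: "inj_on g {0..1}" using g(1) by (auto simp: arc_def path_def)
  have gD: "g t \<in> D" if "t \<in> {0..1}" for t using g(2) that by (auto simp: path_image_def)
  have norm: "cmod (fst (g t)) = 1" if "t \<in> {0..1}" for t
    using gD[OF that] D(1) by (auto simp: cylinder_def)
  have c1: "continuous_on {0..1} (\<lambda>t. fst (g t))" by (intro continuous_intros cg)
  have c2: "contractible {0..1::real}" by (simp add: convex_imp_contractible)
  have c3: "fst (g t) \<noteq> 0" if "t \<in> {0..1}" for t using norm[OF that] by auto
  obtain \<phi> where \<phi>: "continuous_on {0..1} \<phi>" "\<And>t. t \<in> {0..1} \<Longrightarrow> fst (g t) = exp (\<phi> t)"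
    using continuous_logarithm_on_contractible[OF c1 c2 c3] by blast
  have lift: "fst (g t) = cis (Im (\<phi> t))" if "t \<in> {0..1}" for t
  proof -
    have "exp (Re (\<phi> t)) = 1" using norm[OF that] \<phi>(2)[OF that] by simp
    then show ?thesis using \<phi>(2)[OF that] by (simp add: exp_eq_polar)
  qed
  have "cis (Im (\<phi> 0)) = cis 0" using lift[of 0] g(3) by (simp add: wrap_def)
  then obtain k0 :: int where "Im (\<phi> 0) = 0 + 2 * pi * k0" unfolding cis_eq_cis_iff by blast
  then have k0: "Im (\<phi> 0) = 2 * pi * k0" by simp
  define \<theta> where "\<theta> t = real N / (2 * pi) * (Im (\<phi> t) - 2 * pi * k0)" for t
  have c\<theta>: "continuous_on {0..1} \<theta>" unfolding \<theta>_def by (intro continuous_intros \<phi>(1))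
  have \<theta>0: "\<theta> 0 = 0" by (simp add: \<theta>_def k0)
  have g\<theta>: "g t = wrap N (\<theta> t, snd (g t))" if "t \<in> {0..1}" for t
  proof -
    have "2 * pi * \<theta> t / real N = Im (\<phi> t) + 2 * pi * real_of_int (- k0)" using N by (simp add: \<theta>_def field_simps)
    then have "cis (2 * pi * \<theta> t / real N) = cis (Im (\<phi> t))" using cis_eq_cis_iff by blast
    then show ?thesis using lift[OF that] by (cases "g t") (simp add: wrap_def)
  qed
  have inj\<theta>: "t = t'" if t: "t \<in> {0..1}" "t' \<in> {0..1}" and k: "\<theta> t = \<theta> t' + of_int k * real N" for t t' and k :: int
  proof -
    have "fst (g t) = fst (g t')"
    proof -
      have "wrap N (\<theta> t, 0) = wrap N (\<theta> t', 0)" using k wrap_eq_iff[OF N] by blast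
      then show ?thesis by (metis Pair_inject fst_conv g\<theta> t wrap_def case_prod_conv)
    qed
    then have "g t' \<in> D \<inter> vertical_line (fst (g t))" "g t \<in> D \<inter> vertical_line (fst (g t))"
      using gD t by (auto simp: vertical_line_def mem_Times_iff)
    then have "g t = g t'" using D(2) unfolding cylindrically_monotone_def meet_at_most_once_def by blast
    then show ?thesis using inj t by (auto dest: inj_onD)
  qed
  define \<psi> where "\<psi> = inv_into {0..1} \<theta>"
  have "inj_on \<theta> {0..1}" using inj\<theta>[of _ _ 0] by (auto intro!: inj_onI)
  then have \<psi>: "\<psi> (\<theta> t) = t" if "t \<in> {0..1}" for t using that by (simp add: \<psi>_def)
  \<comment> \<open>The inverse of a continuous injection on a compact interval is
    continuous.\<close>
  then have c\<psi>: "continuous_on (\<theta> ` {0..1}) \<psi>" by (intro continuous_on_inv c\<theta>) auto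
  define d where "d = (\<lambda>s. snd (g (\<psi> s)))"
  have cd: "continuous_on (\<theta> ` {0..1}) d"
    unfolding d_def by (intro continuous_intros continuous_on_compose2[OF cg c\<psi>]) (use \<psi> in auto)
  have dD: "wrap N (s, d s) \<in> D" if s: "s \<in> \<theta> ` {0..1}" for s
  proof -
    obtain t where "t \<in> {0..1}" "s = \<theta> t" using s by blast
    then show ?thesis using \<psi> g\<theta> gD by (simp add: d_def)
  qed
  have d0: "d 0 = za" using \<psi>[of 0] g(3) by (simp add: d_def \<theta>0 wrap_def)
  have d1: "d (\<theta> 1) = zb" using \<psi>[of 1] g(4) by (simp add: d_def wrap_def)
  have "wrap N (\<theta> 1, snd (g 1)) = wrap N (\<beta>, zb)" using g\<theta>[of 1] g(4) by simp
  then obtain k1 :: int where k1: "\<theta> 1 = \<beta> + k1 * real N" using wrap_eq_iff[OF N] by blast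
  \<comment> \<open>Otherwise the lift takes the value \<open>N\<close> somewhere, where the curve
    is again on the vertical line of its starting point.\<close>
  have lt: "\<theta> 1 < real N"
  proof (rule ccontr)
    assume "\<not> \<theta> 1 < real N"
    then obtain t where "0 \<le> t" "t \<le> 1" "\<theta> t = real N" using IVT'[of \<theta> 0 "real N" 1] c\<theta> \<theta>0 by auto
    then have "t = 0" using inj\<theta>[of t 0 1] \<theta>0 by simp
    then show False using \<open>\<theta> t = real N\<close> \<theta>0 N by simp
  qed
  have gt: "- real N < \<theta> 1"
  proof (rule ccontr)
    assume "\<not> - real N < \<theta> 1"
    then obtain t where "0 \<le> t" "t \<le> 1" "\<theta> t = - real N" using IVT2'[of \<theta> 1 "- real N" 0] c\<theta> \<theta>0 by auto
    then have "t = 0" using inj\<theta>[of t 0 "-1"] \<theta>0 by simp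
    then show False using \<open>\<theta> t = - real N\<close> \<theta>0 N by simp
  qed
  have "k1 = 0 \<or> k1 = -1"
  proof -
    have u: "of_int k1 * real N < 1 * real N" "(-2) * real N < of_int k1 * real N" using k1 lt gt \<beta> by linarith+
    have "real_of_int k1 < 1" "-2 < real_of_int k1" by (rule mult_right_less_imp_less[OF u(1)] mult_right_less_imp_less[OF u(2)], simp)+
    then show ?thesis by linarith
  qed
  then show thesis
  proof
    assume "k1 = 0"
    then have \<theta>1: "\<theta> 1 = \<beta>" using k1 by simp
    have sub: "{0..\<beta>} \<subseteq> \<theta> ` {0..1}"
    proof
      fix s assume "s \<in> {0..\<beta>}"
      then obtain t where "0 \<le> t" "t \<le> 1" "\<theta> t = s" using IVT'[of \<theta> 0 s 1] c\<theta> \<theta>0 \<theta>1 by auto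
      then show "s \<in> \<theta> ` {0..1}" by force
    qed
    show thesis
      by (rule that(1)[of d]) (use continuous_on_subset[OF cd sub] d0 d1 \<theta>1 dD sub in auto)
  next
    assume "k1 = -1"
    then have \<theta>1: "\<theta> 1 = \<beta> - real N" using k1 by simp
    have sub: "s - real N \<in> \<theta> ` {0..1}" if "s \<in> {\<beta>..real N}" for s
    proof -
      obtain t where "0 \<le> t" "t \<le> 1" "\<theta> t = s - real N"
        using IVT2'[of \<theta> 1 "s - real N" 0] c\<theta> \<theta>0 \<theta>1 \<open>s \<in> _\<close> by auto
      then show ?thesis by force
    qed
    let ?d = "\<lambda>s. d (s - real N)"
    have "continuous_on {\<beta>..real N} ?d"
    proof (rule continuous_on_compose2[OF cd])
      show "(\<lambda>s. s - real N) ` {\<beta>..real N} \<subseteq> \<theta> ` {0..1}" using sub by blast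
    qed (intro continuous_intros)
    moreover have "wrap N (s, ?d s) \<in> D" if "s \<in> {\<beta>..real N}" for s
    proof -
      have "s - real N = s + of_int (-1) * real N" by simp
      then have "wrap N (s - real N, ?d s) = wrap N (s, ?d s)" using wrap_eq_iff[OF N] by blast
      then show ?thesis using dD[OF sub[OF that]] by simp
    qed
    ultimately show thesis using that(2)[of ?d] d0 d1 \<theta>1 by simp
  qed
qed

subsection \<open>Proper crossings\<close>

text \<open>A homeomorphism of the line onto the interval from -1 to 1, with inverse
  \<open>stretch\<close>. It enlarges a small open parallelogram to the whole plane, as
  \<open>proper_crossing\<close> requires.\<close>

definition squash :: "real \<Rightarrow> real" where "squash y = y / (1 + \<bar>y\<bar>)"
definition stretch :: "real \<Rightarrow> real" where "stretch x = x / (1 - \<bar>x\<bar>)"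

lemma abs_squash_less: "\<bar>squash y\<bar> < 1"
  by (simp add: squash_def abs_divide)

lemma stretch_squash: "stretch (squash y) = y"
proof -
  have "1 - \<bar>squash y\<bar> = 1 / (1 + \<bar>y\<bar>)" by (simp add: squash_def abs_divide field_simps)
  then show ?thesis by (simp add: stretch_def squash_def)
qed

lemma squash_stretch: "\<bar>x\<bar> < 1 \<Longrightarrow> squash (stretch x) = x"
proof -
  assume x: "\<bar>x\<bar> < 1"
  then have "1 + \<bar>stretch x\<bar> = 1 / (1 - \<bar>x\<bar>)" by (simp add: stretch_def abs_divide field_simps)
  then show ?thesis using x by (simp add: stretch_def squash_def)
qed

lemma squash_eq_0_iff: "squash y = 0 \<longleftrightarrow> y = 0"
  by (simp add: squash_def add_nonneg_eq_0_iff)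

lemma continuous_on_squash [continuous_intros]: "continuous_on A f \<Longrightarrow> continuous_on A (\<lambda>x. squash (f x))"
  unfolding squash_def by (intro continuous_intros) auto

lemma continuous_on_stretch [continuous_intros]:
  "continuous_on A f \<Longrightarrow> (\<And>x. x \<in> A \<Longrightarrow> \<bar>f x\<bar> < 1) \<Longrightarrow> continuous_on A (\<lambda>x. stretch (f x))"
  unfolding stretch_def by (intro continuous_intros) fastforce+

text \<open>After rotation by the angle of \<open>s0\<close>, the principal argument inverts
  \<open>wrap\<close>. Less than half a turn on either side keeps clear of its branch cut, the
  nonpositive reals.\<close>

lemma wrap_homeomorphism:
  assumes N: "N > 0" and B: "open B" and small: "\<And>s z. (s, z) \<in> B \<Longrightarrow> \<bar>s - s0\<bar> < real N / 2"
  shows "openin (top_of_set cylinder) (wrap N ` B)" "\<exists>u. homeomorphism B (wrap N ` B) (wrap N) u"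
proof -
  let ?c = "cis (- (2 * pi * s0 / real N))"
  define u where "u = (\<lambda>(w, z). (s0 + real N / (2 * pi) * Arg (w * ?c), z :: real))"
  define W where "W = (\<lambda>p :: complex \<times> real. fst p * ?c) -` (- \<real>\<^sub>\<le>\<^sub>0)"
  have "open W" unfolding W_def
    by (intro open_vimage continuous_intros) (auto simp: open_Compl)
  have cu: "continuous_on W u" unfolding u_def case_prod_beta W_def
    by (intro continuous_intros) auto
  have inW: "wrap N (s, z) \<in> W" "u (wrap N (s, z)) = (s, z)" if "\<bar>s - s0\<bar> < real N / 2" for s z
  proof -
    let ?x = "2 * pi * (s - s0) / real N"
    have "\<bar>?x\<bar> = pi * (2 * \<bar>s - s0\<bar> / real N)" by (simp add: abs_mult abs_divide)
    also have "\<dots> < pi * 1" by (rule mult_strict_left_mono) (use that N in \<open>auto simp: field_simps\<close>)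
    finally have "- pi < ?x" "?x < pi" by linarith+
    then have x: "?x \<in> {-pi<..pi}" "?x \<in> {-pi<..<pi}" by auto
    have e: "cis (2 * pi * s / real N) * ?c = cis ?x" by (simp add: cis_mult diff_divide_distrib algebra_simps)
    have "cis ?x \<notin> \<real>\<^sub>\<le>\<^sub>0"
    proof
      assume "cis ?x \<in> \<real>\<^sub>\<le>\<^sub>0"
      then have "cos ?x \<le> 0" "sin ?x = 0" by (simp_all add: complex_nonpos_Reals_iff)
      moreover have "cos ?x \<noteq> 0" using sin_cos_squared_add[of ?x] \<open>sin ?x = 0\<close> by auto
      ultimately have "Arg (cis ?x) = pi" by (simp add: Arg_eq_pi less_le)
      then show False using Arg_cis[OF x(1)] x(2) by simp
    qed
    then show "wrap N (s, z) \<in> W" by (simp add: W_def wrap_def e)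
    show "u (wrap N (s, z)) = (s, z)" using Arg_cis[OF x(1)] N by (simp add: u_def wrap_def e)
  qed
  have wrap_u: "wrap N (u p) = p" if "p \<in> cylinder" for p
  proof -
    obtain w z where p: "p = (w, z)" by (cases p)
    have w: "cmod w = 1" using that by (simp add: p cylinder_def)
    then have "w * ?c \<noteq> 0" by auto
    then have "cis (Arg (w * ?c)) = w * ?c" using w by (simp add: cis_Arg sgn_div_norm norm_mult)
    moreover have "2 * pi * (s0 + real N / (2 * pi) * A) / real N = 2 * pi * s0 / real N + A" for A
      using N by (simp add: field_simps)
    ultimately have "cis (2 * pi * (s0 + real N / (2 * pi) * Arg (w * ?c)) / real N) = cis (2 * pi * s0 / real N) * (w * ?c)"
      by (simp add: cis_mult[symmetric])
    also have "\<dots> = w" by (simp add: cis_mult mult.left_commute[of w])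
    finally show ?thesis by (simp add: p u_def wrap_def)
  qed
  have eq: "wrap N ` B = cylinder \<inter> (W \<inter> u -` B)"
  proof (intro equalityI subsetI)
    fix p assume "p \<in> wrap N ` B"
    then obtain s z where "(s, z) \<in> B" "p = wrap N (s, z)" by auto
    then show "p \<in> cylinder \<inter> (W \<inter> u -` B)" using inW small wrap_in_cylinder by simp
  next
    fix p assume "p \<in> cylinder \<inter> (W \<inter> u -` B)"
    then show "p \<in> wrap N ` B" using wrap_u by (metis IntE imageI vimageE)
  qed
  have "open (W \<inter> u -` B)" using continuous_open_preimage[OF cu \<open>open W\<close> B] .
  then show "openin (top_of_set cylinder) (wrap N ` B)" unfolding eq by (rule openin_open_Int)
  have "homeomorphism B (wrap N ` B) (wrap N) u"
  proof (rule homeomorphismI)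
    show "continuous_on (wrap N ` B) u" by (rule continuous_on_subset[OF cu]) (auto simp: eq)
    show "u ` (wrap N ` B) \<subseteq> B" by (auto simp: eq)
    show "u (wrap N x) = x" if "x \<in> B" for x using that inW small by (cases x) auto
    show "wrap N (u y) = y" if "y \<in> wrap N ` B" for y using that wrap_u by (auto simp: eq)
  qed (auto intro: continuous_on_wrap)
  then show "\<exists>u. homeomorphism B (wrap N ` B) (wrap N) u" by blast
qed

text \<open>The vertical distances \<open>F\<close> and \<open>G\<close> from the two lines serve as
  coordinates: \<open>F = 0\<close> is the one curve and \<open>G = 0\<close> the other. On the
  parallelogram where both are below \<open>\<epsilon>\<close>, rescaling by \<open>stretch\<close>
  gives the required chart. The integer \<open>k\<close> counts the turns between the drawings of
  the two curves.\<close>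

lemma proper_crossing_graph_curves:
  fixes k :: int
  assumes N: "N > 0" and len: "b - a < real N" "b' - a' < real N" and e: "e > 0"
    and dom: "a \<le> s0 - e" "s0 + e \<le> b" "a' \<le> s0 - k * real N - e" "s0 - k * real N + e \<le> b'"
    and f: "\<And>s. \<bar>s - s0\<bar> < e \<Longrightarrow> f s = z0 + \<mu> * (s - s0)"
    and f': "\<And>s. \<bar>s - s0\<bar> < e \<Longrightarrow> f' (s - k * real N) = z0 + \<nu> * (s - s0)"
    and slopes: "\<mu> \<noteq> \<nu>"
  shows "proper_crossing cylinder (graph_curve N a b f) (graph_curve N a' b' f') (wrap N (s0, z0))"
proof -
  \<comment> \<open>With this size, \<open>F\<close> and \<open>G\<close> below
    \<open>\<epsilon>\<close> force \<open>s\<close> to be within \<open>e\<close> of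
    \<open>s0\<close>, where both curves are straight.\<close>
  define \<epsilon> where "\<epsilon> = e * \<bar>\<mu> - \<nu>\<bar> / 2"
  have \<epsilon>: "\<epsilon> > 0" using e slopes by (simp add: \<epsilon>_def)
  define F where "F = (\<lambda>(s, z). z - z0 - \<mu> * (s - s0))"
  define G where "G = (\<lambda>(s, z). z - z0 - \<nu> * (s - s0))"
  define B where "B = {p. \<bar>F p\<bar> < \<epsilon> \<and> \<bar>G p\<bar> < \<epsilon>}"
  have cFG: "continuous_on A F" "continuous_on A G" for A
    unfolding F_def G_def case_prod_beta by (intro continuous_intros)+
  have "B = {p. \<bar>F p\<bar> < \<epsilon>} \<inter> {p. \<bar>G p\<bar> < \<epsilon>}" by (auto simp: B_def)
  then have "open B" by (auto intro!: open_Int open_Collect_less continuous_intros cFG)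
  have small: "\<bar>s - s0\<bar> < e" if "(s, z) \<in> B" for s z
  proof -
    have "\<bar>(\<mu> - \<nu>) * (s - s0)\<bar> < \<epsilon> + \<epsilon>"
      using that by (auto simp: B_def F_def G_def algebra_simps)
    then have "\<bar>\<mu> - \<nu>\<bar> * \<bar>s - s0\<bar> < \<bar>\<mu> - \<nu>\<bar> * e" by (simp add: \<epsilon>_def abs_mult mult.commute)
    then show ?thesis using slopes by (simp add: mult_less_cancel_left)
  qed
  have "e \<le> real N / 2" using dom(1,2) len(1) by linarith
  then have half: "\<bar>s - s0\<bar> < real N / 2" if "(s, z) \<in> B" for s z using small[OF that] by linarith
  obtain u where u: "homeomorphism B (wrap N ` B) (wrap N) u" using wrap_homeomorphism(2)[of N B s0] N \<open>open B\<close> half by blast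
  define h where "h = (\<lambda>p. (stretch (G p / \<epsilon>), stretch (F p / \<epsilon>)))"
  define S where "S = (\<lambda>(x, y). s0 + \<epsilon> * (squash x - squash y) / (\<mu> - \<nu>))"
  define h' where "h' = (\<lambda>q. (S q, z0 + \<epsilon> * squash (snd q) + \<mu> * (S q - s0)))"
  have F': "F (h' q) = \<epsilon> * squash (snd q)" and G': "G (h' q) = \<epsilon> * squash (fst q)" for q
  proof -
    show "F (h' q) = \<epsilon> * squash (snd q)" by (simp add: F_def h'_def)
    have "(\<mu> - \<nu>) * (S q - s0) = \<epsilon> * (squash (fst q) - squash (snd q))"
      using slopes by (cases q) (simp add: S_def)
    then show "G (h' q) = \<epsilon> * squash (fst q)" by (simp add: G_def h'_def algebra_simps)
  qed
  have hom: "homeomorphism B UNIV h h'"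
  proof (rule homeomorphismI)
    show "continuous_on B h" unfolding h_def
      by (intro continuous_intros cFG) (use \<epsilon> in \<open>auto simp: B_def abs_divide\<close>)
    have "continuous_on UNIV S" unfolding S_def case_prod_beta using slopes by (intro continuous_intros) auto
    then show "continuous_on UNIV h'" unfolding h'_def by (intro continuous_intros)
    show "h' ` UNIV \<subseteq> B"
      using \<epsilon> abs_squash_less by (auto simp: B_def F' G' abs_mult)
    show "h (h' y) = y" for y using \<epsilon> by (simp add: h_def F' G' stretch_squash)
    show "h' (h p) = p" if "p \<in> B" for p
    proof -
      obtain s z where p: "p = (s, z)" by (cases p)
      have sq: "squash (stretch (F p / \<epsilon>)) = F p / \<epsilon>" "squash (stretch (G p / \<epsilon>)) = G p / \<epsilon>"
        using that \<epsilon> by (auto simp: B_def abs_divide intro!: squash_stretch)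
      have "\<epsilon> * (G p / \<epsilon> - F p / \<epsilon>) = (\<mu> - \<nu>) * (s - s0)"
      proof -
        have "\<epsilon> * (G p / \<epsilon> - F p / \<epsilon>) = G p - F p" using \<epsilon> by (simp add: right_diff_distrib)
        then show ?thesis by (simp add: F_def G_def p algebra_simps)
      qed
      then have Sh: "S (h p) = s" using slopes by (simp add: S_def h_def sq)
      have "snd (h p) = stretch (F p / \<epsilon>)" by (simp add: h_def)
      then show ?thesis using \<epsilon> unfolding h'_def Sh by (simp only: sq) (simp add: F_def p)
    qed
  qed simp
  have inter: "graph_curve N a b f \<inter> wrap N ` B = wrap N ` {p \<in> B. F p = 0}"
  proof -
    have "wrap N p \<in> graph_curve N a b f \<longleftrightarrow> F p = 0" if pB: "p \<in> B" for p
    proof -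
      obtain s z where p: "p = (s, z)" by (cases p)
      have s: "\<bar>s - s0\<bar> < e" using small pB p by simp
      then have "s \<in> {a..b}" using dom by auto
      then show ?thesis using wrap_mem_graph_curve[OF N len(1)] f[OF s] by (auto simp: p F_def)
    qed
    then show ?thesis by auto
  qed
  have inter': "graph_curve N a' b' f' \<inter> wrap N ` B = wrap N ` {p \<in> B. G p = 0}"
  proof -
    have "wrap N p \<in> graph_curve N a' b' f' \<longleftrightarrow> G p = 0" if pB: "p \<in> B" for p
    proof -
      obtain s z where p: "p = (s, z)" by (cases p)
      have s: "\<bar>s - s0\<bar> < e" using small pB p by simp
      then have "s - k * real N \<in> {a'..b'}" using dom by auto
      moreover have "wrap N (s, z) = wrap N (s - k * real N, z)" using wrap_eq_iff[OF N] by auto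
      ultimately show ?thesis using wrap_mem_graph_curve[OF N len(2)] f'[OF s] by (auto simp: p G_def)
    qed
    then show ?thesis by auto
  qed
  have uw: "u (wrap N p) = p" if "p \<in> B" for p using u that by (simp add: homeomorphism_def)
  have img: "h ` {p \<in> B. P p} = {q. P (h' q)}" for P
  proof (intro equalityI subsetI)
    fix q assume "q \<in> h ` {p \<in> B. P p}"
    then obtain p where "p \<in> B" "P p" "q = h p" by blast
    then show "q \<in> {q. P (h' q)}" using homeomorphism_apply1[OF hom] by simp
  next
    fix q assume "q \<in> {q. P (h' q)}"
    moreover have "h' q \<in> B" using homeomorphism_image2[OF hom] by blast
    moreover have "q = h (h' q)" using homeomorphism_apply2[OF hom] by simp
    ultimately show "q \<in> h ` {p \<in> B. P p}" by blast
  qed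
  have p0: "(s0, z0) \<in> B" "h (s0, z0) = (0, 0)" using \<epsilon> by (simp_all add: B_def F_def G_def h_def stretch_def)
  show ?thesis unfolding proper_crossing_def
  proof (intro exI conjI)
    show "openin (top_of_set cylinder) (wrap N ` B)" using wrap_homeomorphism(1)[of N B s0] N \<open>open B\<close> half by blast
    show "wrap N (s0, z0) \<in> wrap N ` B" using p0 by blast
    show "homeomorphism (wrap N ` B) UNIV (h \<circ> u) (wrap N \<circ> h')"
      using homeomorphism_compose[OF homeomorphism_symD[OF u] hom] .
    show "(h \<circ> u) (wrap N (s0, z0)) = (0, 0)" using uw p0 by simp
    have "(h \<circ> u) ` (wrap N ` {p \<in> B. P p}) = {q. P (h' q)}" for P
      unfolding img[symmetric] image_comp by (intro image_cong) (auto simp: uw)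
    then show "(h \<circ> u) ` (graph_curve N a b f \<inter> wrap N ` B) = UNIV \<times> {0}"
      "(h \<circ> u) ` (graph_curve N a' b' f' \<inter> wrap N ` B) = {0} \<times> UNIV"
      unfolding inter inter' using \<epsilon> by (auto simp: F' G' squash_eq_0_iff)
  qed
qed

lemma proper_crossing_commute:
  assumes "proper_crossing S C D p"
  shows "proper_crossing S D C p"
proof -
  obtain U h h' where U: "openin (top_of_set S) U" "p \<in> U" "homeomorphism U (UNIV :: (real \<times> real) set) h h'" "h p = (0, 0)"
    "h ` (C \<inter> U) = UNIV \<times> {0}" "h ` (D \<inter> U) = {0} \<times> UNIV"
    using assms unfolding proper_crossing_def by blast
  have sw: "homeomorphism UNIV (UNIV :: (real \<times> real) set) prod.swap prod.swap"
    by (rule homeomorphismI) (auto intro: continuous_on_swap)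
  have "(prod.swap \<circ> h) ` (D \<inter> U) = UNIV \<times> {0}" "(prod.swap \<circ> h) ` (C \<inter> U) = {0} \<times> UNIV"
    unfolding image_comp[symmetric] U by (auto simp: image_iff)
  then show ?thesis unfolding proper_crossing_def
    using U homeomorphism_compose[OF U(3) sw] by (intro exI[of _ U] exI[of _ "prod.swap \<circ> h"] exI[of _ "h' \<circ> prod.swap"] conjI) auto
qed


section \<open>Piecewise linear curves\<close>

definition pl :: "(nat \<Rightarrow> nat) \<Rightarrow> real \<Rightarrow> real" where
  "pl H s = real (H (nat \<lfloor>s\<rfloor>)) + (s - of_int \<lfloor>s\<rfloor>) * (real (H (Suc (nat \<lfloor>s\<rfloor>))) - real (H (nat \<lfloor>s\<rfloor>)))"

lemma pl_nat [simp]: "pl H (real c) = real (H c)"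
  by (simp add: pl_def)

lemma pl_eq:
  assumes "real c \<le> s" "s \<le> real (Suc c)"
  shows "pl H s = real (H c) + (s - real c) * (real (H (Suc c)) - real (H c))"
proof (cases "s = real (Suc c)")
  case True
  then show ?thesis unfolding True pl_nat by simp
next
  case False
  then have "\<lfloor>s\<rfloor> = int c" using assms by (intro floor_unique) auto
  then show ?thesis by (simp add: pl_def)
qed

lemma pl_shift: "s \<ge> 0 \<Longrightarrow> pl H (s + real n) = pl (\<lambda>c. H (c + n)) s"
proof -
  assume "s \<ge> 0"
  have "\<lfloor>s + real n\<rfloor> = \<lfloor>s\<rfloor> + int n" using floor_add_int[of s "int n"] by simp
  moreover have "nat (\<lfloor>s\<rfloor> + int n) = nat \<lfloor>s\<rfloor> + n" using \<open>s \<ge> 0\<close> by (simp add: nat_add_distrib)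
  ultimately show ?thesis by (simp add: pl_def)
qed

lemma real_between_Suc:
  assumes "real lo \<le> s" "s < real hi"
  obtains c where "lo \<le> c" "c < hi" "real c \<le> s" "s < real (Suc c)"
proof -
  have "0 \<le> s" using assms(1) by linarith
  then have f: "real (nat \<lfloor>s\<rfloor>) \<le> s" "s < real (Suc (nat \<lfloor>s\<rfloor>))" by linarith+
  show thesis by (rule that[of "nat \<lfloor>s\<rfloor>"]) (use f assms in linarith)+
qed

lemma continuous_on_pl: "l \<le> r \<Longrightarrow> continuous_on {real l..real r} (pl H)"
proof (induction r rule: dec_induct)
  case base
  then show ?case by simp
next
  case (step r)
  have "continuous_on {real r..real (Suc r)} (\<lambda>s. real (H r) + (s - real r) * (real (H (Suc r)) - real (H r)))"
    by (intro continuous_intros)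
  then have "continuous_on {real r..real (Suc r)} (pl H)"
    by (subst continuous_on_cong[OF refl pl_eq[of r]]) auto
  with step have "continuous_on ({real l..real r} \<union> {real r..real (Suc r)}) (pl H)"
    by (intro continuous_on_closed_Un) auto
  moreover have "{real l..real r} \<union> {real r..real (Suc r)} = {real l..real (Suc r)}"
    using step by auto
  ultimately show ?case by simp
qed

lemma segment_eq_graph:
  "closed_segment (real c, real (H c)) (real (Suc c), real (H (Suc c))) = (\<lambda>s. (s, pl H s)) ` {real c..real (Suc c)}"
proof -
  have "{real c..real (Suc c)} = (\<lambda>u. real c + u) ` {0..1}"
    by (simp add: add.commute)
  then have "(\<lambda>s. (s, pl H s)) ` {real c..real (Suc c)} = (\<lambda>u. (real c + u, pl H (real c + u))) ` {0..1}"
    by (simp only: image_image)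
  also have "\<dots> = (\<lambda>u. (1 - u) *\<^sub>R (real c, real (H c)) + u *\<^sub>R (real (Suc c), real (H (Suc c)))) ` {0..1}"
  proof (rule image_cong[OF refl])
    fix u :: real assume "u \<in> {0..1}"
    then have "pl H (real c + u) = real (H c) + u * (real (H (Suc c)) - real (H c))"
      by (subst pl_eq[of c]) auto
    then show "(real c + u, pl H (real c + u)) = (1 - u) *\<^sub>R (real c, real (H c)) + u *\<^sub>R (real (Suc c), real (H (Suc c)))"
      by (simp add: algebra_simps)
  qed
  finally show ?thesis by (simp add: closed_segment_image_interval)
qed

definition pl_curve :: "nat \<Rightarrow> nat \<Rightarrow> nat \<Rightarrow> (nat \<Rightarrow> nat) \<Rightarrow> (complex \<times> real) set" where
  "pl_curve N l r H = graph_curve N (real l) (real r) (pl H)"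

lemma drawn_curve_eq_pl_curve:
  assumes "l < r"
  shows "drawn_curve N (map (\<lambda>c. (c, H c)) [l..<Suc r]) = pl_curve N l r H"
proof -
  have "polygonal_chain (map (\<lambda>c. (real c, real (H c))) [l..<Suc (Suc (l + n))]) =
      (\<lambda>s. (s, pl H s)) ` {real l..real (Suc (l + n))}" for n
  proof (induction n arbitrary: l)
    case 0
    have "[l..<Suc (Suc (l + 0))] = [l, Suc l]" by (simp add: upt_rec)
    then show ?case using segment_eq_graph[of l H] by simp
  next
    case (Suc n)
    have "[l..<Suc (Suc (l + Suc n))] = l # Suc l # [Suc (Suc l)..<Suc (Suc (l + Suc n))]"
      by (simp add: upt_conv_Cons)
    note eq1 = this
    have eq2: "Suc l # [Suc (Suc l)..<Suc (Suc (l + Suc n))] = [Suc l..<Suc (Suc (Suc l + n))]"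
      by (simp add: upt_conv_Cons)
    have chain: "polygonal_chain (map g (l # Suc l # xs)) = closed_segment (g l) (g (Suc l)) \<union> polygonal_chain (map g (Suc l # xs))" for g xs
      by simp
    have "polygonal_chain (map (\<lambda>c. (real c, real (H c))) [l..<Suc (Suc (l + Suc n))]) =
       closed_segment (real l, real (H l)) (real (Suc l), real (H (Suc l))) \<union>
       polygonal_chain (map (\<lambda>c. (real c, real (H c))) [Suc l..<Suc (Suc (Suc l + n))])"
      by (simp only: eq1 chain) (simp only: eq2)
    also have "\<dots> = (\<lambda>s. (s, pl H s)) ` ({real l..real (Suc l)} \<union> {real (Suc l)..real (Suc (Suc l + n))})"
      unfolding Suc.IH[of "Suc l"] segment_eq_graph image_Un ..
    also have "{real l..real (Suc l)} \<union> {real (Suc l)..real (Suc (Suc l + n))} = {real l..real (Suc (l + Suc n))}"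
      by auto
    finally show ?case .
  qed
  from this[of "r - Suc l"] show ?thesis using assms
    by (simp add: drawn_curve_def pl_curve_def graph_curve_def grid_point_def image_image comp_def)
qed

lemma pl_curve_facts:
  assumes "l < r" "r < l + N"
  shows "simple_curve (pl_curve N l r H)" "pl_curve N l r H \<subseteq> cylinder" "cylindrically_monotone (pl_curve N l r H)"
    "curve_endpoint (pl_curve N l r H) (wrap N (real r, real (H r)))"
    "curve_between (pl_curve N l r H) (wrap N (real l, real (H l))) (wrap N (real r, real (H r)))"
proof -
  have cb: "curve_between (pl_curve N l r H) (wrap N (real l, real (H l))) (wrap N (real r, real (H r)))"
    using curve_between_graph_curve[of "real l" "real r" N "pl H"] continuous_on_pl[of l r H] assms
    by (simp add: pl_curve_def)
  show "curve_between (pl_curve N l r H) (wrap N (real l, real (H l))) (wrap N (real r, real (H r)))" by (rule cb)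
  show "simple_curve (pl_curve N l r H)" using cb unfolding simple_curve_def by blast
  show "pl_curve N l r H \<subseteq> cylinder" by (simp add: pl_curve_def graph_curve_subset_cylinder)
  show "cylindrically_monotone (pl_curve N l r H)"
    unfolding pl_curve_def by (rule cylindrically_monotone_graph_curve) (use assms in auto)
  show "curve_endpoint (pl_curve N l r H) (wrap N (real r, real (H r)))"
    using curve_between_commute[OF cb] unfolding curve_endpoint_def by blast
qed

lemma wrap_mem_pl_curve:
  assumes "N > 0" "r < l + N" "l \<le> c" "c \<le> r"
  shows "wrap N (real c, real z) \<in> pl_curve N l r H \<longleftrightarrow> z = H c"
  using wrap_mem_graph_curve[OF assms(1), of "real r" "real l" "real c" "real z" "pl H"] assms
  by (auto simp: pl_curve_def)

lemma wrap_add_N: "N > 0 \<Longrightarrow> wrap N (s + real N, z) = wrap N (s, z)"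
  unfolding wrap_eq_iff by (intro conjI refl exI[of _ 1]) simp

subsection \<open>Crossings of piecewise linear curves\<close>

lemma pl_less:
  assumes "\<And>c. c \<in> {lo..hi} \<Longrightarrow> f c < g c" "real lo \<le> s" "s \<le> real hi"
  shows "pl f s < pl g s"
proof (cases "s = real hi")
  case True
  then show ?thesis using assms by simp
next
  case False
  then obtain c where c: "lo \<le> c" "c < hi" "real c \<le> s" "s < real (Suc c)"
    using real_between_Suc[of lo s hi] assms(2,3) by auto
  have "real (f c) < real (g c)" "real (f (Suc c)) < real (g (Suc c))" using c assms(1) by auto
  then have "(1 - (s - c)) * (g c - real (f c)) + (s - c) * (g (Suc c) - real (f (Suc c))) > 0"
    using c by (intro add_pos_nonneg mult_pos_pos mult_nonneg_nonneg) auto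
  then show ?thesis using c by (simp add: pl_eq[of c] algebra_simps)
qed

lemma pl_less_end:
  assumes "\<And>c. c \<in> {lo..<hi} \<Longrightarrow> f c < g c" "f hi = g hi" "real lo \<le> s" "s < real hi"
  shows "pl f s < pl g s"
proof -
  obtain c where c: "lo \<le> c" "c < hi" "real c \<le> s" "s < real (Suc c)"
    using real_between_Suc[OF assms(3,4)] by blast
  have "real (f c) < real (g c)" using c assms(1)[of c] by simp
  moreover have "real (f (Suc c)) \<le> real (g (Suc c))"
    using c assms(1)[of "Suc c"] assms(2) by (cases "Suc c = hi") auto
  ultimately have "(1 - (s - c)) * (g c - real (f c)) + (s - c) * (g (Suc c) - real (f (Suc c))) > 0"
    using c by (intro add_pos_nonneg mult_pos_pos mult_nonneg_nonneg) auto
  then show ?thesis using c by (simp add: pl_eq[of c] algebra_simps)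
qed

text \<open>\<open>m\<close> is the last column in which \<open>f\<close> is the lower curve. Values
  of \<open>m\<close> outside \<open>A\<close> are allowed and mean that the order never changes, so
  a single notion covers one crossing and none.\<close>

definition flips :: "(nat \<Rightarrow> nat) \<Rightarrow> (nat \<Rightarrow> nat) \<Rightarrow> nat set \<Rightarrow> nat \<Rightarrow> bool" where
  "flips f g A m \<longleftrightarrow> (\<forall>c\<in>A. if c \<le> m then f c < g c else g c < f c)"

text \<open>Interpolation preserves the strict order on both sides of the strip from
  \<open>m\<close> to \<open>m + 1\<close>. In the strip the difference is linear and changes sign,
  hence has nonzero slope; the explicit zero gives uniqueness, the different slopes a proper
  crossing.\<close>

lemma flips_zero:
  assumes "flips f g {lo..hi} m \<or> flips g f {lo..hi} m" "real lo \<le> s" "s \<le> real hi" "pl f s = pl g s"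
  shows "lo \<le> m" "Suc m \<le> hi" "real m < s" "s < real (Suc m)"
    "real (f (Suc m)) - real (f m) \<noteq> real (g (Suc m)) - real (g m)"
    "s = real m + (real (f m) - real (g m)) / ((real (g (Suc m)) - real (g m)) - (real (f (Suc m)) - real (f m)))"
proof -
  have gt: "real m < s"
  proof (rule ccontr)
    assume "\<not> real m < s"
    then have "s \<le> real (min m hi)" using assms by (simp add: min_def)
    then have "pl f s < pl g s \<or> pl g s < pl f s"
      using assms pl_less[of lo "min m hi" f g s] pl_less[of lo "min m hi" g f s] by (auto simp: flips_def)
    then show False using assms by simp
  qed
  have lt: "s < real (Suc m)"
  proof (rule ccontr)
    assume "\<not> s < real (Suc m)"
    then have "real (max (Suc m) lo) \<le> s" using assms by (simp add: max_def)
    then have "pl f s < pl g s \<or> pl g s < pl f s"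
      using assms pl_less[of "max (Suc m) lo" hi f g s] pl_less[of "max (Suc m) lo" hi g f s] by (auto simp: flips_def)
    then show False using assms by simp
  qed
  show "real m < s" "s < real (Suc m)" by fact+
  show lo: "lo \<le> m" and hi: "Suc m \<le> hi" using gt lt assms by linarith+
  let ?K = "(real (g (Suc m)) - real (g m)) - (real (f (Suc m)) - real (f m))"
  have signs: "f m < g m \<and> g (Suc m) < f (Suc m) \<or> g m < f m \<and> f (Suc m) < g (Suc m)"
    using assms(1) lo hi by (auto simp: flips_def)
  then show slopes: "real (f (Suc m)) - real (f m) \<noteq> real (g (Suc m)) - real (g m)" by linarith
  have "(s - real m) * ?K = real (f m) - real (g m)"
    using assms(4) gt lt pl_eq[of m s f] pl_eq[of m s g] by (simp add: algebra_simps)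
  then have "s - real m = (real (f m) - real (g m)) / ?K"
    using slopes by (simp add: eq_divide_eq)
  then show "s = real m + (real (f m) - real (g m)) / ?K" by simp
qed

lemma flips_unique:
  assumes "flips f g {lo..hi} m \<or> flips g f {lo..hi} m" "real lo \<le> s" "s \<le> real hi" "pl f s = pl g s"
    "real lo \<le> s'" "s' \<le> real hi" "pl f s' = pl g s'"
  shows "s = s'"
  using flips_zero(6)[OF assms(1-4)] flips_zero(6)[OF assms(1,5-7)] by simp

lemma proper_crossing_pl_curves:
  fixes k :: nat
  assumes N: "N > 0" and "r < l + N" "r' < l' + N"
    and "l' \<le> m" "Suc m \<le> r'" "l \<le> m + k * N" "Suc m + k * N \<le> r"
    and s: "real m < s" "s < real (Suc m)" "pl H (s + real (k * N)) = pl H' s"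
    and slopes: "real (H (Suc m + k * N)) - real (H (m + k * N)) \<noteq> real (H' (Suc m)) - real (H' m)"
  shows "proper_crossing cylinder (pl_curve N l r H) (pl_curve N l' r' H') (wrap N (s, pl H' s))"
proof -
  let ?s0 = "s + real (k * N)" and ?e = "min (s - real m) (real (Suc m) - s)"
  let ?\<mu> = "real (H (Suc m + k * N)) - real (H (m + k * N))" and ?\<nu> = "real (H' (Suc m)) - real (H' m)"
  have e: "?e > 0" using s by simp
  have lin: "pl F x = pl F x0 + (real (F (Suc c)) - real (F c)) * (x - x0)"
    if "real c \<le> x" "x \<le> real (Suc c)" "real c \<le> x0" "x0 \<le> real (Suc c)" for F x x0 c
    using that by (simp add: pl_eq[of c] algebra_simps)
  have "proper_crossing cylinder (pl_curve N l r H) (pl_curve N l' r' H') (wrap N (?s0, pl H' s))"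
    unfolding pl_curve_def
  proof (rule proper_crossing_graph_curves[where e = ?e and k = "int k" and \<mu> = ?\<mu> and \<nu> = ?\<nu>])
    fix x assume "\<bar>x - ?s0\<bar> < ?e"
    then have x: "real (m + k * N) \<le> x" "x \<le> real (Suc (m + k * N))" "real m \<le> x - real (k * N)" "x - real (k * N) \<le> real (Suc m)"
      by (auto simp: abs_less_iff)
    show "pl H x = pl H' s + ?\<mu> * (x - ?s0)"
      using lin[of "m + k * N" x ?s0 H] x s by simp
    show "pl H' (x - of_int (int k) * real N) = pl H' s + ?\<nu> * (x - ?s0)"
      using lin[of m "x - real (k * N)" s H'] x s by (simp add: algebra_simps)
  next
    have "real l \<le> real (m + k * N)" "real (Suc m + k * N) \<le> real r" "real l' \<le> real m" "real (Suc m) \<le> real r'"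
      using assms by (simp_all only: of_nat_le_iff)
    then show "real l \<le> ?s0 - ?e" "?s0 + ?e \<le> real r"
      "real l' \<le> ?s0 - of_int (int k) * real N - ?e" "?s0 - of_int (int k) * real N + ?e \<le> real r'"
      by (auto simp: min_def)
  qed (use assms e in auto)
  moreover have "wrap N (?s0, pl H' s) = wrap N (s, pl H' s)"
    unfolding wrap_eq_iff[OF N] by (intro conjI refl exI[of _ "int k"]) simp
  ultimately show ?thesis by simp
qed

definition pair_ok :: "(complex \<times> real) set \<Rightarrow> (complex \<times> real) set \<Rightarrow> bool" where
  "pair_ok C D \<longleftrightarrow> meet_at_most_once C D \<and>
     (\<forall>p \<in> C \<inter> D. proper_crossing cylinder C D p \<or> (curve_endpoint C p \<and> curve_endpoint D p))"

lemma pair_ok_commute: "pair_ok C D \<Longrightarrow> pair_ok D C"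
  unfolding pair_ok_def meet_at_most_once_def using proper_crossing_commute by blast

lemma pair_ok_meet: "pair_ok C C' \<Longrightarrow> meet_at_most_once C' C"
  unfolding pair_ok_def meet_at_most_once_def by blast

text \<open>The bounds on the ranges leave only 0 or 1 full turns between the parameters of a common
  point.\<close>

lemma pl_curves_meet:
  assumes N: "N > 0" and "r' < l + N" "r < l' + 2 * N" and p: "p \<in> pl_curve N l r H" "p \<in> pl_curve N l' r' H'"
  obtains s where "real (max l l') \<le> s" "s \<le> real (min r r')" "pl H s = pl H' s" "p = wrap N (s, pl H' s)"
  | s where "real (max (l - N) l') \<le> s" "s \<le> real (min (r - N) r')" "N \<le> r" "pl H (s + real N) = pl H' s" "p = wrap N (s, pl H' s)"
proof -
  obtain s s' where s: "s \<in> {real l..real r}" "p = wrap N (s, pl H s)" and s': "s' \<in> {real l'..real r'}" "p = wrap N (s', pl H' s')"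
    using p unfolding pl_curve_def graph_curve_def by auto
  then have "wrap N (s, pl H s) = wrap N (s', pl H' s')" by simp
  then have "pl H s = pl H' s'" and "\<exists>k::int. s = s' + k * real N" using wrap_eq_iff[OF N] by blast+
  then obtain k :: int where k: "s = s' + k * real N" and eq: "pl H s = pl H' s'" by blast
  have "k * real N < 2 * real N"
  proof -
    have "real r < real (l' + 2 * N)" using assms(3) by (simp only: of_nat_less_iff)
    then show ?thesis using s s' k by auto
  qed
  note u1 = this
  have u2: "-1 * real N < k * real N"
  proof -
    have "real r' < real (l + N)" using assms(2) by (simp only: of_nat_less_iff)
    then show ?thesis using s s' k by auto
  qed
  have "real_of_int k < 2" "-1 < real_of_int k" by (rule mult_right_less_imp_less[OF u1] mult_right_less_imp_less[OF u2], simp)+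
  then have "k = 0 \<or> k = 1" by linarith
  then show thesis
  proof
    assume "k = 0"
    then show thesis using that(1)[of s'] k eq s s' by auto
  next
    assume "k = 1"
    then have k1: "s = s' + real N" using k by simp
    then have "real N \<le> real r" using s s' by auto
    then have "N \<le> r" by simp
    moreover have "real (l - N) \<le> s'" using s s' k1 by (cases "l \<le> N") (auto simp: of_nat_diff)
    ultimately show thesis using that(2)[of s'] k1 eq s s' by (auto simp: of_nat_diff)
  qed
qed

text \<open>Both curves lie within one turn of each other, so a common point has the same parameter
  on both and the situation is that of the plane.\<close>

lemma pair_ok_planar:
  assumes N: "N > 0" and "l < r" "l' < r'" and len: "r < l + N" "r' < l' + N" and window: "r' < l + N" "r < l' + N"
    and fl: "flips H H' {max l l'..min r r'} m \<or> flips H' H {max l l'..min r r'} m"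
  shows "pair_ok (pl_curve N l r H) (pl_curve N l' r' H')"
proof -
  have hit: "\<exists>s. real (max l l') \<le> s \<and> s \<le> real (min r r') \<and> pl H s = pl H' s \<and> p = wrap N (s, pl H' s)"
    if "p \<in> pl_curve N l r H \<inter> pl_curve N l' r' H'" for p
  proof -
    have p: "p \<in> pl_curve N l r H" "p \<in> pl_curve N l' r' H'" "r < l' + 2 * N" using that window by auto
    show ?thesis
      by (rule pl_curves_meet[OF N window(1) p(3,1,2)]) (use window in force)+
  qed
  show ?thesis unfolding pair_ok_def meet_at_most_once_def
  proof (intro conjI ballI disjI1)
    fix p q assume "p \<in> pl_curve N l r H \<inter> pl_curve N l' r' H'" "q \<in> pl_curve N l r H \<inter> pl_curve N l' r' H'"
    then show "p = q" using hit flips_unique[OF fl] by metis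
  next
    fix p assume "p \<in> pl_curve N l r H \<inter> pl_curve N l' r' H'"
    then obtain s where s: "real (max l l') \<le> s" "s \<le> real (min r r')" "pl H s = pl H' s" "p = wrap N (s, pl H' s)"
      using hit by blast
    note z = flips_zero[OF fl s(1-3)]
    show "proper_crossing cylinder (pl_curve N l r H) (pl_curve N l' r' H') p"
      unfolding s(4) by (rule proper_crossing_pl_curves[where k = 0 and m = m]) (use z N len s in auto)
  qed
qed

lemma pair_ok_common_end:
  assumes N: "N > 0" and "l < r" "l' < r" and window: "r < l + N" "r < l' + N"
    and less: "\<And>c. c \<in> {max l l'..<r} \<Longrightarrow> H c < H' c" and eq: "H r = H' r"
  shows "pair_ok (pl_curve N l r H) (pl_curve N l' r H')"
proof -
  have hit: "p = wrap N (real r, real (H r))" if "p \<in> pl_curve N l r H \<inter> pl_curve N l' r H'" for p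
  proof -
    have p: "p \<in> pl_curve N l r H" "p \<in> pl_curve N l' r H'" "r < l' + 2 * N" using that window by auto
    show ?thesis
    proof (rule pl_curves_meet[OF N window(1) p(3,1,2)])
      fix s assume s: "real (max l l') \<le> s" "s \<le> real (min r r)" "pl H s = pl H' s" "p = wrap N (s, pl H' s)"
      have "\<not> s < real r"
      proof
        assume "s < real r"
        from pl_less_end[of "max l l'" r H H' s, OF less eq s(1) this] show False using s(3) by simp
      qed
      moreover have "s \<le> real r" using s(2) by simp
      ultimately have "s = real r" by linarith
      then show ?thesis using s eq by simp
    qed (use window in force)
  qed
  show ?thesis unfolding pair_ok_def meet_at_most_once_def
  proof (intro conjI ballI disjI2)
    fix p q assume pq: "p \<in> pl_curve N l r H \<inter> pl_curve N l' r H'" "q \<in> pl_curve N l r H \<inter> pl_curve N l' r H'"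
    show "p = q" unfolding hit[OF pq(1)] hit[OF pq(2)] ..
  next
    fix p assume p: "p \<in> pl_curve N l r H \<inter> pl_curve N l' r H'"
    show "curve_endpoint (pl_curve N l r H) p" unfolding hit[OF p] by (rule pl_curve_facts) (use assms in auto)
    show "curve_endpoint (pl_curve N l' r H') p" unfolding hit[OF p] eq by (rule pl_curve_facts) (use assms in auto)
  qed
qed

text \<open>For a curve that also overlaps the next copy of the other one in the universal cover.\<close>

lemma pair_ok_shifted:
  assumes N: "N > 0" and "l < r" "l' < r'" and window: "r < l + N" "r' < l' + N" "r' < l + N" "r < l' + 2 * N"
    and fl: "flips H H' {max l l'..min r r'} m \<or> flips H' H {max l l'..min r r'} m"
    and fl': "flips (\<lambda>c. H (c + N)) H' {max (l - N) l'..min (r - N) r'} m' \<or> flips H' (\<lambda>c. H (c + N)) {max (l - N) l'..min (r - N) r'} m'"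
    and const: "(\<forall>c\<in>{max l l'..min r r'}. H' c < H c) \<or> (\<forall>c\<in>{max (l - N) l'..min (r - N) r'}. H' c < H (c + N)) \<or>
      (\<forall>c\<in>{max l l'..min r r'}. H c < H' c) \<or> (\<forall>c\<in>{max (l - N) l'..min (r - N) r'}. H (c + N) < H' c)"
  shows "pair_ok (pl_curve N l r H) (pl_curve N l' r' H')"
proof -
  let ?P = "\<lambda>s p. real (max l l') \<le> s \<and> s \<le> real (min r r') \<and> pl H s = pl H' s \<and> p = wrap N (s, pl H' s)"
  let ?Q = "\<lambda>s p. real (max (l - N) l') \<le> s \<and> s \<le> real (min (r - N) r') \<and> N \<le> r \<and> pl (\<lambda>c. H (c + N)) s = pl H' s \<and> p = wrap N (s, pl H' s)"
  have hit: "(\<exists>s. ?P s p) \<or> (\<exists>s. ?Q s p)"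
    if "p \<in> pl_curve N l r H \<inter> pl_curve N l' r' H'" for p
  proof -
    have p: "p \<in> pl_curve N l r H" "p \<in> pl_curve N l' r' H'" using that by auto
    show ?thesis
    proof (rule pl_curves_meet[OF N window(3,4) p])
      fix s assume s: "real (max (l - N) l') \<le> s" "s \<le> real (min (r - N) r')" "N \<le> r" "pl H (s + real N) = pl H' s" "p = wrap N (s, pl H' s)"
      then have "0 \<le> s" by linarith
      then show ?thesis using s pl_shift[of s H N] by auto
    qed blast
  qed
  \<comment> \<open>Each copy admits at most one meeting by its \<open>flips\<close> assumption;
    \<open>const\<close> keeps one copy entirely free, so that the two do not add up.\<close>
  have excl: "False" if "?P s p" "?Q s' q" for s s' p q
    using const
  proof (elim disjE)
    assume "\<forall>c\<in>{max l l'..min r r'}. H' c < H c"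
    then show False using pl_less[of "max l l'" "min r r'" H' H s] that by auto
  next
    assume "\<forall>c\<in>{max l l'..min r r'}. H c < H' c"
    then show False using pl_less[of "max l l'" "min r r'" H H' s] that by auto
  next
    assume "\<forall>c\<in>{max (l - N) l'..min (r - N) r'}. H' c < H (c + N)"
    then show False using pl_less[of "max (l - N) l'" "min (r - N) r'" H' "\<lambda>c. H (c + N)" s'] that by auto
  next
    assume "\<forall>c\<in>{max (l - N) l'..min (r - N) r'}. H (c + N) < H' c"
    then show False using pl_less[of "max (l - N) l'" "min (r - N) r'" "\<lambda>c. H (c + N)" H' s'] that by auto
  qed
  show ?thesis unfolding pair_ok_def meet_at_most_once_def
  proof (intro conjI ballI disjI1)
    fix p q assume "p \<in> pl_curve N l r H \<inter> pl_curve N l' r' H'" "q \<in> pl_curve N l r H \<inter> pl_curve N l' r' H'"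
    then have "(\<exists>s. ?P s p) \<or> (\<exists>s. ?Q s p)" "(\<exists>s. ?P s q) \<or> (\<exists>s. ?Q s q)" using hit by blast+
    then consider s s' where "?P s p" "?P s' q" | s s' where "?Q s p" "?Q s' q" using excl by blast
    then show "p = q"
    proof cases
      case 1
      then show ?thesis using flips_unique[OF fl, of s s'] by blast
    next
      case 2
      then show ?thesis using flips_unique[OF fl', of s s'] by blast
    qed
  next
    fix p assume "p \<in> pl_curve N l r H \<inter> pl_curve N l' r' H'"
    then consider s where "?P s p" | s where "?Q s p" using hit by blast
    then show "proper_crossing cylinder (pl_curve N l r H) (pl_curve N l' r' H') p"
    proof cases
      case s: 1
      have z: "max l l' \<le> m" "Suc m \<le> min r r'" "real m < s" "s < real (Suc m)"
        "real (H (Suc m)) - real (H m) \<noteq> real (H' (Suc m)) - real (H' m)"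
        using flips_zero[OF fl, of s] s by blast+
      have p: "p = wrap N (s, pl H' s)" using s by blast
      show ?thesis
        unfolding p by (rule proper_crossing_pl_curves[where k = 0 and m = m]) (use z N window s in auto)
    next
      case s: 2
      have z: "max (l - N) l' \<le> m'" "Suc m' \<le> min (r - N) r'" "real m' < s" "s < real (Suc m')"
        "real (H (Suc m' + N)) - real (H (m' + N)) \<noteq> real (H' (Suc m')) - real (H' m')"
        using flips_zero[OF fl', of s] s by blast+
      have "0 \<le> s" using z(3) by linarith
      then have sh: "pl H (s + real N) = pl H' s" using s pl_shift[of s H N] by simp
      have p: "p = wrap N (s, pl H' s)" using s by blast
      show ?thesis
        unfolding p by (rule proper_crossing_pl_curves[where k = 1 and m = m']) (use z N window s sh in auto)
    qed
  qed
qed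

subsection \<open>Intersections with a graph\<close>

definition hits :: "(real \<Rightarrow> real) \<Rightarrow> nat \<Rightarrow> nat \<Rightarrow> nat \<Rightarrow> (nat \<Rightarrow> nat) \<Rightarrow> real \<Rightarrow> bool" where
  "hits d N l r H s \<longleftrightarrow> wrap N (s, d s) \<in> pl_curve N l r H"

lemma hits_unique:
  assumes "meet_at_most_once (pl_curve N l r H) D" "wrap N (s, d s) \<in> D" "wrap N (s', d s') \<in> D"
    "hits d N l r H s" "hits d N l r H s'" "\<bar>s - s'\<bar> < real N"
  shows "s = s'"
proof -
  have N: "N > 0" using assms(6) by (cases N) auto
  have "wrap N (s, d s) = wrap N (s', d s')"
    using assms unfolding hits_def meet_at_most_once_def by blast
  then obtain k :: int where k: "s = s' + k * real N" using wrap_eq_iff[OF N] by blast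
  then have "k = 0" using assms(6) by (intro of_int_mult_small) simp
  then show ?thesis using k by simp
qed

text \<open>Intermediate values for the difference. The strict signs at both columns put the
  intersection strictly between them, so that intersections found in different column ranges are
  distinct.\<close>

lemma hits_between:
  fixes k :: nat
  assumes N: "N > 0" and cont: "continuous_on {real c..real c'} d" and c: "c < c'" "l \<le> c + k * N" "c' + k * N \<le> r"
    and signs: "d (real c) < real (H (c + k * N)) \<and> real (H (c' + k * N)) < d (real c') \<or>
      real (H (c + k * N)) < d (real c) \<and> d (real c') < real (H (c' + k * N))"
  obtains s where "real c < s" "s < real c'" "hits d N l r H s"
proof -
  let ?h = "\<lambda>s. d s - pl H (s + real (k * N))"
  have add: "real x + real (k * N) = real (x + k * N)" for x by simp
  have "continuous_on {real c..real c'} (\<lambda>s. pl H (s + real (k * N)))"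
  proof (rule continuous_on_compose2[OF continuous_on_pl[of "c + k * N" "c' + k * N"]])
    show "continuous_on {real c..real c'} (\<lambda>s. s + real (k * N))" by (intro continuous_intros)
  qed (use c in auto)
  then have ch: "continuous_on {real c..real c'} ?h" by (intro continuous_intros cont)
  have hc: "?h (real c) = d (real c) - real (H (c + k * N))" "?h (real c') = d (real c') - real (H (c' + k * N))"
    unfolding add pl_nat by (rule refl)+
  have "\<exists>s. real c \<le> s \<and> s \<le> real c' \<and> ?h s = 0"
    using signs
  proof
    assume "d (real c) < real (H (c + k * N)) \<and> real (H (c' + k * N)) < d (real c')"
    then show ?thesis using IVT'[of ?h "real c" 0 "real c'"] ch hc c by auto
  next
    assume "real (H (c + k * N)) < d (real c) \<and> d (real c') < real (H (c' + k * N))"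
    then show ?thesis using IVT2'[of ?h "real c'" 0 "real c"] ch hc c by auto
  qed
  then obtain s where s: "real c \<le> s" "s \<le> real c'" "?h s = 0" by blast
  then have "s \<noteq> real c" "s \<noteq> real c'" using hc signs by auto
  then have s': "real c < s" "s < real c'" using s by auto
  have "wrap N (s, d s) = wrap N (s + real (k * N), pl H (s + real (k * N)))"
    unfolding wrap_eq_iff[OF N] using s by (intro conjI exI[of _ "- int k"]) auto
  moreover have "s + real (k * N) \<in> {real l..real r}"
  proof -
    have "real l \<le> real (c + k * N)" "real (c' + k * N) \<le> real r" using c by (simp_all only: of_nat_le_iff)
    then show ?thesis using s' by auto
  qed
  ultimately have "hits d N l r H s" unfolding hits_def pl_curve_def graph_curve_def by auto
  then show thesis using that s' by blast
qed

lemma hits_nat: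
  assumes "N > 0" "l \<le> c + k * N" "c + k * N \<le> r" "d (real c) = real (H (c + k * N))"
  shows "hits d N l r H (real c)"
proof -
  have "wrap N (real c, d (real c)) = wrap N (real (c + k * N), pl H (real (c + k * N)))"
    unfolding wrap_eq_iff[OF assms(1)] pl_nat using assms(4) by (intro conjI exI[of _ "- int k"]) auto
  moreover have "real (c + k * N) \<in> {real l..real r}" using assms(2,3) by (simp only: atLeastAtMost_iff of_nat_le_iff)
  ultimately show ?thesis unfolding hits_def pl_curve_def graph_curve_def by auto
qed

section \<open>The arrangement of a CNF formula\<close>

text \<open>\<open>TopC\<close> ends at \<open>b\<close> and \<open>BlockC\<close> at
  \<open>a\<close>; these are the two barriers. \<open>GuardC j\<close> has to be crossed just
  before \<open>b\<close> and pushes the connecting curve down in clause \<open>j\<close>.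
  \<open>LinkC j i\<close> passes this push from literal \<open>i\<close> on to literal
  \<open>i + 1\<close>. \<open>BarC x\<close> ends at \<open>a\<close> and lifts the connecting
  curve in the middle of gadget \<open>x\<close>; \<open>VarC x\<close> runs along that
  gadget.\<close>

datatype curve_id = TopC | BlockC | GuardC nat | LitC nat nat | LinkC nat nat | BarC nat | VarC nat

text \<open>There are \<open>J\<close> clauses with \<open>w\<close> literals each; the \<open>i\<close>-th literal of clause \<open>j\<close> is the variable
  \<open>var j i < Vn\<close>, negated iff \<open>pol j i\<close> is False, and has number \<open>row j + i\<close>. Columns \<open>0\<close> (identified with \<open>N\<close>),
  \<open>1, \<dots>\<close> hold the point \<open>a\<close> and the clause gadgets, columns from \<open>X0\<close> on the variable gadgets, and
  column \<open>Y + 2\<close> the point \<open>b\<close>.\<close>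

locale cnf_arrangement =
  fixes J w Vn :: nat and var :: "nat \<Rightarrow> nat \<Rightarrow> nat" and pol :: "nat \<Rightarrow> nat \<Rightarrow> bool"
  assumes J: "J \<ge> 1" and w: "w \<ge> 2" and var: "\<And>j i. j < J \<Longrightarrow> i < w \<Longrightarrow> var j i < Vn"
begin

text \<open>The literals of a clause are \<open>0, ..., v + 1\<close> and its links
  \<open>0, ..., v\<close>.\<close>

definition v :: nat where "v = w - 2"
definition occ :: nat where "occ = J * w"
definition row :: "nat \<Rightarrow> nat" where "row j = j * w"
definition B :: "nat \<Rightarrow> nat" where "B j = 1 + 2 * row j"
definition X0 :: nat where "X0 = 1 + 2 * occ"
definition G :: "nat \<Rightarrow> nat" where "G x = X0 + x * (2 * occ + 1)"
definition Y :: nat where "Y = G Vn"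
definition N :: nat where "N = Y + 4"
text \<open>Above the bars, the guards and the block as they pass column
  \<open>Y + 2\<close>.\<close>

definition be :: nat where "be = 8 * Vn + 8 * J + 16"
definition Hh :: nat where "Hh = 8 * Y + be + 8 * J + 16"
text \<open>The level of a literal descends with its starting column, so the literals that have
  started earlier pass above a later start. The size of \<open>Hh\<close> keeps these levels above
  \<open>be\<close> and above the guards in column \<open>Y + 1\<close>.\<close>

definition la :: "nat \<Rightarrow> nat" where "la c = Hh - 8 * c"
text \<open>The level that a literal starting just behind gadget \<open>x\<close> would have: lower
  than those of all literals starting inside the gadget.\<close>

definition eb :: "nat \<Rightarrow> nat" where "eb x = la (G x + 2 * occ + 1)"
definition Z :: nat where "Z = 8 * occ + 16"
definition Top :: nat where "Top = Hh + Z + 8 * J + 16"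
text \<open>The level of literal number \<open>r\<close> in the clause gadgets, where later literals
  are lower and all of them are below \<open>a\<close>.\<close>

definition base :: "nat \<Rightarrow> nat" where "base r = 8 * occ - 8 * r"
text \<open>A gadget has \<open>occ\<close> columns for positive literals, one middle column for the
  bar, and \<open>occ\<close> columns for negative ones. The offset is the literal number, which
  makes all starting columns distinct.\<close>

definition q :: "nat \<Rightarrow> nat \<Rightarrow> nat" where "q j i = G (var j i) + (if pol j i then 0 else occ + 1) + (row j + i)"

fun lo :: "curve_id \<Rightarrow> nat" where
  "lo TopC = Y + 3"
| "lo BlockC = Y + 2"
| "lo (GuardC j) = Y + 1"
| "lo (LitC j i) = q j i"
| "lo (LinkC j i) = N + B j + i"
| "lo (BarC x) = G x + occ"
| "lo (VarC x) = G x"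

fun hi :: "curve_id \<Rightarrow> nat" where
  "hi TopC = N + Y + 2"
| "hi BlockC = N"
| "hi (GuardC j) = N + B j + v + 1"
| "hi (LitC j i) = (if i \<le> v then N + B j + i else N + B j + 2 * v + 2)"
| "hi (LinkC j i) = N + B j + w + i"
| "hi (BarC x) = N"
| "hi (VarC x) = G x + 2 * occ"

text \<open>Columns from \<open>N\<close> on belong to the next turn, that is, to the clause
  gadgets. The named levels are multiples of 8. In a variable gadget the offsets from
  \<open>eb x\<close> are 2 for literals, 4 for the curve along the gadget and 6 for the bar; in a
  clause the offsets from \<open>base\<close> are 2 for ends of guards and links, 4 for links and 6
  for literals.\<close>

fun ht :: "curve_id \<Rightarrow> nat \<Rightarrow> nat" where
  "ht TopC c = (if c \<le> N + Y then Top else be)"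
| "ht BlockC c = (if c \<le> Y + 2 then 8 * Vn + 8 * J + 8 else if c < N then Top + 8 else Z)"
| "ht (GuardC j) c = (if c \<le> Y + 1 then be + 8 * j + 8 else if c < N then 8 * Vn + 8 * j + 8
     else if c < N + B j + v + 1 then Z + 8 * j + 8 else base (row j) + 2)"
| "ht (LitC j i) c = (if c \<le> q j i then eb (var j i) + 2 else if c < N then la (q j i) else base (row j + i) + 6)"
| "ht (LinkC j i) c = (if c < N + B j + w + i then base (row j + i) + 4 else base (row j + i + 1) + 2)"
| "ht (BarC x) c = (if c \<le> G x + occ then eb x + 6 else if c < N then 8 * x + 8 else Z)"
| "ht (VarC x) c = eb x + 4"

fun valid :: "curve_id \<Rightarrow> bool" where
  "valid (GuardC j) \<longleftrightarrow> j < J"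
| "valid (LitC j i) \<longleftrightarrow> j < J \<and> i < w"
| "valid (LinkC j i) \<longleftrightarrow> j < J \<and> i \<le> v"
| "valid (BarC x) \<longleftrightarrow> x < Vn"
| "valid (VarC x) \<longleftrightarrow> x < Vn"
| "valid _ \<longleftrightarrow> True"

definition curve :: "curve_id \<Rightarrow> (complex \<times> real) set" where
  "curve a = pl_curve N (lo a) (hi a) (ht a)"

abbreviation "pt_a \<equiv> wrap N (real 0, real Z)"
abbreviation "pt_b \<equiv> wrap N (real (Y + 2), real be)"

subsection \<open>Linear facts\<close>

text \<open>Here and in the next lemmas products and truncated differences are turned into linear
  relations between atoms such as \<open>occ\<close>, \<open>row j\<close> and \<open>G x\<close>,
  so that linear arithmetic settles the comparisons of heights.\<close>

lemma const_facts:
  "N = Y + 4" "be = 8 * Vn + 8 * J + 16" "Hh = 8 * Y + be + 8 * J + 16" "Z = 8 * occ + 16"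
  "Top = Hh + Z + 8 * J + 16" "X0 = 1 + 2 * occ" "w \<le> occ" "X0 \<le> Y" "w = v + 2"
  using J w by (simp_all add: v_def N_def be_def Hh_def Z_def Top_def X0_def occ_def Y_def G_def)

lemma clause_facts:
  assumes "j < J"
  shows "B j = 1 + 2 * row j" "row j + w \<le> occ"
proof -
  have "Suc j * w \<le> J * w" using assms by (intro mult_le_mono1) simp
  then show "row j + w \<le> occ" by (simp add: occ_def row_def)
qed (simp add: B_def)

lemma clause_order: "j < j' \<Longrightarrow> row j + w \<le> row j'"
  using mult_le_mono1[of "Suc j" j' w] by (simp add: row_def)

lemma G_order: "x < x' \<Longrightarrow> G x + 2 * occ + 1 \<le> G x'"
  using mult_le_mono1[of "Suc x" x' "2 * occ + 1"] by (simp add: G_def)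

lemma la_eq: "c \<le> Y \<Longrightarrow> la c + 8 * c = Hh"
  by (simp add: la_def Hh_def)

lemma base_eq: "r \<le> occ \<Longrightarrow> base r + 8 * r = 8 * occ"
  by (simp add: base_def)

lemma block_facts:
  assumes "x < Vn"
  shows "X0 \<le> G x" "G x + 2 * occ + 1 \<le> Y" "eb x + 8 * G x + 16 * occ + 8 = Hh"
  using G_order[OF assms] la_eq[of "G x + 2 * occ + 1"] by (simp_all add: Y_def eb_def G_def)

lemma lit_facts:
  assumes "j < J" "i < w"
  shows "G (var j i) \<le> q j i" "q j i \<le> G (var j i) + 2 * occ" "q j i \<noteq> G (var j i) + occ" "la (q j i) + 8 * q j i = Hh"
    "pol j i \<Longrightarrow> q j i < G (var j i) + occ" "\<not> pol j i \<Longrightarrow> G (var j i) + occ < q j i"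
    "base (row j + i) + 8 * row j + 8 * i = 8 * occ" "row j + i < occ"
proof -
  have r: "row j + i < occ" using clause_facts[OF assms(1)] assms(2) by linarith
  then show "row j + i < occ" "base (row j + i) + 8 * row j + 8 * i = 8 * occ" using base_eq[of "row j + i"] by (simp_all add: algebra_simps)
  show a: "G (var j i) \<le> q j i" "q j i \<le> G (var j i) + 2 * occ" "q j i \<noteq> G (var j i) + occ"
    "pol j i \<Longrightarrow> q j i < G (var j i) + occ" "\<not> pol j i \<Longrightarrow> G (var j i) + occ < q j i"
    using r by (auto simp: q_def)
  show "la (q j i) + 8 * q j i = Hh"
    using a(2) block_facts(2)[OF var[OF assms]] by (intro la_eq) linarith
qed

lemma link_facts:
  assumes "j < J" "i \<le> v"
  shows "base (row j + i) + 8 * row j + 8 * i = 8 * occ" "base (row j + i + 1) + 8 = base (row j + i)" "row j + i + 1 < occ" "i + 1 < w"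
proof -
  show i: "i + 1 < w" using assms const_facts by linarith
  show "base (row j + i) + 8 * row j + 8 * i = 8 * occ" "base (row j + i + 1) + 8 = base (row j + i)" "row j + i + 1 < occ"
    using lit_facts(7,8)[OF assms(1), of i] lit_facts(7,8)[OF assms(1), of "i + 1"] i by (auto simp: add.assoc)
qed

lemma q_block:
  assumes "j < J" "i < w" "x < Vn"
  shows "q j i < G x \<or> var j i = x \<and> G x \<le> q j i \<and> q j i \<le> G x + 2 * occ \<or> G x + 2 * occ + 1 \<le> q j i"
  using lit_facts[OF assms(1,2)] G_order[of x "var j i"] G_order[of "var j i" x] by (cases "var j i" x rule: linorder_cases) auto

lemma q_inj:
  assumes "j < J" "i < w" "j' < J" "i' < w" "q j i = q j' i'"
  shows "row j + i = row j' + i'"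
proof -
  have "var j i = var j' i'"
    using q_block[OF assms(1,2) var[OF assms(3,4)]] lit_facts[OF assms(3,4)] assms(5) by auto
  then show ?thesis
    using assms(5) lit_facts(5,6,8)[OF assms(1,2)] lit_facts(5,6,8)[OF assms(3,4)] unfolding q_def
    by (cases "pol j i"; cases "pol j' i'") auto
qed

lemma number_inj: "i < w \<Longrightarrow> i' < w \<Longrightarrow> row j + i = row j' + i' \<Longrightarrow> j = j' \<and> i = i'"
  using clause_order[of j j'] clause_order[of j' j] by (cases j j' rule: linorder_cases) auto

lemma lit_start: "j < J \<Longrightarrow> i < w \<Longrightarrow> N \<le> c \<Longrightarrow> ht (LitC j i) c = base (row j + i) + 6"
  using lit_facts(2)[of j i] block_facts(2)[OF var[of j i]] const_facts(1) by simp

text \<open>All curves but \<open>TopC\<close> stay in the columns from \<open>X0\<close> to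
  \<open>X0 + N\<close>, so two of them can be compared as in the plane; only \<open>TopC\<close>
  also has to be compared after a shift by \<open>N\<close>.\<close>

lemma range_facts:
  assumes "valid a"
  shows "lo a < hi a" "hi a < lo a + N" "X0 \<le> lo a" "a \<noteq> TopC \<Longrightarrow> hi a < X0 + N"
proof -
  have "lo a < hi a \<and> X0 \<le> lo a \<and> (a \<noteq> TopC \<longrightarrow> hi a < X0 + N) \<and> hi a < lo a + N"
  proof (cases a)
    case (GuardC j)
    then show ?thesis using assms const_facts w clause_facts[of j] by auto
  next
    case (LitC j i)
    then show ?thesis using assms const_facts w clause_facts[of j] lit_facts[of j i] block_facts[OF var[of j i]] by auto
  next
    case (LinkC j i)
    then show ?thesis using assms const_facts w clause_facts[of j] by auto
  next
    case (BarC x)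
    then show ?thesis using assms const_facts w block_facts[of x] by auto
  next
    case (VarC x)
    then show ?thesis using assms const_facts w block_facts[of x] by auto
  qed (use const_facts w in auto)
  then show "lo a < hi a" "hi a < lo a + N" "X0 \<le> lo a" "a \<noteq> TopC \<Longrightarrow> hi a < X0 + N" by auto
qed

subsection \<open>Every pair crosses at most once\<close>

lemma planar:
  assumes "valid a" "valid b" "a \<noteq> TopC" "b \<noteq> TopC"
    and "\<And>c. lo a \<le> c \<Longrightarrow> lo b \<le> c \<Longrightarrow> c \<le> hi a \<Longrightarrow> c \<le> hi b \<Longrightarrow> if c \<le> m then ht a c < ht b c else ht b c < ht a c"
  shows "pair_ok (curve a) (curve b)"
  unfolding curve_def
proof (rule pair_ok_planar)
  show "flips (ht a) (ht b) {max (lo a) (lo b)..min (hi a) (hi b)} m \<or> flips (ht b) (ht a) {max (lo a) (lo b)..min (hi a) (hi b)} m"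
    using assms(5) by (auto simp: flips_def)
qed (use range_facts[OF assms(1)] range_facts[OF assms(2)] assms const_facts in auto)

lemma common_end:
  assumes "valid a" "valid b" "hi a = N" "hi b = N" "ht a N = ht b N"
    and "\<And>c. lo a \<le> c \<Longrightarrow> lo b \<le> c \<Longrightarrow> c < N \<Longrightarrow> ht a c < ht b c"
  shows "pair_ok (curve a) (curve b)"
  unfolding curve_def assms(3,4)
  by (rule pair_ok_common_end) (use range_facts[OF assms(1)] range_facts[OF assms(2)] assms const_facts in auto)

lemma below:
  assumes "valid a" "valid b" "a \<noteq> TopC" "b \<noteq> TopC"
    and "\<And>c. lo a \<le> c \<Longrightarrow> lo b \<le> c \<Longrightarrow> c \<le> hi a \<Longrightarrow> c \<le> hi b \<Longrightarrow> ht a c < ht b c"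
  shows "pair_ok (curve a) (curve b)"
  by (rule planar[where m = "hi a"]) (use assms in auto)

lemma disjoint:
  assumes "valid a" "valid b" "a \<noteq> TopC" "b \<noteq> TopC" "hi a < lo b"
  shows "pair_ok (curve a) (curve b)"
  by (rule planar[where m = 0]) (use assms in auto)

text \<open>The guard is below up to column \<open>N - 1\<close> and above at \<open>N\<close>, by
  \<open>Z + 8 * j + 8\<close> against \<open>Z\<close>; so it also passes above
  \<open>a\<close>.\<close>

lemma ok_Block_Guard:
  assumes "j < J"
  shows "pair_ok (curve (GuardC j)) (curve BlockC)"
proof (rule planar[where m = "Y + 3"])
  fix c assume "lo (GuardC j) \<le> c" "lo BlockC \<le> c" "c \<le> hi (GuardC j)" "c \<le> hi BlockC"
  then show "if c \<le> Y + 3 then ht (GuardC j) c < ht BlockC c else ht BlockC c < ht (GuardC j) c"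
    unfolding lo.simps hi.simps ht.simps using assms const_facts w clause_facts[OF assms(1)]
    by (auto split: if_splits)
qed (use assms const_facts  in auto)

text \<open>The block rises through all literals in the strip after column \<open>Y + 2\<close> and
  stays above them until it ends at \<open>a\<close>.\<close>

lemma ok_Block_Lit:
  assumes "j < J" "i < w"
  shows "pair_ok (curve BlockC) (curve (LitC j i))"
proof (rule planar[where m = "Y + 2"])
  fix c assume "lo BlockC \<le> c" "lo (LitC j i) \<le> c" "c \<le> hi BlockC" "c \<le> hi (LitC j i)"
  then show "if c \<le> Y + 2 then ht BlockC c < ht (LitC j i) c else ht (LitC j i) c < ht BlockC c"
    unfolding lo.simps hi.simps ht.simps using assms const_facts w clause_facts[OF assms(1)] lit_facts(1,2,4,7,8)[OF assms(1,2)] block_facts[OF var[OF assms(1,2)]]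
    by (auto split: if_splits)
qed (use assms const_facts  in auto)

lemma ok_Block_Bar:
  assumes "x < Vn"
  shows "pair_ok (curve (BarC x)) (curve BlockC)"
proof (rule common_end)
  fix c assume "lo (BarC x) \<le> c" "lo BlockC \<le> c" "c < N"
  then show "ht (BarC x) c < ht BlockC c"
    unfolding lo.simps hi.simps ht.simps using assms const_facts w assms block_facts[OF assms]
    by (auto split: if_splits)
qed (use assms const_facts assms block_facts[OF assms] in auto)

lemma ok_Block_Link:
  assumes "j < J" "i \<le> v"
  shows "pair_ok (curve BlockC) (curve (LinkC j i))"
  by (rule disjoint) (use assms const_facts w clause_facts[OF assms(1)] in auto)

lemma ok_Block_Var:
  assumes "x < Vn"
  shows "pair_ok (curve (VarC x)) (curve BlockC)"
  by (rule disjoint) (use assms const_facts w block_facts[OF assms] in auto)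

lemma ok_Guard_Guard:
  assumes "j < j'" "j' < J"
  shows "pair_ok (curve (GuardC j)) (curve (GuardC j'))"
proof (rule below)
  have j: "j < J" using assms by simp
  have base: "base (row j) + 8 * row j = 8 * occ" using clause_facts[OF j] by (intro base_eq) simp
  fix c assume "lo (GuardC j) \<le> c" "lo (GuardC j') \<le> c" "c \<le> hi (GuardC j)" "c \<le> hi (GuardC j')"
  then show "ht (GuardC j) c < ht (GuardC j') c"
    unfolding lo.simps hi.simps ht.simps using assms const_facts w assms(1) base clause_facts[OF j] clause_facts[OF assms(2)] clause_order[OF assms(1)]
    by (auto split: if_splits)
qed (use assms const_facts  in auto)

text \<open>The one crossing is in the strip before column \<open>N\<close>. In its last column the
  guard drops to the level of literal 0 of its clause, but there the literals of earlier clauses and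
  literals \<open>0, ..., v\<close> of its own have ended, and all others are lower.\<close>

lemma ok_Guard_Lit:
  assumes "j < J" "j' < J" "i' < w"
  shows "pair_ok (curve (GuardC j)) (curve (LitC j' i'))"
proof (rule planar[where m = "Y + 3"])
  have base: "base (row j) + 8 * row j = 8 * occ" using clause_facts[OF assms(1)] by (intro base_eq) simp
  fix c assume c: "lo (GuardC j) \<le> c" "lo (LitC j' i') \<le> c" "c \<le> hi (GuardC j)" "c \<le> hi (LitC j' i')"
  note facts = const_facts w base clause_facts[OF assms(1)] clause_facts[OF assms(2)] lit_facts(1,2,4,7,8)[OF assms(2,3)] block_facts[OF var[OF assms(2,3)]]
  have c': "c \<le> N + B j' + 2 * v + 2" "i' \<le> v \<Longrightarrow> c \<le> N + B j' + i'" using c(4) assms(3) by (auto split: if_splits)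
  consider "j < j'" | "j = j'" "i' \<le> v" | "j = j'" "i' = v + 1" | "j' < j" using assms const_facts by linarith
  then show "if c \<le> Y + 3 then ht (GuardC j) c < ht (LitC j' i') c else ht (LitC j' i') c < ht (GuardC j) c"
  proof cases
    case 1
    show ?thesis unfolding ht.simps using c(1,2,3)[unfolded lo.simps hi.simps] c'(1) assms facts clause_order[OF 1]
      by (auto split: if_splits)
  next
    case 2
    show ?thesis unfolding ht.simps using c(1,2,3)[unfolded lo.simps hi.simps] c'(1) assms facts 2 c'(2)[OF 2(2)]
      by (auto split: if_splits)
  next
    case 3
    show ?thesis unfolding ht.simps using c(1,2,3)[unfolded lo.simps hi.simps] c'(1) assms facts 3
      by (auto split: if_splits)
  next
    case 4
    show ?thesis unfolding ht.simps using c(1,2,3)[unfolded lo.simps hi.simps] c'(1) assms facts clause_order[OF 4]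
      by (auto split: if_splits)
  qed
qed (use assms in auto)

text \<open>The final drop of the guard crosses link 0 of its own clause; the other links it
  overlaps are lower.\<close>

lemma ok_Guard_Link:
  assumes "j < J" "j' < J" "i' \<le> v"
  shows "pair_ok (curve (LinkC j' i')) (curve (GuardC j))"
proof -
  have base: "base (row j) + 8 * row j = 8 * occ" using clause_facts[OF assms(1)] by (intro base_eq) simp
  note facts = base clause_facts[OF assms(1)] clause_facts[OF assms(2)] link_facts[OF assms(2,3)]
  consider "j < j'" | "j' = j" "i' = 0" | "j' = j" "i' > 0" | "j' < j" by linarith
  then show ?thesis
  proof cases
    case 1
    show ?thesis by (rule pair_ok_commute, rule disjoint) (use assms const_facts w facts clause_order[OF 1] in auto)
  next
    case 2
    show ?thesis
    proof (rule planar[where m = "N + B j + v"])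
      fix c assume "lo (LinkC j' i') \<le> c" "lo (GuardC j) \<le> c" "c \<le> hi (LinkC j' i')" "c \<le> hi (GuardC j)"
      then show "if c \<le> N + B j + v then ht (LinkC j' i') c < ht (GuardC j) c else ht (GuardC j) c < ht (LinkC j' i') c"
        unfolding lo.simps hi.simps ht.simps using assms const_facts w facts 2
        by (auto split: if_splits)
    qed (use assms const_facts  in auto)
  next
    case 3
    show ?thesis
    proof (rule below)
      fix c assume "lo (LinkC j' i') \<le> c" "lo (GuardC j) \<le> c" "c \<le> hi (LinkC j' i')" "c \<le> hi (GuardC j)"
      then show "ht (LinkC j' i') c < ht (GuardC j) c"
        unfolding lo.simps hi.simps ht.simps using assms const_facts w facts 3(2)
        by (auto split: if_splits)
    qed (use assms const_facts  in auto)
  next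
    case 4
    show ?thesis
    proof (rule below)
      fix c assume "lo (LinkC j' i') \<le> c" "lo (GuardC j) \<le> c" "c \<le> hi (LinkC j' i')" "c \<le> hi (GuardC j)"
      then show "ht (LinkC j' i') c < ht (GuardC j) c"
        unfolding lo.simps hi.simps ht.simps using assms const_facts w facts clause_order[OF 4]
        by (auto split: if_splits)
    qed (use assms const_facts  in auto)
  qed
qed

lemma ok_Guard_Bar:
  assumes "j < J" "x < Vn"
  shows "pair_ok (curve (BarC x)) (curve (GuardC j))"
proof (rule below)
  fix c assume "lo (BarC x) \<le> c" "lo (GuardC j) \<le> c" "c \<le> hi (BarC x)" "c \<le> hi (GuardC j)"
  then show "ht (BarC x) c < ht (GuardC j) c"
    unfolding lo.simps hi.simps ht.simps using assms const_facts w assms clause_facts[OF assms(1)] block_facts[OF assms(2)]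
    by (auto split: if_splits)
qed (use assms const_facts  in auto)

lemma ok_Guard_Var:
  assumes "j < J" "x < Vn"
  shows "pair_ok (curve (VarC x)) (curve (GuardC j))"
  by (rule disjoint) (use assms const_facts w block_facts[OF assms(2)] in auto)

text \<open>Up to column \<open>N - 1\<close> the earlier start is the higher one, from
  \<open>N\<close> on the smaller number. If the two orders disagree, the pair crosses once in
  between.\<close>

lemma ok_Lit_Lit:
  assumes "j < J" "i < w" "j' < J" "i' < w" "row j + i < row j' + i'"
  shows "pair_ok (curve (LitC j i)) (curve (LitC j' i'))"
proof -
  have qq: "q j i \<noteq> q j' i'" using q_inj[OF assms(1-4)] assms(5) by auto
  note facts = assms(5) qq lit_facts(1,2,4,7,8)[OF assms(1,2)] block_facts[OF var[OF assms(1,2)]] lit_facts(1,2,4,7,8)[OF assms(3,4)] block_facts[OF var[OF assms(3,4)]]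
  show ?thesis
  proof (cases "q j i < q j' i'")
    case True
    have "pair_ok (curve (LitC j' i')) (curve (LitC j i))"
    proof (rule below)
      fix c assume "lo (LitC j' i') \<le> c" "lo (LitC j i) \<le> c" "c \<le> hi (LitC j' i')" "c \<le> hi (LitC j i)"
      then show "ht (LitC j' i') c < ht (LitC j i) c"
        unfolding lo.simps ht.simps using assms const_facts w facts True
        by (auto split: if_splits)
    qed (use assms const_facts  in auto)
    then show ?thesis by (rule pair_ok_commute)
  next
    case False
    then have "q j' i' < q j i" using qq by simp
    show ?thesis
    proof (rule planar[where m = "Y + 3"])
      fix c assume "lo (LitC j i) \<le> c" "lo (LitC j' i') \<le> c" "c \<le> hi (LitC j i)" "c \<le> hi (LitC j' i')"
      then show "if c \<le> Y + 3 then ht (LitC j i) c < ht (LitC j' i') c else ht (LitC j' i') c < ht (LitC j i) c"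
        unfolding lo.simps ht.simps using assms const_facts w facts \<open>q j' i' < q j i\<close>
        by (auto split: if_splits)
    qed (use assms const_facts  in auto)
  qed
qed

text \<open>A literal \<open>i \<le> v\<close> ends right above the beginning of link
  \<open>i\<close>, and links of its clause with smaller index are higher. The last literal
  continues to the end of link \<open>v\<close>, which crosses it in its last strip.\<close>

lemma ok_Lit_Link:
  assumes "j < J" "i < w" "j' < J" "i' \<le> v"
  shows "pair_ok (curve (LitC j i)) (curve (LinkC j' i'))"
proof -
  note facts = clause_facts[OF assms(1)] clause_facts[OF assms(3)] lit_facts(7,8)[OF assms(1,2)] link_facts[OF assms(3,4)]
  have hi: "hi (LitC j i) \<le> N + B j + 2 * v + 2" "i \<le> v \<Longrightarrow> hi (LitC j i) = N + B j + i" using assms(2) by auto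
  have v: "i \<le> v \<or> i = v + 1" "i' < v \<or> i' = v" using assms const_facts by linarith+
  consider "j < j'" | "j' < j" | "j = j'" "i < i'" | "j = j'" "i = i'" | "j = j'" "i' < i" "i \<le> v"
    | "j = j'" "i = v + 1" "i' < v" | "j = j'" "i = v + 1" "i' = v" using v by (cases j j' rule: linorder_cases; cases i i' rule: linorder_cases) auto
  then show ?thesis
  proof cases
    case 1
    show ?thesis by (rule disjoint) (use assms const_facts w facts hi clause_order[OF 1] in auto)
  next
    case 2
    show ?thesis
    proof (rule below)
      fix c assume c: "lo (LitC j i) \<le> c" "lo (LinkC j' i') \<le> c" "c \<le> hi (LitC j i)" "c \<le> hi (LinkC j' i')"
      then have Nc: "N \<le> c" by simp
      show "ht (LitC j i) c < ht (LinkC j' i') c"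
        unfolding lit_start[OF assms(1,2) Nc] ht.simps(5) using c[unfolded lo.simps hi.simps(5)] assms const_facts w facts clause_order[OF 2]
        by (auto split: if_splits)
    qed (use assms const_facts  in auto)
  next
    case 3
    show ?thesis by (rule disjoint) (use assms const_facts w facts 3 hi in auto)
  next
    case 4
    have "pair_ok (curve (LinkC j' i')) (curve (LitC j i))"
    proof (rule below)
      fix c assume c: "lo (LinkC j' i') \<le> c" "lo (LitC j i) \<le> c" "c \<le> hi (LinkC j' i')" "c \<le> hi (LitC j i)"
      then have Nc: "N \<le> c" by simp
      show "ht (LinkC j' i') c < ht (LitC j i) c"
        unfolding lit_start[OF assms(1,2) Nc] ht.simps(5) using c[unfolded lo.simps hi.simps(5)] assms const_facts w facts 4 hi(2)
        by (auto split: if_splits)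
    qed (use assms const_facts  in auto)
    then show ?thesis by (rule pair_ok_commute)
  next
    case 5
    show ?thesis
    proof (rule below)
      fix c assume c: "lo (LitC j i) \<le> c" "lo (LinkC j' i') \<le> c" "c \<le> hi (LitC j i)" "c \<le> hi (LinkC j' i')"
      then have Nc: "N \<le> c" by simp
      show "ht (LitC j i) c < ht (LinkC j' i') c"
        unfolding lit_start[OF assms(1,2) Nc] ht.simps(5) using c[unfolded lo.simps hi.simps(5)] assms const_facts w facts 5 hi(2)[OF 5(3)]
        by (auto split: if_splits)
    qed (use assms const_facts  in auto)
  next
    case 6
    show ?thesis
    proof (rule below)
      fix c assume c: "lo (LitC j i) \<le> c" "lo (LinkC j' i') \<le> c" "c \<le> hi (LitC j i)" "c \<le> hi (LinkC j' i')"
      then have Nc: "N \<le> c" by simp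
      show "ht (LitC j i) c < ht (LinkC j' i') c"
        unfolding lit_start[OF assms(1,2) Nc] ht.simps(5) using c[unfolded lo.simps hi.simps(5)] assms const_facts w facts 6 hi(1)
        by (auto split: if_splits)
    qed (use assms const_facts  in auto)
  next
    case 7
    show ?thesis
    proof (rule planar[where m = "N + B j + 2 * v + 1"])
      fix c assume c: "lo (LitC j i) \<le> c" "lo (LinkC j' i') \<le> c" "c \<le> hi (LitC j i)" "c \<le> hi (LinkC j' i')"
      then have Nc: "N \<le> c" by simp
      show "if c \<le> N + B j + 2 * v + 1 then ht (LitC j i) c < ht (LinkC j' i') c else ht (LinkC j' i') c < ht (LitC j i) c"
        unfolding lit_start[OF assms(1,2) Nc] ht.simps(5) using c[unfolded lo.simps hi.simps(5)] assms const_facts w facts 7 hi(1)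
        by (auto split: if_splits)
    qed (use assms const_facts  in auto)
  qed
qed

text \<open>No literal starts in the middle column of a gadget. The bar passes below the literals up
  to column \<open>N - 1\<close> and rises above all of them to \<open>a\<close>.\<close>

lemma ok_Lit_Bar:
  assumes "j < J" "i < w" "x < Vn"
  shows "pair_ok (curve (BarC x)) (curve (LitC j i))"
proof (rule planar[where m = "Y + 3"])
  have qx: "q j i < G x + occ \<or> G x + occ < q j i" using q_block[OF assms] lit_facts(3)[OF assms(1,2)] by auto
  fix c assume "lo (BarC x) \<le> c" "lo (LitC j i) \<le> c" "c \<le> hi (BarC x)" "c \<le> hi (LitC j i)"
  from qx this show "if c \<le> Y + 3 then ht (BarC x) c < ht (LitC j i) c else ht (LitC j i) c < ht (BarC x) c"
    unfolding lo.simps hi.simps(6) ht.simps using assms const_facts w lit_facts(1,2,4,7,8)[OF assms(1,2)] block_facts[OF var[OF assms(1,2)]] block_facts[OF assms(3)]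
    by (auto split: if_splits)
qed (use assms in auto)

text \<open>A literal starts two units below the curve along its own gadget and crosses it right
  away on the way up to its level.\<close>

lemma ok_Lit_Var:
  assumes "j < J" "i < w" "x < Vn"
  shows "pair_ok (curve (LitC j i)) (curve (VarC x))"
proof (rule planar[where m = "q j i"])
  fix c assume c: "lo (LitC j i) \<le> c" "lo (VarC x) \<le> c" "c \<le> hi (LitC j i)" "c \<le> hi (VarC x)"
  note facts = const_facts w lit_facts(1,2,4,7,8)[OF assms(1,2)] block_facts[OF var[OF assms(1,2)]] block_facts[OF assms(3)]
  have eb: "eb (var j i) = eb x" if "G x \<le> q j i" "q j i \<le> G x + 2 * occ" using q_block[OF assms] that by auto
  have "q j i < G x \<or> G x \<le> q j i" by linarith
  then show "if c \<le> q j i then ht (LitC j i) c < ht (VarC x) c else ht (VarC x) c < ht (LitC j i) c"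
  proof
    assume "q j i < G x"
    then show ?thesis unfolding ht.simps using c(1,2,4)[unfolded lo.simps hi.simps] facts
      by (auto split: if_splits)
  next
    assume g: "G x \<le> q j i"
    show ?thesis
    proof (cases "q j i \<le> G x + 2 * occ")
      case True
      show ?thesis unfolding ht.simps using c(1,2,4)[unfolded lo.simps hi.simps] facts eb[OF g True] g
        by (auto split: if_splits)
    next
      case False
      then show ?thesis using c by simp
    qed
  qed
qed (use assms in auto)

text \<open>A link crosses its successor in its own last strip, where it descends from offset 4 over
  its level to offset 2 over the next level.\<close>

lemma ok_Link_Link:
  assumes "j < J" "i \<le> v" "j' < J" "i' \<le> v" "row j + i < row j' + i'"
  shows "pair_ok (curve (LinkC j' i')) (curve (LinkC j i))"
proof -
  note facts = clause_facts[OF assms(1)] clause_facts[OF assms(3)] link_facts[OF assms(1,2)] link_facts[OF assms(3,4)]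
  have "j < j' \<or> j = j' \<and> (i' = i + 1 \<or> i + 1 < i')"
    using assms(5) facts clause_order[of j' j] by (cases j j' rule: linorder_cases) auto
  then consider "j < j'" | "j = j'" "i' = i + 1" | "j = j'" "i + 1 < i'" by blast
  then show ?thesis
  proof cases
    case 1
    show ?thesis by (rule pair_ok_commute, rule disjoint) (use assms const_facts w facts clause_order[OF 1] in auto)
  next
    case 2
    show ?thesis
    proof (rule planar[where m = "N + B j + v + 1 + i"])
      fix c assume "lo (LinkC j' i') \<le> c" "lo (LinkC j i) \<le> c" "c \<le> hi (LinkC j' i')" "c \<le> hi (LinkC j i)"
      then show "if c \<le> N + B j + v + 1 + i then ht (LinkC j' i') c < ht (LinkC j i) c else ht (LinkC j i) c < ht (LinkC j' i') c"
        unfolding lo.simps hi.simps ht.simps using const_facts(9) clause_facts(1)[OF assms(1)] link_facts(1,2)[OF assms(1,2)] 2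
        by (auto split: if_splits)
    qed (use assms const_facts  in auto)
  next
    case 3
    show ?thesis
    proof (rule below)
      fix c assume "lo (LinkC j' i') \<le> c" "lo (LinkC j i) \<le> c" "c \<le> hi (LinkC j' i')" "c \<le> hi (LinkC j i)"
      then show "ht (LinkC j' i') c < ht (LinkC j i) c"
        unfolding lo.simps hi.simps ht.simps using const_facts(9) clause_facts(1)[OF assms(1)] link_facts(1,2)[OF assms(1,2)] link_facts(1)[OF assms(3,4)] 3
        by (auto split: if_splits)
    qed (use assms const_facts  in auto)
  qed
qed

lemma ok_Link_Bar:
  assumes "j < J" "i \<le> v" "x < Vn"
  shows "pair_ok (curve (BarC x)) (curve (LinkC j i))"
  by (rule disjoint) (use assms const_facts w clause_facts[OF assms(1)] in auto)

lemma ok_Link_Var: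
  assumes "j < J" "i \<le> v" "x < Vn"
  shows "pair_ok (curve (VarC x)) (curve (LinkC j i))"
  by (rule disjoint) (use assms const_facts w clause_facts[OF assms(1)] block_facts[OF assms(3)] in auto)

lemma ok_Bar_Bar:
  assumes "x < x'" "x' < Vn"
  shows "pair_ok (curve (BarC x)) (curve (BarC x'))"
proof (rule common_end)
  fix c assume "lo (BarC x) \<le> c" "lo (BarC x') \<le> c" "c < N"
  then show "ht (BarC x) c < ht (BarC x') c"
    unfolding lo.simps hi.simps ht.simps using assms const_facts w assms block_facts[OF order.strict_trans[OF assms]] block_facts[OF assms(2)] G_order[OF assms(1)]
    by (auto split: if_splits)
qed (use assms const_facts assms block_facts[OF order.strict_trans[OF assms]] block_facts[OF assms(2)] G_order[OF assms(1)] in auto)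

text \<open>The bar starts above the curve of its own gadget and drops through it at once; other
  gadgets are passed below.\<close>

lemma ok_Bar_Var:
  assumes "x < Vn" "x' < Vn"
  shows "pair_ok (curve (VarC x')) (curve (BarC x))"
proof (rule planar[where m = "G x + occ"])
  fix c assume c: "lo (VarC x') \<le> c" "lo (BarC x) \<le> c" "c \<le> hi (VarC x')" "c \<le> hi (BarC x)"
  note facts = assms const_facts w block_facts[OF assms(1)] block_facts[OF assms(2)]
  consider "x < x'" | "x = x'" | "x' < x" by linarith
  then show "if c \<le> G x + occ then ht (VarC x') c < ht (BarC x) c else ht (BarC x) c < ht (VarC x') c"
  proof cases
    case 1
    show ?thesis unfolding ht.simps using c[unfolded lo.simps hi.simps] facts G_order[OF 1]
      by (auto split: if_splits)
  next
    case 2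
    show ?thesis unfolding ht.simps using c[unfolded lo.simps hi.simps] facts 2 arg_cong[OF 2, of G] arg_cong[OF 2, of eb]
      by (auto split: if_splits)
  next
    case 3
    show ?thesis unfolding ht.simps using c[unfolded lo.simps hi.simps] facts G_order[OF 3]
      by (auto split: if_splits)
  qed
qed (use assms in auto)

lemma ok_Var_Var:
  assumes "x < x'" "x' < Vn"
  shows "pair_ok (curve (VarC x)) (curve (VarC x'))"
  by (rule disjoint) (use assms const_facts w G_order[OF assms(1)] in auto)

section \<open>Pairs with the upper barrier\<close>

abbreviation "top_front c \<equiv> if c \<le> Y then Top else be"

text \<open>\<open>TopC\<close> goes almost once around. It faces another curve unshifted from
  column \<open>Y + 3\<close> on, at constant height \<open>Top\<close>, and shifted by
  \<open>N\<close> up to column \<open>Y + 2\<close>, where \<open>top_front\<close> drops to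
  \<open>be\<close>. The flag \<open>p\<close> selects the direction of a change of sides in the
  shifted part.\<close>

lemma shifted_by_Top:
  assumes b: "valid b" "b \<noteq> TopC"
    and R0: "\<And>c. Y + 3 \<le> c \<Longrightarrow> lo b \<le> c \<Longrightarrow> c \<le> hi b \<Longrightarrow> if c \<le> m then Top < ht b c else ht b c < Top"
    and R1: "\<And>c. lo b \<le> c \<Longrightarrow> c \<le> Y + 2 \<Longrightarrow> c \<le> hi b \<Longrightarrow>
        if (c \<le> m') = p then ht b c < top_front c else top_front c < ht b c"
    and const: "(\<forall>c. Y + 3 \<le> c \<longrightarrow> lo b \<le> c \<longrightarrow> c \<le> hi b \<longrightarrow> ht b c < Top) \<or>
      (\<forall>c. lo b \<le> c \<longrightarrow> c \<le> Y + 2 \<longrightarrow> c \<le> hi b \<longrightarrow> ht b c < top_front c)"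
  shows "pair_ok (curve TopC) (curve b)"
proof -
  note rb = range_facts[OF b(1)] range_facts(4)[OF b] range_facts[of TopC]
  have e: "lo TopC - N = 0" "hi TopC - N = Y + 2" using const_facts by auto
  have top: "ht TopC c = Top" if "c \<le> hi b" for c using that rb const_facts by simp
  have front: "ht TopC (c + N) = top_front c" for c by simp
  show ?thesis unfolding curve_def
  proof (rule pair_ok_shifted[where m = m and m' = m'])
    show "flips (ht TopC) (ht b) {max (lo TopC) (lo b)..min (hi TopC) (hi b)} m \<or>
      flips (ht b) (ht TopC) {max (lo TopC) (lo b)..min (hi TopC) (hi b)} m"
      using R0 top by (auto simp: flips_def simp del: ht.simps)
    show "flips (\<lambda>c. ht TopC (c + N)) (ht b) {max (lo TopC - N) (lo b)..min (hi TopC - N) (hi b)} m' \<or>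
      flips (ht b) (\<lambda>c. ht TopC (c + N)) {max (lo TopC - N) (lo b)..min (hi TopC - N) (hi b)} m'"
      unfolding e front using R1 by (cases p) (auto simp: flips_def simp del: ht.simps)
    show "(\<forall>c\<in>{max (lo TopC) (lo b)..min (hi TopC) (hi b)}. ht b c < ht TopC c) \<or>
      (\<forall>c\<in>{max (lo TopC - N) (lo b)..min (hi TopC - N) (hi b)}. ht b c < ht TopC (c + N)) \<or>
      (\<forall>c\<in>{max (lo TopC) (lo b)..min (hi TopC) (hi b)}. ht TopC c < ht b c) \<or>
      (\<forall>c\<in>{max (lo TopC - N) (lo b)..min (hi TopC - N) (hi b)}. ht TopC (c + N) < ht b c)"
    proof (rule disjE[OF const])
      assume "\<forall>c. Y + 3 \<le> c \<longrightarrow> lo b \<le> c \<longrightarrow> c \<le> hi b \<longrightarrow> ht b c < Top"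
      then have "\<forall>c\<in>{max (lo TopC) (lo b)..min (hi TopC) (hi b)}. ht b c < ht TopC c"
        using top by (simp del: ht.simps)
      then show ?thesis unfolding e front by (rule disjI1)
    next
      assume "\<forall>c. lo b \<le> c \<longrightarrow> c \<le> Y + 2 \<longrightarrow> c \<le> hi b \<longrightarrow> ht b c < top_front c"
      then have "\<forall>c\<in>{max 0 (lo b)..min (Y + 2) (hi b)}. ht b c < top_front c" by simp
      then show ?thesis unfolding e front by (intro disjI2 disjI1)
    qed
  qed (use rb const_facts in auto)
qed

text \<open>The block exceeds \<open>Top\<close> only at column \<open>Y + 3\<close>, and at
  \<open>Y + 2\<close> it is below \<open>be\<close>; so the unshifted part contains the only
  meeting.\<close>

lemma ok_Top_Block: "pair_ok (curve TopC) (curve BlockC)"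
proof (rule shifted_by_Top[where m = "Y + 3" and m' = "Y + 2" and p = True])
qed (use const_facts in auto)

lemma ok_Top_Guard:
  assumes "j < J"
  shows "pair_ok (curve TopC) (curve (GuardC j))"
proof (rule shifted_by_Top[where m = 0 and m' = "Y + 1" and p = False])
  note facts = const_facts w assms clause_facts[OF assms] base_eq[OF order.trans[OF le_add1 clause_facts(2)[OF assms]]]
  have R0: "ht (GuardC j) c < Top" if "Y + 3 \<le> c" "lo (GuardC j) \<le> c" "c \<le> hi (GuardC j)" for c
    using that unfolding lo.simps hi.simps ht.simps using assms facts by (auto split: if_splits)
  then show "(\<forall>c. Y + 3 \<le> c \<longrightarrow> lo (GuardC j) \<le> c \<longrightarrow> c \<le> hi (GuardC j) \<longrightarrow> ht (GuardC j) c < Top) \<or>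
    (\<forall>c. lo (GuardC j) \<le> c \<longrightarrow> c \<le> Y + 2 \<longrightarrow> c \<le> hi (GuardC j) \<longrightarrow> ht (GuardC j) c < top_front c)" by blast
  show "if c \<le> 0 then Top < ht (GuardC j) c else ht (GuardC j) c < Top" if "Y + 3 \<le> c" "lo (GuardC j) \<le> c" "c \<le> hi (GuardC j)" for c
    using R0[OF that] that(1) by simp
  show "if (c \<le> Y + 1) = False then ht (GuardC j) c < top_front c else top_front c < ht (GuardC j) c"
    if "lo (GuardC j) \<le> c" "c \<le> Y + 2" "c \<le> hi (GuardC j)" for c
    using that unfolding lo.simps hi.simps ht.simps simp_thms using assms facts by (auto split: if_splits)
qed (use assms in auto)

text \<open>The final descent of \<open>TopC\<close> between columns \<open>Y\<close> and
  \<open>Y + 1\<close> cuts through all literals, whose levels exceed \<open>be\<close>.\<close>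

lemma ok_Top_Lit:
  assumes "j < J" "i < w"
  shows "pair_ok (curve TopC) (curve (LitC j i))"
proof (rule shifted_by_Top[where m = 0 and m' = "Y" and p = True])
  note facts = const_facts w lit_facts(1,2,4,7,8)[OF assms] block_facts[OF var[OF assms]]
  have R0: "ht (LitC j i) c < Top" if "Y + 3 \<le> c" "lo (LitC j i) \<le> c" "c \<le> hi (LitC j i)" for c
    using that unfolding lo.simps hi.simps(1) ht.simps using assms facts by (auto split: if_splits)
  then show "(\<forall>c. Y + 3 \<le> c \<longrightarrow> lo (LitC j i) \<le> c \<longrightarrow> c \<le> hi (LitC j i) \<longrightarrow> ht (LitC j i) c < Top) \<or>
    (\<forall>c. lo (LitC j i) \<le> c \<longrightarrow> c \<le> Y + 2 \<longrightarrow> c \<le> hi (LitC j i) \<longrightarrow> ht (LitC j i) c < top_front c)" by blast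
  show "if c \<le> 0 then Top < ht (LitC j i) c else ht (LitC j i) c < Top" if "Y + 3 \<le> c" "lo (LitC j i) \<le> c" "c \<le> hi (LitC j i)" for c
    using R0[OF that] that(1) by simp
  show "if (c \<le> Y) = True then ht (LitC j i) c < top_front c else top_front c < ht (LitC j i) c"
    if "lo (LitC j i) \<le> c" "c \<le> Y + 2" "c \<le> hi (LitC j i)" for c
    using that unfolding lo.simps hi.simps(1) ht.simps simp_thms using assms facts by (auto split: if_splits)
qed (use assms in auto)

lemma ok_Top_Link:
  assumes "j < J" "i \<le> v"
  shows "pair_ok (curve TopC) (curve (LinkC j i))"
proof (rule shifted_by_Top[where m = 0 and m' = "2 * N" and p = True])
  note facts = const_facts w clause_facts[OF assms(1)] link_facts[OF assms]
  have R0: "ht (LinkC j i) c < Top" if "Y + 3 \<le> c" "lo (LinkC j i) \<le> c" "c \<le> hi (LinkC j i)" for c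
    using that unfolding lo.simps hi.simps ht.simps using assms facts by (auto split: if_splits)
  then show "(\<forall>c. Y + 3 \<le> c \<longrightarrow> lo (LinkC j i) \<le> c \<longrightarrow> c \<le> hi (LinkC j i) \<longrightarrow> ht (LinkC j i) c < Top) \<or>
    (\<forall>c. lo (LinkC j i) \<le> c \<longrightarrow> c \<le> Y + 2 \<longrightarrow> c \<le> hi (LinkC j i) \<longrightarrow> ht (LinkC j i) c < top_front c)" by blast
  show "if c \<le> 0 then Top < ht (LinkC j i) c else ht (LinkC j i) c < Top" if "Y + 3 \<le> c" "lo (LinkC j i) \<le> c" "c \<le> hi (LinkC j i)" for c
    using R0[OF that] that(1) by simp
  show "if (c \<le> 2 * N) = True then ht (LinkC j i) c < top_front c else top_front c < ht (LinkC j i) c"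
    if "lo (LinkC j i) \<le> c" "c \<le> Y + 2" "c \<le> hi (LinkC j i)" for c
    using that unfolding lo.simps hi.simps ht.simps simp_thms using assms facts by (auto split: if_splits)
qed (use assms in auto)

lemma ok_Top_Bar:
  assumes "x < Vn"
  shows "pair_ok (curve TopC) (curve (BarC x))"
proof (rule shifted_by_Top[where m = 0 and m' = "2 * N" and p = True])
  note facts = const_facts w assms block_facts[OF assms]
  have R0: "ht (BarC x) c < Top" if "Y + 3 \<le> c" "lo (BarC x) \<le> c" "c \<le> hi (BarC x)" for c
    using that unfolding lo.simps hi.simps ht.simps using assms facts by (auto split: if_splits)
  then show "(\<forall>c. Y + 3 \<le> c \<longrightarrow> lo (BarC x) \<le> c \<longrightarrow> c \<le> hi (BarC x) \<longrightarrow> ht (BarC x) c < Top) \<or>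
    (\<forall>c. lo (BarC x) \<le> c \<longrightarrow> c \<le> Y + 2 \<longrightarrow> c \<le> hi (BarC x) \<longrightarrow> ht (BarC x) c < top_front c)" by blast
  show "if c \<le> 0 then Top < ht (BarC x) c else ht (BarC x) c < Top" if "Y + 3 \<le> c" "lo (BarC x) \<le> c" "c \<le> hi (BarC x)" for c
    using R0[OF that] that(1) by simp
  show "if (c \<le> 2 * N) = True then ht (BarC x) c < top_front c else top_front c < ht (BarC x) c"
    if "lo (BarC x) \<le> c" "c \<le> Y + 2" "c \<le> hi (BarC x)" for c
    using that unfolding lo.simps hi.simps ht.simps simp_thms using assms facts by (auto split: if_splits)
qed (use assms in auto)

lemma ok_Top_Var:
  assumes "x < Vn"
  shows "pair_ok (curve TopC) (curve (VarC x))"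
proof (rule shifted_by_Top[where m = 0 and m' = "2 * N" and p = True])
  note facts = const_facts w block_facts[OF assms]
  have R0: "ht (VarC x) c < Top" if "Y + 3 \<le> c" "lo (VarC x) \<le> c" "c \<le> hi (VarC x)" for c
    using that unfolding lo.simps hi.simps ht.simps using assms facts by (auto split: if_splits)
  then show "(\<forall>c. Y + 3 \<le> c \<longrightarrow> lo (VarC x) \<le> c \<longrightarrow> c \<le> hi (VarC x) \<longrightarrow> ht (VarC x) c < Top) \<or>
    (\<forall>c. lo (VarC x) \<le> c \<longrightarrow> c \<le> Y + 2 \<longrightarrow> c \<le> hi (VarC x) \<longrightarrow> ht (VarC x) c < top_front c)" by blast
  show "if c \<le> 0 then Top < ht (VarC x) c else ht (VarC x) c < Top" if "Y + 3 \<le> c" "lo (VarC x) \<le> c" "c \<le> hi (VarC x)" for c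
    using R0[OF that] that(1) by simp
  show "if (c \<le> 2 * N) = True then ht (VarC x) c < top_front c else top_front c < ht (VarC x) c"
    if "lo (VarC x) \<le> c" "c \<le> Y + 2" "c \<le> hi (VarC x)" for c
    using that unfolding lo.simps hi.simps ht.simps simp_thms using assms facts by (auto split: if_splits)
qed (use assms in auto)

lemma pair_ok_curves:
  assumes "valid a" "valid b" "a \<noteq> b"
  shows "pair_ok (curve a) (curve b)"
proof -
  have lit: "pair_ok (curve (LitC j i)) (curve (LitC j' i'))"
    if ji: "j < J" "i < w" "j' < J" "i' < w" "j \<noteq> j' \<or> i \<noteq> i'" for j i j' i'
  proof -
    have "row j + i \<noteq> row j' + i'" using number_inj[OF ji(2,4)] ji(5) by blast
    then consider "row j + i < row j' + i'" | "row j' + i' < row j + i" by linarith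
    then show ?thesis by cases (rule ok_Lit_Lit[OF ji(1-4)] ok_Lit_Lit[OF ji(3,4,1,2), THEN pair_ok_commute], assumption)+
  qed
  have link: "pair_ok (curve (LinkC j i)) (curve (LinkC j' i'))"
    if ji: "j < J" "i \<le> v" "j' < J" "i' \<le> v" "j \<noteq> j' \<or> i \<noteq> i'" for j i j' i'
  proof -
    have "i < w" "i' < w" using ji const_facts by auto
    then have "row j + i \<noteq> row j' + i'" using number_inj ji(5) by blast
    then consider "row j + i < row j' + i'" | "row j' + i' < row j + i" by linarith
    then show ?thesis by cases (rule ok_Link_Link[OF ji(1-4), THEN pair_ok_commute] ok_Link_Link[OF ji(3,4,1,2)], assumption)+
  qed
  have guard: "pair_ok (curve (GuardC j)) (curve (GuardC j'))" if "j < J" "j' < J" "j \<noteq> j'" for j j'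
  proof (cases j j' rule: linorder_cases)
    case less
    show ?thesis by (rule ok_Guard_Guard[OF less that(2)])
  next
    case greater
    show ?thesis by (rule pair_ok_commute[OF ok_Guard_Guard[OF greater that(1)]])
  qed (use that in simp)
  have bar: "pair_ok (curve (BarC j)) (curve (BarC j'))" if "j < Vn" "j' < Vn" "j \<noteq> j'" for j j'
  proof (cases j j' rule: linorder_cases)
    case less
    show ?thesis by (rule ok_Bar_Bar[OF less that(2)])
  next
    case greater
    show ?thesis by (rule pair_ok_commute[OF ok_Bar_Bar[OF greater that(1)]])
  qed (use that in simp)
  have vars: "pair_ok (curve (VarC j)) (curve (VarC j'))" if "j < Vn" "j' < Vn" "j \<noteq> j'" for j j'
  proof (cases j j' rule: linorder_cases)
    case less
    show ?thesis by (rule ok_Var_Var[OF less that(2)])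
  next
    case greater
    show ?thesis by (rule pair_ok_commute[OF ok_Var_Var[OF greater that(1)]])
  qed (use that in simp)
  note rules = lit link guard bar vars
    ok_Block_Guard ok_Block_Lit ok_Block_Bar ok_Block_Link ok_Block_Var ok_Guard_Lit ok_Guard_Link ok_Guard_Bar ok_Guard_Var
    ok_Lit_Link ok_Lit_Bar ok_Lit_Var ok_Link_Bar ok_Link_Var ok_Bar_Var
    ok_Top_Block ok_Top_Guard ok_Top_Lit ok_Top_Link ok_Top_Bar ok_Top_Var
  show ?thesis using assms by (cases a; cases b) (auto intro: rules rules[THEN pair_ok_commute])
qed

section \<open>The arrangement is a legitimate instance\<close>

definition arrangement :: "(complex \<times> real) set set" where
  "arrangement = curve ` {a. valid a}"

lemma finite_valid: "finite {a. valid a}"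
proof -
  have "{a. valid a} \<subseteq> {TopC, BlockC} \<union> GuardC ` {..<J} \<union> (\<lambda>(j, i). LitC j i) ` ({..<J} \<times> {..<w}) \<union>
     (\<lambda>(j, i). LinkC j i) ` ({..<J} \<times> {..v}) \<union> BarC ` {..<Vn} \<union> VarC ` {..<Vn}"
  proof
    fix a assume "a \<in> {a. valid a}"
    then show "a \<in> {TopC, BlockC} \<union> GuardC ` {..<J} \<union> (\<lambda>(j, i). LitC j i) ` ({..<J} \<times> {..<w}) \<union>
     (\<lambda>(j, i). LinkC j i) ` ({..<J} \<times> {..v}) \<union> BarC ` {..<Vn} \<union> VarC ` {..<Vn}"
      by (cases a) auto
  qed
  then show ?thesis by (rule finite_subset) auto
qed

text \<open>Serves the requirement that no curve contain both points: only the curves ending at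
  \<open>a\<close> remain to be compared with \<open>b\<close>.\<close>

lemma pt_a_mem:
  assumes "valid a" "wrap N (real 0, real Z) \<in> curve a"
  shows "a = BlockC \<or> (\<exists>x. a = BarC x)"
proof (rule ccontr)
  assume n: "\<not> (a = BlockC \<or> (\<exists>x. a = BarC x))"
  have N: "N > 0" by (simp add: N_def)
  have eq: "wrap N (real 0, real Z) = wrap N (real N, real Z)" using wrap_add_N[OF N, of 0] by simp
  have "lo a \<le> N \<and> N \<le> hi a \<and> Z = ht a N \<or> \<not> (lo a \<le> N \<and> N \<le> hi a)"
  proof (cases "lo a \<le> N \<and> N \<le> hi a")
    case True
    then show ?thesis using wrap_mem_pl_curve[OF N range_facts(2)[OF assms(1)], of N Z "ht a"] assms(2) unfolding eq curve_def by blast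
  qed simp
  moreover have "\<not> (lo a \<le> N \<and> N \<le> hi a)" if "Z \<noteq> ht a N"
    using calculation that by blast
  moreover have "lo a \<le> N \<and> N \<le> hi a \<Longrightarrow> Z \<noteq> ht a N"
  proof (cases a)
    case (LitC j i)
    then show "lo a \<le> N \<and> N \<le> hi a \<Longrightarrow> Z \<noteq> ht a N" using assms(1) const_facts lit_facts[of j i] block_facts[OF var[of j i]] by auto
  next
    case (GuardC j)
    then show "lo a \<le> N \<and> N \<le> hi a \<Longrightarrow> Z \<noteq> ht a N" using assms(1) const_facts w clause_facts[of j] by auto
  next
    case (LinkC j i)
    then show "lo a \<le> N \<and> N \<le> hi a \<Longrightarrow> Z \<noteq> ht a N" using assms(1) const_facts w clause_facts[of j] by auto
  next
    case (VarC x)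
    then show "lo a \<le> N \<and> N \<le> hi a \<Longrightarrow> Z \<noteq> ht a N" using assms(1) const_facts block_facts[of x] by auto
  qed (use n const_facts in auto)
  ultimately have out: "\<not> (lo a \<le> N \<and> N \<le> hi a)" by blast
  obtain s where s: "s \<in> {real (lo a)..real (hi a)}" "wrap N (real N, real Z) = wrap N (s, pl (ht a) s)"
    using assms(2) unfolding eq curve_def pl_curve_def graph_curve_def by blast
  then obtain k :: int where k: "real N = s + k * real N" using wrap_eq_iff[OF N] by blast
  have "lo a > 0" using range_facts(3)[OF assms(1)] const_facts by linarith
  moreover have "hi a < 2 * N" using range_facts[OF assms(1)] const_facts by (cases "a = TopC") auto
  ultimately have "real (hi a) < 2 * real N" "real (lo a) > 0" by linarith+
  then have "\<bar>of_int k * real N\<bar> < real N" using s(1) k by auto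
  then have "k = 0" by (rule of_int_mult_small)
  then show False using k s(1) out by auto
qed

lemma pt_b_not_mem:
  assumes "valid a" "a = BlockC \<or> a = BarC x"
  shows "wrap N (real (Y + 2), real be) \<notin> curve a"
proof -
  have N: "N > 0" by (simp add: N_def)
  have "lo a \<le> Y + 2" "Y + 2 \<le> hi a" "be \<noteq> ht a (Y + 2)"
    using assms const_facts block_facts[of x] by auto
  then show ?thesis using wrap_mem_pl_curve[OF N range_facts(2)[OF assms(1)], of "Y + 2" be "ht a"] unfolding curve_def by blast
qed

lemma extension_instance_arrangement: "extension_instance arrangement pt_a pt_b"
proof -
  have N: "N > 0" by (simp add: N_def)
  have "pseudosegment_arrangement cylinder arrangement"
    unfolding pseudosegment_arrangement_def
  proof (intro conjI ballI impI)
    show "finite arrangement" unfolding arrangement_def using finite_valid by simp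
  next
    fix C assume "C \<in> arrangement"
    then obtain a where a: "valid a" "C = curve a" unfolding arrangement_def by blast
    show "C \<subseteq> cylinder" "simple_curve C"
      unfolding a(2) curve_def by (rule pl_curve_facts[OF range_facts(1,2)[OF a(1)]])+
    fix D assume "D \<in> arrangement" "C \<noteq> D"
    then obtain b where b: "valid b" "D = curve b" "a \<noteq> b" using a unfolding arrangement_def by blast
    note ok = pair_ok_curves[OF a(1) b(1,3), folded a(2) b(2), unfolded pair_ok_def]
    show "meet_at_most_once C D" using ok by blast
    show "proper_crossing cylinder C D p \<or> curve_endpoint C p \<and> curve_endpoint D p" if "p \<in> C \<inter> D" for p
      using ok that by blast
  qed
  moreover have "cylindrically_monotone C" if "C \<in> arrangement" for C
    using that pl_curve_facts(3)[OF range_facts(1,2)] unfolding arrangement_def curve_def by blast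
  moreover have "\<not> (\<exists>u. pt_a \<in> vertical_line u \<and> pt_b \<in> vertical_line u)"
  proof
    assume "\<exists>u. pt_a \<in> vertical_line u \<and> pt_b \<in> vertical_line u"
    then have "fst pt_a = fst pt_b" by (auto simp: vertical_line_def)
    then have "wrap N (real 0, 0) = wrap N (real (Y + 2), 0)" by (simp add: wrap_def)
    then obtain k :: int where k: "real 0 = real (Y + 2) + k * real N" using wrap_eq_iff[OF N] by blast
    then have "\<bar>of_int k * real N\<bar> < real N" using const_facts by auto
    then have "k = 0" by (rule of_int_mult_small)
    then show False using k by simp
  qed
  moreover have "\<not> (\<exists>C\<in>arrangement. pt_a \<in> C \<and> pt_b \<in> C)"
    using pt_a_mem pt_b_not_mem unfolding arrangement_def by blast
  ultimately show ?thesis unfolding extension_instance_def using wrap_in_cylinder by blast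
qed

end

context cnf_arrangement
begin

subsection \<open>A connecting curve yields a satisfying assignment\<close>

context
  fixes D :: "(complex \<times> real) set" and d :: "real \<Rightarrow> real"
  assumes once: "\<And>a. valid a \<Longrightarrow> meet_at_most_once (curve a) D"
    and cont: "continuous_on {0..real (Y + 2)} d" and d_a: "d 0 = real Z" and d_b: "d (real (Y + 2)) = real be"
    and mem: "\<And>s. s \<in> {0..real (Y + 2)} \<Longrightarrow> wrap N (s, d s) \<in> D"
begin

definition hit :: "curve_id \<Rightarrow> real \<Rightarrow> bool" where
  "hit a s \<longleftrightarrow> 0 \<le> s \<and> s \<le> real (Y + 2) \<and> hits d N (lo a) (hi a) (ht a) s"

lemma hit_unique:
  assumes "valid a" "hit a s" "hit a s'"
  shows "s = s'"
proof -
  have "\<bar>s - s'\<bar> < real N" using assms const_facts by (auto simp: hit_def)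
  then show ?thesis
    using hits_unique[OF once[OF assms(1), unfolded curve_def], of s d s'] assms mem by (auto simp: hit_def)
qed

lemma hit_column:
  assumes "c \<le> Y + 2" "lo a \<le> c + k * N" "c + k * N \<le> hi a" "d (real c) = real (ht a (c + k * N))"
  shows "hit a (real c)"
proof -
  have "N > 0" by (simp add: N_def)
  then show ?thesis using hits_nat[of N "lo a" c k "hi a" d "ht a"] assms by (simp add: hit_def)
qed

lemma hit_between:
  assumes "c < c'" "c' \<le> Y + 2" "lo a \<le> c + k * N" "c' + k * N \<le> hi a"
    "d (real c) < real (ht a (c + k * N)) \<and> real (ht a (c' + k * N)) < d (real c') \<or>
     real (ht a (c + k * N)) < d (real c) \<and> d (real c') < real (ht a (c' + k * N))"
  obtains s where "real c < s" "s < real c'" "hit a s"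
proof -
  have "continuous_on {real c..real c'} d" using assms by (intro continuous_on_subset[OF cont]) auto
  moreover have "N > 0" by (simp add: N_def)
  ultimately obtain s where "real c < s" "s < real c'" "hits d N (lo a) (hi a) (ht a) s"
    using hits_between[of N c c' d "lo a" k "hi a" "ht a"] assms by blast
  then show thesis using assms by (intro that[of s]) (auto simp: hit_def)
qed

text \<open>A known intersection at \<open>s\<close> is the only one, so away from \<open>s\<close>
  the connecting curve keeps its side. With \<open>k = 1\<close> the columns are those of the clause
  gadgets, with \<open>k = 0\<close> those of the variable gadgets.\<close>

lemma same_side:
  assumes "valid a" "hit a s" "c < c'" "c' \<le> Y + 2" "lo a \<le> c + k * N" "c' + k * N \<le> hi a" "s < real c \<or> real c' < s"
  shows "d (real c) < real (ht a (c + k * N)) \<longleftrightarrow> d (real c') < real (ht a (c' + k * N))"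
    "d (real c) \<noteq> real (ht a (c + k * N))" "d (real c') \<noteq> real (ht a (c' + k * N))"
proof -
  have no: "\<not> hit a s'" if "real c \<le> s'" "s' \<le> real c'" for s'
    using hit_unique[OF assms(1,2), of s'] that assms(7) by auto
  show ne: "d (real c) \<noteq> real (ht a (c + k * N))" "d (real c') \<noteq> real (ht a (c' + k * N))"
    using hit_column[of c a k] hit_column[of c' a k] no[of "real c"] no[of "real c'"] assms by auto
  show "d (real c) < real (ht a (c + k * N)) \<longleftrightarrow> d (real c') < real (ht a (c' + k * N))"
  proof (rule ccontr)
    assume "\<not> ?thesis"
    then have "d (real c) < real (ht a (c + k * N)) \<and> real (ht a (c' + k * N)) < d (real c') \<or>
      real (ht a (c + k * N)) < d (real c) \<and> d (real c') < real (ht a (c' + k * N))"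
      using ne by linarith
    from hit_between[OF assms(3-6) this] obtain s' where "real c < s'" "s' < real c'" "hit a s'" .
    then show False using no[of s'] by simp
  qed
qed

text \<open>The permitted meeting with \<open>TopC\<close> is spent at the common endpoint
  \<open>b\<close>.\<close>

lemma below_Top:
  assumes "c \<le> Y + 1"
  shows "d (real c) < real (if c \<le> Y then Top else be)"
proof (cases "c = 0")
  case True
  then show ?thesis using d_a const_facts by auto
next
  case False
  have "hit TopC (real (Y + 2))" using const_facts d_b by (intro hit_column[of _ _ 1]) auto
  from same_side(1)[OF _ this, of 0 c 1] show ?thesis using d_a assms False const_facts by (auto split: if_splits)
qed

text \<open>At column \<open>Y + 1\<close> the curve is below \<open>be\<close> and hence below the
  guard; at \<open>b\<close> the guard is the lower one. This crossing is forced, so the curve,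
  which starts below the guard at \<open>a\<close>, stays below it up to its final drop.\<close>

lemma below_Guard:
  assumes "j < J"
  shows "d (real (B j + v + 1)) < real (base (row j) + 2)"
proof -
  note f = const_facts clause_facts[OF assms] assms
  obtain s where "real (Y + 1) < s" "s < real (Y + 2)" "hit (GuardC j) s"
    by (rule hit_between[of "Y + 1" "Y + 2" "GuardC j" 0]) (use f below_Top[of "Y + 1"] d_b in auto)
  moreover have "B j + v + 1 \<le> Y" using f by linarith
  ultimately show ?thesis using same_side(1)[of "GuardC j" s 0 "B j + v + 1" 1] f d_a by auto
qed

text \<open>The meeting with the bar is spent at \<open>a\<close>, and at \<open>b\<close> the bar
  is far below.\<close>

lemma above_Bar:
  assumes "x < Vn"
  shows "real (eb x + 6) < d (real (G x + occ))"
proof -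
  note f = const_facts block_facts[OF assms] assms
  have "hit (BarC x) (real 0)" using f d_a by (intro hit_column[of _ _ 1]) auto
  moreover have "0 < G x + occ" "G x + occ < Y + 2" using f by linarith+
  ultimately show ?thesis
    using same_side[of "BarC x" "real 0" "G x + occ" "Y + 2" 0] f d_b by auto
qed

text \<open>A literal is chosen if it is met in the columns of the clause gadgets.\<close>

definition chosen :: "nat \<Rightarrow> nat \<Rightarrow> bool" where
  "chosen j i \<longleftrightarrow> (\<exists>s<real X0. hit (LitC j i) s)"

text \<open>The literal has been used up, and \<open>b\<close> is below its level. So the connecting
  curve is below it all the way from its starting column to \<open>b\<close>.\<close>

lemma chosen_low:
  assumes "j < J" "i < w" "chosen j i"
  shows "d (real (q j i)) < real (eb (var j i) + 2)"
proof -
  note f = const_facts lit_facts[OF assms(1,2)] block_facts[OF var[OF assms(1,2)]] assms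
  obtain s where s: "s < real X0" "hit (LitC j i) s" using assms by (auto simp: chosen_def)
  have "X0 \<le> q j i" "q j i < Y + 2" "be < la (q j i)" using f by linarith+
  then show ?thesis using same_side[OF _ s(2), of "q j i" "Y + 2" 0] s f d_b by auto
qed

text \<open>The connecting curve would be low in the left half, high at the bar, and low again in
  the right half, crossing \<open>VarC\<close> twice.\<close>

lemma chosen_consistent:
  assumes "j < J" "i < w" "chosen j i" "pol j i" "j' < J" "i' < w" "chosen j' i'" "\<not> pol j' i'" "var j i = var j' i'"
  shows False
proof -
  let ?x = "var j i" and ?m = "G (var j i) + occ"
  have x: "?x < Vn" using assms var by blast
  note f = const_facts lit_facts[OF assms(1,2)] lit_facts[OF assms(5,6)] block_facts[OF x] assms
  have m: "real (eb ?x + 4) < d (real ?m)" using above_Bar[OF x] by simp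
  have l: "d (real (q j i)) < real (eb ?x + 4)" "d (real (q j' i')) < real (eb ?x + 4)"
    using chosen_low[of j i] chosen_low[of j' i'] assms by auto
  have "q j i < ?m" "?m < q j' i'" "q j' i' \<le> G ?x + 2 * occ" using f by auto
  moreover obtain s where "real (q j i) < s" "s < real ?m" "hit (VarC ?x) s"
    by (rule hit_between[of "q j i" ?m "VarC ?x" 0]) (use f m l calculation in auto)
  moreover obtain s' where "real ?m < s'" "s' < real (q j' i')" "hit (VarC ?x) s'"
    by (rule hit_between[of ?m "q j' i'" "VarC ?x" 0]) (use f m l calculation in auto)
  ultimately show False using hit_unique[of "VarC ?x" s s'] x by auto
qed

text \<open>The point \<open>a\<close> is above all literals, and the connecting curve cannot pass
  below this one without meeting it.\<close>

lemma not_chosen_high: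
  assumes "j < J" "i < w" "\<not> chosen j i"
  shows "real (base (row j + i) + 6) < d (real (hi (LitC j i) - N))"
proof (rule ccontr)
  assume neg: "\<not> ?thesis"
  note f = const_facts clause_facts[OF assms(1)] lit_facts[OF assms(1,2)] block_facts[OF var[OF assms(1,2)]] assms
  define c where "c = hi (LitC j i) - N"
  have c: "hi (LitC j i) = c + 1 * N" "0 < c" "c < X0" using f by (auto simp: c_def)
  have lo: "lo (LitC j i) \<le> 0 + 1 * N" using f by auto
  have h: "ht (LitC j i) (c' + 1 * N) = base (row j + i) + 6" for c' using f by auto
  have "\<not> hit (LitC j i) (real c)" using assms(3) c by (auto simp: chosen_def)
  then have "d (real c) \<noteq> real (base (row j + i) + 6)"
    using hit_column[of c "LitC j i" 1] lo c h[of c] f by auto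
  then have "d (real c) < real (base (row j + i) + 6)" using neg by (simp add: c_def)
  moreover have "real (base (row j + i) + 6) < d (real 0)" using f d_a by auto
  ultimately obtain s where "s < real c" "hit (LitC j i) s"
    using hit_between[of 0 c "LitC j i" 1] lo c h f by auto
  then show False using assms(3) c by (force simp: chosen_def)
qed

text \<open>A curve that passes above all literals of a clause would have to be pushed below the first one by the
  guard, and then below each further one by the links.\<close>

lemma clause_chosen:
  assumes "j < J"
  shows "\<exists>i<w. chosen j i"
proof (rule ccontr)
  assume "\<not> ?thesis"
  then have no: "\<not> chosen j i" if "i < w" for i using that by blast
  note f = const_facts clause_facts[OF assms] assms
  \<comment> \<open>For \<open>i = 0\<close> this column is the end of the guard; afterwards it is
    the end of link \<open>i - 1\<close>, and it still lies in link \<open>i\<close> as long as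
    \<open>i \<le> v\<close>.\<close>
  have "i \<le> v + 1 \<Longrightarrow> d (real (B j + v + 1 + i)) < real (base (row j + i) + 2)" for i
  proof (induction i)
    case 0
    then show ?case using below_Guard[OF assms] by simp
  next
    case (Suc i)
    then have i: "i \<le> v" by simp
    note g = link_facts[OF assms i] f
    have up: "real (base (row j + i) + 4) < d (real (B j + i))"
      using not_chosen_high[OF assms _ no, of i] i f by auto
    have down: "d (real (B j + v + 1 + i)) < real (base (row j + i) + 4)" using Suc i by simp
    obtain s where s: "real (B j + i) < s" "s < real (B j + v + 1 + i)" "hit (LinkC j i) s"
      by (rule hit_between[of "B j + i" "B j + v + 1 + i" "LinkC j i" 1]) (use g i up down in auto)
    have "d (real (B j + v + 1 + i)) < real (ht (LinkC j i) (B j + v + 1 + i + 1 * N)) \<longleftrightarrow>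
        d (real (B j + v + 1 + Suc i)) < real (ht (LinkC j i) (B j + v + 1 + Suc i + 1 * N))"
      by (rule same_side(1)[OF _ s(3)]) (use g i s in auto)
    then show ?case using down g by (auto simp: algebra_simps)
  qed
  \<comment> \<open>The last literal reaches exactly to this column, at offset 6 over its level,
    against offset 2.\<close>
  from this[of "v + 1"] not_chosen_high[OF assms _ no, of "v + 1"] show False using f by (auto simp: algebra_simps)
qed

lemma satisfiable_if_front:
  "\<exists>V. \<forall>j<J. \<exists>i<w. V (var j i) = pol j i"
proof (rule exI, intro allI impI)
  \<comment> \<open>Variables without a chosen positive literal become false; consistency makes this
    right for all chosen negative literals.\<close>
  let ?V = "\<lambda>x. \<exists>j i. j < J \<and> i < w \<and> chosen j i \<and> pol j i \<and> var j i = x"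
  fix j assume j: "j < J"
  obtain i where i: "i < w" "chosen j i" using clause_chosen[OF j] by blast
  have "?V (var j i) = pol j i"
  proof (cases "pol j i")
    case True
    then show ?thesis using i j by blast
  next
    case False
    have "\<not> ?V (var j i)"
    proof
      assume "?V (var j i)"
      then obtain j' i' where "j' < J" "i' < w" "chosen j' i'" "pol j' i'" "var j' i' = var j i" by blast
      then show False using chosen_consistent[of j' i' j i] i j False by simp
    qed
    then show ?thesis using False by simp
  qed
  then show "\<exists>i<w. ?V (var j i) = pol j i" using i by blast
qed

end

text \<open>On the way from \<open>b\<close> over column \<open>Y + 3\<close> to \<open>a\<close>,
  the curve starts above \<open>BlockC\<close>, whose meeting is reserved for \<open>a\<close>, and
  is thus lifted above \<open>Top\<close>. To come down to \<open>a\<close> it has to cross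
  \<open>TopC\<close>, which it has already met at \<open>b\<close>.\<close>

lemma not_extendable_back:
  assumes once: "\<And>a. valid a \<Longrightarrow> meet_at_most_once (curve a) D"
    and cont: "continuous_on {real (Y + 2)..real N} d" and d_a: "d (real N) = real Z" and d_b: "d (real (Y + 2)) = real be"
    and mem: "\<And>s. s \<in> {real (Y + 2)..real N} \<Longrightarrow> wrap N (s, d s) \<in> D"
  shows False
proof -
  have N: "N > 0" "N = Y + 4" by (simp_all add: N_def)
  have uniq: "s = s'" if "valid a" "hits d N (lo a) (hi a) (ht a) s" "hits d N (lo a) (hi a) (ht a) s'"
    "real (Y + 2) \<le> s" "s \<le> real N" "real (Y + 2) \<le> s'" "s' \<le> real N" for a s s'
    by (rule hits_unique[OF once[OF that(1), unfolded curve_def]]) (use that mem N in auto)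
  have sub: "continuous_on {real c..real c'} d" if "Y + 2 \<le> c" "c' \<le> N" for c c'
    using that by (intro continuous_on_subset[OF cont]) auto
  have hN: "hits d N (lo BlockC) (hi BlockC) (ht BlockC) (real N)"
    by (rule hits_nat[of _ _ _ 0]) (use N d_a in auto)
  have "\<not> d (real (Y + 3)) \<le> real (Top + 8)"
  proof
    assume le: "d (real (Y + 3)) \<le> real (Top + 8)"
    have "\<exists>s. hits d N (lo BlockC) (hi BlockC) (ht BlockC) s \<and> real (Y + 2) \<le> s \<and> s \<le> real (Y + 3)"
    proof (cases "d (real (Y + 3)) = real (Top + 8)")
      case True
      then have "hits d N (lo BlockC) (hi BlockC) (ht BlockC) (real (Y + 3))"
        by (intro hits_nat[of _ _ _ 0]) (use N in auto)
      then show ?thesis by (intro exI[of _ "real (Y + 3)"]) simp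
    next
      case False
      obtain s where "real (Y + 2) < s" "s < real (Y + 3)" "hits d N (lo BlockC) (hi BlockC) (ht BlockC) s"
        by (rule hits_between[of N "Y + 2" "Y + 3" d "lo BlockC" 0 "hi BlockC" "ht BlockC"])
          (use N sub[of "Y + 2" "Y + 3"] False le d_b const_facts in auto)
      then show ?thesis by (intro exI[of _ s]) simp
    qed
    then obtain s where s: "hits d N (lo BlockC) (hi BlockC) (ht BlockC) s" "real (Y + 2) \<le> s" "s \<le> real (Y + 3)" by blast
    show False using uniq[OF _ s(1) hN] s N by auto
  qed
  then have gt: "real Top < d (real (Y + 3))" by simp
  obtain s where s: "real (Y + 3) < s" "s < real N" "hits d N (lo TopC) (hi TopC) (ht TopC) s"
    by (rule hits_between[of N "Y + 3" N d "lo TopC" 0 "hi TopC" "ht TopC"])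
      (use N sub[of "Y + 3" N] d_a gt const_facts in auto)
  have "hits d N (lo TopC) (hi TopC) (ht TopC) (real (Y + 2))"
    by (rule hits_nat[of _ _ _ 1]) (use N d_b in auto)
  from uniq[OF _ s(3) this] s N show False by auto
qed

lemma satisfiable_if_extendable:
  assumes "extendable arrangement pt_a pt_b"
  shows "\<exists>V. \<forall>j<J. \<exists>i<w. V (var j i) = pol j i"
proof -
  obtain D where D: "D \<subseteq> cylinder" "cylindrically_monotone D" "curve_between D pt_a pt_b"
    "\<And>a. valid a \<Longrightarrow> meet_at_most_once (curve a) D"
    using assms unfolding extendable_def arrangement_def by blast
  have D3: "curve_between D (wrap N (0, real Z)) (wrap N (real (Y + 2), real be))" using D(3) by simp
  have b: "0 < real (Y + 2)" "real (Y + 2) < real N" by (simp_all add: N_def)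
  show ?thesis
  proof (rule monotone_curve_lift[OF D(1,2) D3 b])
    fix d assume d: "continuous_on {0..real (Y + 2)} d" "d 0 = real Z" "d (real (Y + 2)) = real be"
      "\<And>s. s \<in> {0..real (Y + 2)} \<Longrightarrow> wrap N (s, d s) \<in> D"
    show ?thesis by (rule satisfiable_if_front[OF D(4) d])
  next
    fix d assume d: "continuous_on {real (Y + 2)..real N} d" "d (real (Y + 2)) = real be" "d (real N) = real Z"
      "\<And>s. s \<in> {real (Y + 2)..real N} \<Longrightarrow> wrap N (s, d s) \<in> D"
    show ?thesis using not_extendable_back[OF D(4) d(1,3,2,4)] by blast
  qed
qed

subsection \<open>A satisfying assignment yields a connecting curve\<close>

context
  fixes i0 :: "nat \<Rightarrow> nat" and V :: "nat \<Rightarrow> bool"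
  assumes i0: "\<And>j. j < J \<Longrightarrow> i0 j < w" and V: "\<And>j. j < J \<Longrightarrow> V (var j (i0 j)) = pol j (i0 j)"
begin

text \<open>Height of the connecting curve above column \<open>c\<close>, counted from \<open>a\<close>: in clause \<open>j\<close> it passes below the
  literal \<open>i0 j\<close>, and in the gadget of a variable it is low in the half given by the truth value.\<close>

definition track :: "nat \<Rightarrow> nat" where
  "track c = (if c = 0 then Z
     else if c < X0 then
       let j = (c - 1) div (2 * w) in if B j + i0 j \<le> c \<and> c \<le> B j + v + 1 + i0 j then base (row j + i0 j) + 1 else Z - 1
     else if c < Y then
       let x = (c - X0) div (2 * occ + 1) in if (if V x then c < G x + occ else G x + occ < c) then eb x + 1 else eb x + 7
     else if c < Y + 2 then 8 * Vn + 8 * J + 12 else be)"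

lemma track_clause:
  assumes "j < J" "B j \<le> c" "c < B j + 2 * w"
  shows "track c = (if B j + i0 j \<le> c \<and> c \<le> B j + v + 1 + i0 j then base (row j + i0 j) + 1 else Z - 1)"
proof -
  have "(c - 1) div (2 * w) = j"
    using assms(2,3) by (intro div_nat_eqI) (auto simp: B_def row_def algebra_simps)
  moreover have "0 < c" "c < X0" using assms clause_facts[OF assms(1)] const_facts by auto
  ultimately show ?thesis by (simp add: track_def)
qed

lemma clause_at:
  assumes "0 < c" "c < X0"
  obtains j where "j < J" "B j \<le> c" "c < B j + 2 * w"
proof
  let ?j = "(c - 1) div (2 * w)"
  have w2: "0 < 2 * w" using w by simp
  have e: "c - 1 = ?j * (2 * w) + (c - 1) mod (2 * w)" by (rule div_mult_mod_eq[symmetric])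
  have m: "(c - 1) mod (2 * w) < 2 * w" using w2 by simp
  have r: "?j * (2 * w) = 2 * row ?j" by (simp add: row_def)
  show "B ?j \<le> c" "c < B ?j + 2 * w" using e m r assms(1) unfolding B_def by linarith+
  have "J * (2 * w) = 2 * occ" by (simp add: occ_def)
  then show "?j < J" using assms by (intro less_mult_imp_div_less) (simp add: X0_def)
qed

lemma track_var:
  assumes "x < Vn" "G x \<le> c" "c \<le> G x + 2 * occ"
  shows "track c = (if (if V x then c < G x + occ else G x + occ < c) then eb x + 1 else eb x + 7)"
proof -
  have "(c - X0) div (2 * occ + 1) = x"
    using assms(2,3) by (intro div_nat_eqI) (auto simp: G_def algebra_simps)
  moreover have "X0 \<le> c" "0 < X0" "c < Y" using assms(2,3) block_facts[OF assms(1)] const_facts by auto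
  ultimately show ?thesis by (simp add: track_def)
qed

lemma var_at:
  assumes "X0 \<le> c" "c < Y"
  obtains x where "x < Vn" "G x \<le> c" "c \<le> G x + 2 * occ"
proof
  let ?x = "(c - X0) div (2 * occ + 1)"
  have e: "c - X0 = ?x * (2 * occ + 1) + (c - X0) mod (2 * occ + 1)" by (rule div_mult_mod_eq[symmetric])
  have m: "(c - X0) mod (2 * occ + 1) < 2 * occ + 1" by simp
  show "G ?x \<le> c" "c \<le> G ?x + 2 * occ" using e m assms(1) unfolding G_def by linarith+
  show "?x < Vn" using assms by (intro less_mult_imp_div_less) (simp add: Y_def G_def)
qed

lemma track_ends: "track 0 = Z" "track Y = 8 * Vn + 8 * J + 12" "track (Y + 1) = 8 * Vn + 8 * J + 12" "track (Y + 2) = be"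
  using const_facts by (auto simp: track_def)

text \<open>Even its dips in earlier clauses stay above the literals of clause \<open>j\<close>,
  since \<open>base\<close> falls by 8 from each literal to the next.\<close>

lemma track_before:
  assumes "j < J" "c < B j"
  shows "base (row j) + 9 \<le> track c"
proof (cases "c = 0")
  case True
  then show ?thesis using track_ends const_facts base_eq[of "row j"] clause_facts[OF assms(1)] by auto
next
  case False
  note f = const_facts clause_facts[OF assms(1)] base_eq[of "row j"]
  obtain j' where j': "j' < J" "B j' \<le> c" "c < B j' + 2 * w" by (rule clause_at[of c]) (use False assms f in auto)
  have "j' < j"
  proof (rule ccontr)
    assume "\<not> j' < j"
    then have "row j \<le> row j'" by (simp add: row_def)
    then show False using j' assms by (simp add: B_def)
  qed
  then have "row j' + w \<le> row j" by (rule clause_order)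
  then show ?thesis
    using f track_clause[OF j'] i0[OF j'(1)] base_eq[of "row j' + i0 j'"] by (auto split: if_splits)
qed

lemma track_start_less:
  assumes "0 < c" "c < X0"
  shows "track c < Z"
proof -
  obtain j where j: "j < J" "B j \<le> c" "c < B j + 2 * w" using clause_at[OF assms] .
  show ?thesis using track_clause[OF j] const_facts base_eq[of "row j + i0 j"] i0[OF j(1)] clause_facts[OF j(1)]
    by (auto split: if_splits)
qed

lemma track_end_ge:
  assumes "X0 \<le> c" "c \<le> Y + 2"
  shows "8 * Vn + 8 * J + 12 \<le> track c" "track c < Top"
proof -
  have "8 * Vn + 8 * J + 12 \<le> track c \<and> track c < Top"
  proof (cases "c < Y")
    case True
    obtain x where x: "x < Vn" "G x \<le> c" "c \<le> G x + 2 * occ" using var_at[OF assms(1) True] .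
    show ?thesis using track_var[OF x] block_facts[OF x(1)] const_facts by (auto split: if_splits)
  next
    case False
    then consider "c = Y" | "c = Y + 1" | "c = Y + 2" using assms by linarith
    then show ?thesis using track_ends const_facts by cases auto
  qed
  then show "8 * Vn + 8 * J + 12 \<le> track c" "track c < Top" by auto
qed

text \<open>\<open>eb\<close> falls by more than 8 from gadget to gadget, so later gadgets are
  traversed entirely below the levels of gadget \<open>x\<close>, even at offset 7.\<close>

lemma track_after:
  assumes "x < Vn" "G x + 2 * occ < c" "c \<le> Y + 2"
  shows "track c < eb x"
proof (cases "c < Y")
  case True
  note f = const_facts block_facts[OF assms(1)]
  obtain x' where x': "x' < Vn" "G x' \<le> c" "c \<le> G x' + 2 * occ" by (rule var_at[of c]) (use True assms f in auto)
  have "x < x'"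
  proof (rule ccontr)
    assume "\<not> x < x'"
    then have "G x' \<le> G x" unfolding G_def by (intro add_left_mono mult_right_mono) auto
    then show False using x' assms by simp
  qed
  then have "G x + 2 * occ + 1 \<le> G x'" by (rule G_order)
  then show ?thesis using f track_var[OF x'] block_facts[OF x'(1)] by (auto split: if_splits)
next
  case False
  then consider "c = Y" | "c = Y + 1" | "c = Y + 2" using assms by linarith
  then show ?thesis using track_ends const_facts block_facts[OF assms(1)] by cases auto
qed

text \<open>Drawn from column \<open>N\<close> on, so that the clause gadgets are compared unshifted
  and the variable gadgets after a shift by one turn.\<close>

definition track_curve :: "(complex \<times> real) set" where
  "track_curve = pl_curve N N (N + Y + 2) (\<lambda>c. track (c - N))"

lemma track_curve_facts:
  "track_curve \<subseteq> cylinder" "cylindrically_monotone track_curve" "curve_between track_curve pt_a pt_b"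
proof -
  have N: "N < N + Y + 2" "N + Y + 2 < N + N" "N > 0" by (simp_all add: N_def)
  note pc = pl_curve_facts[OF N(1,2), of "\<lambda>c. track (c - N)"]
  show "track_curve \<subseteq> cylinder" "cylindrically_monotone track_curve" using pc by (simp_all add: track_curve_def)
  have "wrap N (real N, real Z) = pt_a" "wrap N (real (N + Y + 2), real be) = pt_b"
    using wrap_add_N[OF N(3), of 0 "real Z"] wrap_add_N[OF N(3), of "real (Y + 2)" "real be"]
    by (simp_all add: algebra_simps)
  moreover have "N + Y + 2 - N = Y + 2" by simp
  ultimately show "curve_between track_curve pt_a pt_b" using pc(5) track_ends unfolding track_curve_def by simp
qed

lemma track_meets_once:
  assumes a: "valid a"
    and start: "flips (\<lambda>c. track (c - N)) (ht a) {max N (lo a)..min (N + Y + 2) (hi a)} m \<or>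
      flips (ht a) (\<lambda>c. track (c - N)) {max N (lo a)..min (N + Y + 2) (hi a)} m"
    and ending: "flips track (ht a) {lo a..min (Y + 2) (hi a)} m' \<or> flips (ht a) track {lo a..min (Y + 2) (hi a)} m'"
    and one: "(\<forall>c\<in>{max N (lo a)..min (N + Y + 2) (hi a)}. ht a c < track (c - N)) \<or>
      (\<forall>c\<in>{lo a..min (Y + 2) (hi a)}. ht a c < track c) \<or>
      (\<forall>c\<in>{max N (lo a)..min (N + Y + 2) (hi a)}. track (c - N) < ht a c) \<or>
      (\<forall>c\<in>{lo a..min (Y + 2) (hi a)}. track c < ht a c)"
  shows "meet_at_most_once (curve a) track_curve"
proof -
  have hi: "hi a < N + N" using range_facts(4)[OF a] const_facts by (cases "a = TopC") auto
  have sets: "{max (N - N) (lo a)..min (N + Y + 2 - N) (hi a)} = {lo a..min (Y + 2) (hi a)}"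
    and shift: "(\<lambda>c. track (c + N - N)) = track" by simp_all
  have "pair_ok track_curve (curve a)" unfolding track_curve_def curve_def
  proof (rule pair_ok_shifted[where m = m and m' = m'], unfold sets shift)
    show "N > 0" "N < N + Y + 2" "N + Y + 2 < N + N" "N + Y + 2 < lo a + 2 * N" by (simp_all add: N_def)
    show "(\<forall>c\<in>{max N (lo a)..min (N + Y + 2) (hi a)}. ht a c < track (c - N)) \<or>
      (\<forall>c\<in>{lo a..min (Y + 2) (hi a)}. ht a c < track (c + N - N)) \<or>
      (\<forall>c\<in>{max N (lo a)..min (N + Y + 2) (hi a)}. track (c - N) < ht a c) \<or>
      (\<forall>c\<in>{lo a..min (Y + 2) (hi a)}. track (c + N - N) < ht a c)"
      unfolding add_diff_cancel_right' by (rule one)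
  qed (fact range_facts(1,2)[OF a] hi start ending)+
  then show ?thesis by (rule pair_ok_meet)
qed

lemma track_Top: "meet_at_most_once (curve TopC) track_curve"
proof -
  have less: "track c < ht TopC (c + N)" if "c < Y + 2" for c
  proof (cases "c = 0 \<or> c = Y + 1")
    case True
    then show ?thesis using track_ends const_facts by auto
  next
    case False
    then show ?thesis using that track_start_less[of c] track_end_ge[of c] const_facts by (cases "c < X0") auto
  qed
  have "pair_ok track_curve (curve TopC)" unfolding track_curve_def curve_def hi.simps
  proof (rule pair_ok_common_end)
    fix c assume "c \<in> {max N (lo TopC)..<N + Y + 2}"
    then show "track (c - N) < ht TopC c" using less[of "c - N"] by (auto simp: algebra_simps)
  qed (use track_ends in \<open>auto simp: N_def algebra_simps\<close>)
  then show ?thesis by (rule pair_ok_meet)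
qed

text \<open>The common point \<open>a\<close> is the right end of the given curve but the left end
  of the track. The unshifted overlap is therefore the single column \<open>N\<close>; in the
  shifted one the track is strictly above.\<close>

lemma track_above:
  assumes "lo a \<le> Y + 2" "hi a = N" "\<And>c. lo a \<le> c \<Longrightarrow> c \<le> Y + 2 \<Longrightarrow> ht a c < track c"
  shows "meet_at_most_once (curve a) track_curve"
proof -
  have N: "N > 0" "N = Y + 4" by (simp_all add: N_def)
  have "p = wrap N (real N, real (ht a N))" if p: "p \<in> curve a" "p \<in> track_curve" for p
  proof (rule pl_curves_meet[OF N(1) _ _ p(2)[unfolded track_curve_def] p(1)[unfolded curve_def]])
    fix s assume s: "real (max N (lo a)) \<le> s" "s \<le> real (min (N + Y + 2) (hi a))" "p = wrap N (s, pl (ht a) s)"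
    then have "s = real N" using assms(2) by (auto simp: max_def min_def split: if_splits)
    then show ?thesis using s(3) by simp
  next
    fix s assume s: "real (max (N - N) (lo a)) \<le> s" "s \<le> real (min (N + Y + 2 - N) (hi a))"
      "pl (\<lambda>c. track (c - N)) (s + real N) = pl (ht a) s"
    have "0 \<le> s" using s(1) by simp
    then have "pl (\<lambda>c. track (c - N)) (s + real N) = pl track s" by (simp add: pl_shift)
    moreover have "pl (ht a) s < pl track s"
      by (rule pl_less[of "lo a" "Y + 2"]) (use s assms N in auto)
    ultimately show ?thesis using s(3) by simp
  qed (use assms N in auto)
  then show ?thesis unfolding meet_at_most_once_def by blast
qed

lemma track_Block: "meet_at_most_once (curve BlockC) track_curve"
proof (rule track_above)
  fix c assume "lo BlockC \<le> c" "c \<le> Y + 2"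
  then have "c = Y + 2" by simp
  then show "ht BlockC c < track c" using track_ends(4) const_facts by simp
qed auto

lemma track_Bar:
  assumes x: "x < Vn"
  shows "meet_at_most_once (curve (BarC x)) track_curve"
proof (rule track_above)
  note f = const_facts block_facts[OF x] x
  fix c assume c: "lo (BarC x) \<le> c" "c \<le> Y + 2"
  show "ht (BarC x) c < track c"
  proof (cases "c = G x + occ")
    case True
    then show ?thesis using track_var[OF x, of c] by auto
  next
    case False
    then show ?thesis using c f track_end_ge[of c] by auto
  qed
qed (use const_facts block_facts[OF x] in auto)

text \<open>The crossing before \<open>b\<close> is the only one. The dip in clause \<open>j\<close>
  contains column \<open>B j + v + 1\<close> for every choice of \<open>i0 j\<close>, so the track
  passes below the end of the guard.\<close>

lemma track_Guard:
  assumes j: "j < J"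
  shows "meet_at_most_once (curve (GuardC j)) track_curve"
proof -
  note f = const_facts clause_facts[OF j] i0[OF j] j
  have start: "track (c - N) < ht (GuardC j) c" if c: "N \<le> c" "c \<le> hi (GuardC j)" for c
  proof (cases "c = N + B j + v + 1")
    case True
    have "track (B j + v + 1) = base (row j + i0 j) + 1"
      using track_clause[OF j, of "B j + v + 1"] f by auto
    moreover have "base (row j + i0 j) \<le> base (row j)" by (simp add: base_def)
    ultimately show ?thesis using True const_facts(1) clause_facts(1)[OF j] by simp
  next
    case False
    have "B j + v + 1 < X0" "c - N \<le> B j + v + 1" using c f by auto
    then have "c - N < X0" by simp
    then have "track (c - N) \<le> Z" using c track_ends track_start_less[of "c - N"] by (cases "c = N") auto
    then show ?thesis using c False f by auto
  qed
  have "flips track (ht (GuardC j)) {Y + 1..Y + 2} (Y + 1)"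
    using track_ends f by (auto simp: flips_def le_Suc_eq)
  then show ?thesis using start f
    by (intro track_meets_once[of "GuardC j" "N + Y + 2" "Y + 1"]) (auto simp: flips_def)
qed

text \<open>Links after the chosen literal stay below even the dip. The link of the chosen literal
  is crossed in its last strip, where the dip ends. Earlier links are crossed where the dip begins,
  and they end before it does.\<close>

lemma track_Link:
  assumes j: "j < J" and i: "i \<le> v"
  shows "meet_at_most_once (curve (LinkC j i)) track_curve"
proof -
  note f = const_facts clause_facts[OF j] i0[OF j] j i link_facts[OF j i]
  have b: "base (row j + i0 j) + 8 * row j + 8 * i0 j = 8 * occ" using lit_facts(7)[OF j i0[OF j]] .
  have t: "track (c - N) = (if N + B j + i0 j \<le> c \<and> c \<le> N + B j + v + 1 + i0 j then base (row j + i0 j) + 1 else Z - 1)"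
    if "c \<in> {N + B j + i..N + B j + w + i}" for c
    using that track_clause[OF j, of "c - N"] f by auto
  have "\<exists>m. flips (\<lambda>c. track (c - N)) (ht (LinkC j i)) {N + B j + i..N + B j + w + i} m \<or>
      flips (ht (LinkC j i)) (\<lambda>c. track (c - N)) {N + B j + i..N + B j + w + i} m"
  proof (cases "i0 j" i rule: linorder_cases)
    case less
    have "ht (LinkC j i) c < track (c - N)" if "c \<in> {N + B j + i..N + B j + w + i}" for c
      using t[OF that] f b less that by (auto split: if_splits)
    then have "flips (\<lambda>c. track (c - N)) (ht (LinkC j i)) {N + B j + i..N + B j + w + i} 0"
      using f(1) by (simp add: flips_def del: ht.simps)
    then show ?thesis by blast
  next
    case equal
    have "if c \<le> N + B j + w + i - 1 then track (c - N) < ht (LinkC j i) c else ht (LinkC j i) c < track (c - N)"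
      if "c \<in> {N + B j + i..N + B j + w + i}" for c
      using t[OF that] f b equal that by (auto split: if_splits)
    then have "flips (\<lambda>c. track (c - N)) (ht (LinkC j i)) {N + B j + i..N + B j + w + i} (N + B j + w + i - 1)"
      unfolding flips_def by blast
    then show ?thesis by blast
  next
    case greater
    have "if c \<le> N + B j + i0 j - 1 then ht (LinkC j i) c < track (c - N) else track (c - N) < ht (LinkC j i) c"
      if "c \<in> {N + B j + i..N + B j + w + i}" for c
      using t[OF that] f b greater that by (auto split: if_splits)
    then have "flips (ht (LinkC j i)) (\<lambda>c. track (c - N)) {N + B j + i..N + B j + w + i} (N + B j + i0 j - 1)"
      unfolding flips_def by blast
    then show ?thesis by blast
  qed
  then obtain m where m: "flips (\<lambda>c. track (c - N)) (ht (LinkC j i)) {N + B j + i..N + B j + w + i} m \<or>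
      flips (ht (LinkC j i)) (\<lambda>c. track (c - N)) {N + B j + i..N + B j + w + i} m" by blast
  have w1: "{max N (lo (LinkC j i))..min (N + Y + 2) (hi (LinkC j i))} = {N + B j + i..N + B j + w + i}"
    and w2: "{lo (LinkC j i)..min (Y + 2) (hi (LinkC j i))} = {}"
    using f by (auto simp: min_def max_def)
  have "valid (LinkC j i)" using j i by simp
  then show ?thesis
    by (rule track_meets_once[where m = m and m' = 0]) (unfold w1 w2, use m in \<open>auto simp: flips_def simp del: ht.simps\<close>)
qed

text \<open>The middle column always counts as high, so the change from low to high is right before
  it and the change from high to low right behind it.\<close>

lemma track_Var:
  assumes x: "x < Vn"
  shows "meet_at_most_once (curve (VarC x)) track_curve"
proof -
  note f = const_facts block_facts[OF x] x
  let ?m = "if V x then G x + occ - 1 else G x + occ"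
  have "0 < occ" using f by linarith
  then have "flips track (ht (VarC x)) {G x..G x + 2 * occ} ?m \<or> flips (ht (VarC x)) track {G x..G x + 2 * occ} ?m"
    using track_var[OF x] by (cases "V x") (auto simp: flips_def)
  then show ?thesis using f
    by (intro track_meets_once[of "VarC x" 0 ?m]) (auto simp: flips_def min_def max_def)
qed

text \<open>The chosen literal is crossed where the dip begins; the track is low in the half where
  it starts, so it is not met again. Any other literal is not met in the clause gadgets: it ends
  before the dip or is lower than the dip. It may then be crossed once behind its start.\<close>

lemma track_Lit:
  assumes j: "j < J" and i: "i < w"
  shows "meet_at_most_once (curve (LitC j i)) track_curve"
proof -
  note f = const_facts clause_facts[OF j] i0[OF j] j i
  have x: "var j i < Vn" using var j i by blast
  note l = lit_facts[OF j i] block_facts[OF x]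
  have b: "base (row j + i0 j) + 8 * row j + 8 * i0 j = 8 * occ" using lit_facts(7)[OF j i0[OF j]] .
  have after: "track c < ht (LitC j i) c" if "q j i < c" "c \<le> Y + 2" for c
  proof (cases "c \<le> G (var j i) + 2 * occ")
    case True
    then show ?thesis using track_var[OF x, of c] l f that by (auto split: if_splits)
  next
    case False
    then show ?thesis using track_after[OF x, of c] l f that by auto
  qed
  have atq: "track (q j i) \<noteq> ht (LitC j i) (q j i)"
    using track_var[OF x, of "q j i"] l by (auto split: if_splits)
  have atq0: "track (q j i) < ht (LitC j i) (q j i)" if "i = i0 j"
    using track_var[OF x, of "q j i"] l V[OF j] that by (auto split: if_splits)
  have w1: "{max N (lo (LitC j i))..min (N + Y + 2) (hi (LitC j i))} = {N..hi (LitC j i)}"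
    and w2: "{lo (LitC j i)..min (Y + 2) (hi (LitC j i))} = {q j i..Y + 2}" and hi: "hi (LitC j i) < N + B j + 2 * w"
    using f l by (auto simp: min_def max_def)
  have h1: "ht (LitC j i) c = base (row j + i) + 6" if "N \<le> c" for c using that l f by auto
  have bi: "base (row j + i) \<le> base (row j)" by (simp add: base_def)
  have block: "track (c - N) = (if N + B j + i0 j \<le> c \<and> c \<le> N + B j + v + 1 + i0 j then base (row j + i0 j) + 1 else Z - 1)"
    if "N + B j \<le> c" "c \<le> hi (LitC j i)" for c
    using that track_clause[OF j, of "c - N"] hi by auto
  have pre: "ht (LitC j i) c < track (c - N)" if "N \<le> c" "c < N + B j" for c
  proof -
    have "c - N < B j" using that by linarith
    then show ?thesis using track_before[OF j, of "c - N"] h1[OF that(1)] bi by linarith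
  qed
  show ?thesis
  proof (cases "i = i0 j")
    case False
    have "ht (LitC j i) c < track (c - N)" if "c \<in> {N..hi (LitC j i)}" for c
    proof (cases "c < N + B j")
      case True
      then show ?thesis using pre that by simp
    next
      case c: False
      then have "N \<le> c" by simp
      then show ?thesis using block[of c] c that False f b l unfolding h1[OF \<open>N \<le> c\<close>] by (auto split: if_splits)
    qed
    note start = this
    have "flips track (ht (LitC j i)) {q j i..Y + 2} (Y + 2) \<or> flips (ht (LitC j i)) track {q j i..Y + 2} (q j i)"
    proof (cases "track (q j i) < ht (LitC j i) (q j i)")
      case True
      then have "track c < ht (LitC j i) c" if "c \<in> {q j i..Y + 2}" for c using after[of c] that by (cases "c = q j i") auto
      then have "flips track (ht (LitC j i)) {q j i..Y + 2} (Y + 2)" unfolding flips_def by simp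
      then show ?thesis ..
    next
      case False
      have "flips (ht (LitC j i)) track {q j i..Y + 2} (q j i)" unfolding flips_def
      proof
        fix c assume "c \<in> {q j i..Y + 2}"
        then show "if c \<le> q j i then ht (LitC j i) c < track c else track c < ht (LitC j i) c"
          using False atq after[of c] by (cases "c = q j i") (auto simp del: ht.simps)
      qed
      then show ?thesis ..
    qed
    then obtain m' where "flips track (ht (LitC j i)) {q j i..Y + 2} m' \<or> flips (ht (LitC j i)) track {q j i..Y + 2} m'" by blast
    moreover have "flips (ht (LitC j i)) (\<lambda>c. track (c - N)) {N..hi (LitC j i)} (hi (LitC j i))"
      using start unfolding flips_def by simp
    ultimately show ?thesis using j i start
      by (intro track_meets_once[of "LitC j i" "hi (LitC j i)" m']) (simp_all only: w1 w2 valid.simps, simp_all)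
  next
    case True
    have "track c < ht (LitC j i) c" if "c \<in> {q j i..Y + 2}" for c using after[of c] atq0[OF True] that by (cases "c = q j i") auto
    note ending = this
    then have e: "flips track (ht (LitC j i)) {q j i..Y + 2} (Y + 2)" unfolding flips_def by simp
    have "flips (ht (LitC j i)) (\<lambda>c. track (c - N)) {N..hi (LitC j i)} (N + B j + i - 1)" unfolding flips_def
    proof
      fix c assume c: "c \<in> {N..hi (LitC j i)}"
      show "if c \<le> N + B j + i - 1 then ht (LitC j i) c < track (c - N) else track (c - N) < ht (LitC j i) c"
      proof (cases "c < N + B j")
        case t: True
        then show ?thesis using pre[of c] c by (auto simp del: ht.simps)
      next
        case t: False
        then have "N \<le> c" by simp
        then show ?thesis using block[of c] c t True f b l unfolding h1[OF \<open>N \<le> c\<close>] by (auto split: if_splits)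
      qed
    qed
    then show ?thesis using j i e ending
      by (intro track_meets_once[of "LitC j i" "N + B j + i - 1" "Y + 2"]) (simp_all only: w1 w2 valid.simps, simp_all)
  qed
qed

lemma extendable_if_chosen: "extendable arrangement pt_a pt_b"
proof -
  have "meet_at_most_once (curve a) track_curve" if "valid a" for a
    using that track_Top track_Block track_Guard track_Lit track_Link track_Bar track_Var by (cases a) auto
  then show ?thesis using track_curve_facts unfolding extendable_def arrangement_def by blast
qed

end

theorem extendable_iff_satisfiable:
  "extendable arrangement pt_a pt_b \<longleftrightarrow> (\<exists>V. \<forall>j<J. \<exists>i<w. V (var j i) = pol j i)"
proof
  assume "\<exists>V. \<forall>j<J. \<exists>i<w. V (var j i) = pol j i"
  then obtain V where "\<forall>j. \<exists>i. j < J \<longrightarrow> i < w \<and> V (var j i) = pol j i" by blast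
  from choice[OF this] obtain i0 where i0: "\<forall>j. j < J \<longrightarrow> i0 j < w \<and> V (var j (i0 j)) = pol j (i0 j)" ..
  show "extendable arrangement pt_a pt_b" by (rule extendable_if_chosen[of i0 V]) (use i0 in auto)
qed (rule satisfiable_if_extendable)

end

section \<open>Invariance under homeomorphisms of the cylinder\<close>

definition fibre_preserving :: "(complex \<times> real \<Rightarrow> complex \<times> real) \<Rightarrow> bool" where
  "fibre_preserving h \<longleftrightarrow> (\<forall>p\<in>cylinder. \<forall>q\<in>cylinder. fst (h p) = fst (h q) \<longleftrightarrow> fst p = fst q)"

lemma extendable_image:
  assumes h: "homeomorphism cylinder cylinder h h'" and fib: "fibre_preserving h"
    and A: "\<And>C. C \<in> A \<Longrightarrow> C \<subseteq> cylinder" and ext: "extendable A a b"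
  shows "extendable ((`) h ` A) (h a) (h b)"
proof -
  obtain D where D: "D \<subseteq> cylinder" "cylindrically_monotone D" "curve_between D a b" "\<And>C. C \<in> A \<Longrightarrow> meet_at_most_once C D"
    using ext unfolding extendable_def by blast
  have inj: "inj_on h cylinder" using h by (metis homeomorphism_def inj_on_inverseI)
  have cont: "continuous_on cylinder h" and im: "h ` cylinder = cylinder" using h by (auto simp: homeomorphism_def)
  obtain g where g: "arc g" "path_image g = D" "pathstart g = a" "pathfinish g = b"
    using D(3) unfolding curve_between_def by blast
  have "continuous_on D h" "inj_on h D" using cont inj D(1) by (auto intro: continuous_on_subset inj_on_subset)
  then have "continuous_on {0..1} (h \<circ> g)" "inj_on (h \<circ> g) {0..1}"
    using g(1,2) by (simp_all only: arc_def path_def path_image_def continuous_on_compose comp_inj_on)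
  then have "arc (h \<circ> g)" by (simp add: arc_def path_def)
  then have cb: "curve_between (h ` D) (h a) (h b)" unfolding curve_between_def
    by (intro exI[of _ "h \<circ> g"]) (use g in \<open>auto simp: path_image_compose pathstart_compose pathfinish_compose\<close>)
  have mono: "cylindrically_monotone (h ` D)" unfolding cylindrically_monotone_def meet_at_most_once_def
  proof (intro allI ballI)
    fix u p q assume u: "p \<in> h ` D \<inter> vertical_line u" "q \<in> h ` D \<inter> vertical_line u"
    then obtain p' q' where pq: "p' \<in> D" "q' \<in> D" "p = h p'" "q = h q'" by blast
    have "fst p = u" "fst q = u" using u unfolding vertical_line_def by (simp_all add: mem_Times_iff)
    moreover have "p' \<in> cylinder" "q' \<in> cylinder" using pq(1,2) D(1) by blast+
    ultimately have "fst p' = fst q'" using fib[unfolded fibre_preserving_def, rule_format, of p' q'] pq(3,4) by simp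
    then have "p' \<in> D \<inter> vertical_line (fst p')" "q' \<in> D \<inter> vertical_line (fst p')"
      using pq by (auto simp: vertical_line_def mem_Times_iff)
    then have "p' = q'" using D(2) unfolding cylindrically_monotone_def meet_at_most_once_def by blast
    then show "p = q" using pq by simp
  qed
  have "meet_at_most_once (h ` C) (h ` D)" if C: "C \<in> A" for C
  proof -
    have "h ` C \<inter> h ` D = h ` (C \<inter> D)" using inj_on_image_Int[OF inj A[OF C] D(1)] by simp
    then show ?thesis using D(4)[OF C] unfolding meet_at_most_once_def by (metis imageE)
  qed
  then show ?thesis unfolding extendable_def
    using cb mono D(1) im by (intro exI[of _ "h ` D"]) auto
qed

lemma extendable_image_iff:
  assumes h: "homeomorphism cylinder cylinder h h'" and fib: "fibre_preserving h"
    and A: "\<And>C. C \<in> A \<Longrightarrow> C \<subseteq> cylinder" and a: "a \<in> cylinder" "b \<in> cylinder"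
  shows "extendable ((`) h ` A) (h a) (h b) \<longleftrightarrow> extendable A a b"
proof
  have h': "homeomorphism cylinder cylinder h' h" using h by (rule homeomorphism_symD)
  have inv: "h' (h p) = p" "h (h' p) = p" "h p \<in> cylinder" "h' p \<in> cylinder" if "p \<in> cylinder" for p
    using h that by (auto simp: homeomorphism_def)
  have fib': "fibre_preserving h'"
    unfolding fibre_preserving_def
  proof (intro ballI)
    fix p q assume "p \<in> cylinder" "q \<in> cylinder"
    then show "fst (h' p) = fst (h' q) \<longleftrightarrow> fst p = fst q"
      using fib inv unfolding fibre_preserving_def by metis
  qed
  have "h' ` h ` C = C" if "C \<in> A" for C
  proof -
    have "h' ` h ` C = (\<lambda>p. p) ` C" unfolding image_image
      using A[OF that] inv(1) by (intro image_cong) auto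
    then show ?thesis by simp
  qed
  then have im: "(`) h' ` (`) h ` A = A" by (simp add: image_image)
  assume "extendable ((`) h ` A) (h a) (h b)"
  then have "extendable ((`) h' ` (`) h ` A) (h' (h a)) (h' (h b))"
    using A inv(3) by (intro extendable_image[OF h' fib']) blast+
  then show "extendable A a b" using im inv a by simp
next
  assume "extendable A a b"
  then show "extendable ((`) h ` A) (h a) (h b)" using extendable_image[OF h fib A] by blast
qed

text \<open>A code fixes an instance only up to homeomorphisms that respect vertical lines, so the
  reduction has to be correct for every instance with that code.\<close>

lemma describes_extendable_iff:
  assumes "describes (M, Cs, u, u') A a b"
  shows "extendable A a b \<longleftrightarrow> extendable (drawn_curve M ` set Cs) (wrap M (grid_point u)) (wrap M (grid_point u'))"
proof -
  obtain h h' where h: "homeomorphism cylinder cylinder h h'" "fibre_preserving h"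
    "A = (`) h ` drawn_curve M ` set Cs" "a = h (wrap M (grid_point u))" "b = h (wrap M (grid_point u'))"
    using assms unfolding describes_def prod.case fibre_preserving_def image_image by blast
  have sub: "C \<subseteq> cylinder" if "C \<in> drawn_curve M ` set Cs" for C
    using that by (auto simp: drawn_curve_def wrap_in_cylinder)
  show ?thesis unfolding h(3-5)
    by (rule extendable_image_iff[OF h(1,2) sub]) (simp_all add: wrap_in_cylinder)
qed

lemma describes_drawn:
  "describes (M, Cs, u, u') (drawn_curve M ` set Cs) (wrap M (grid_point u)) (wrap M (grid_point u'))"
  unfolding describes_def prod.case
  by (rule exI[of _ "\<lambda>p. p"], rule exI[of _ "\<lambda>p. p"]) (simp add: homeomorphism_ident)

section \<open>Writing down the arrangement\<close>

context cnf_arrangement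
begin

definition chain :: "curve_id \<Rightarrow> (nat \<times> nat) list" where
  "chain a = map (\<lambda>c. (c, ht a c)) [lo a..<Suc (hi a)]"

lemma drawn_curve_chain: "valid a \<Longrightarrow> drawn_curve N (chain a) = curve a"
  unfolding chain_def curve_def by (rule drawn_curve_eq_pl_curve) (rule range_facts(1))

end

notation Add (infixl "\<oplus>" 65)
notation Sub (infixl "\<ominus>" 65)
notation Mul (infixl "\<otimes>" 70)

text \<open>An index beyond the environment evaluates to 0. This has to remain so when a template
  literal is evaluated inside further loops, which lengthen the environment.\<close>

fun restrict_vars :: "nat \<Rightarrow> aexp \<Rightarrow> aexp" where
  "restrict_vars m (Var k) = (if k < m then Var k else Cst 0)"
| "restrict_vars m (a \<oplus> b) = restrict_vars m a \<oplus> restrict_vars m b"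
| "restrict_vars m (a \<otimes> b) = restrict_vars m a \<otimes> restrict_vars m b"
| "restrict_vars m (a \<ominus> b) = restrict_vars m a \<ominus> restrict_vars m b"
| "restrict_vars m (Inp a) = Inp (restrict_vars m a)"
| "restrict_vars m (Cst n) = Cst n"

lemma aval_restrict_vars: "m = length e \<Longrightarrow> aval x (e @ e') (restrict_vars m a) = aval x e a"
  by (induction a) (auto simp: nth_append)

definition ifle :: "aexp \<Rightarrow> aexp \<Rightarrow> aexp \<Rightarrow> aexp \<Rightarrow> aexp" where
  "ifle a b = ifx (Cst 1 \<ominus> (a \<ominus> b))"

definition ifless :: "aexp \<Rightarrow> aexp \<Rightarrow> aexp \<Rightarrow> aexp \<Rightarrow> aexp" where
  "ifless a b = ifle (a \<oplus> Cst 1) b"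

lemma aval_ifle [simp]: "aval x e (ifle a b c d) = (if aval x e a \<le> aval x e b then aval x e c else aval x e d)"
  unfolding ifle_def by (rule aval_ifx) auto

lemma aval_ifless [simp]: "aval x e (ifless a b c d) = (if aval x e a < aval x e b then aval x e c else aval x e d)"
  unfolding ifless_def by auto

fun seqs :: "emitter list \<Rightarrow> emitter" where
  "seqs [] = For (Cst 0) (EmitB False)"
| "seqs (p # ps) = Seq p (seqs ps)"

lemma emitted_seqs [simp]: "emitted x e (seqs ps) = concat (map (emitted x e) ps)"
  by (induction ps) auto

text \<open>The loop variable of the column loop has index \<open>m\<close>.\<close>

definition curve_emitter :: "nat \<Rightarrow> aexp \<Rightarrow> aexp \<Rightarrow> (aexp \<Rightarrow> aexp) \<Rightarrow> emitter" where
  "curve_emitter m lo hi ht = seqs [EmitB True, For (hi \<oplus> Cst 1 \<ominus> lo)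
     (seqs [EmitB True, EmitN (lo \<oplus> Var m), EmitN (ht (lo \<oplus> Var m))]), EmitB False]"

text \<open>The left end and the heights are evaluated inside the column loop, hence in extended
  environments; the right end is evaluated only outside. The leading True announces an entry in the
  list of curves.\<close>

lemma emitted_curve_emitter:
  assumes m: "m = Suc (length e)" and lo: "\<And>e'. aval x (n # e @ e') alo = l" and hi: "aval x (n # e) ahi = h"
    and ht: "\<And>e' a. aval x (n # e @ e') (aht a) = H (aval x (n # e @ e') a)"
  shows "emitted x (n # e) (curve_emitter m alo ahi aht) = True # code_list code_point (map (\<lambda>c. (c, H c)) [l..<Suc h])"
proof -
  have l: "aval x (n # e) alo = l" using lo[of "[]"] by simp
  have "[l..<Suc h] = map (\<lambda>i. l + i) [0..<Suc h - l]"
    using map_add_upt[of l "Suc h - l"] by (cases "l \<le> Suc h") (simp_all add: add.commute)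
  then show ?thesis
    by (simp add: curve_emitter_def code_list_def code_point_def m lo l hi ht nth_append o_def del: upt_Suc)
qed

section \<open>A program that writes the arrangement\<close>

locale clause_templates =
  fixes p :: "nat poly" and tmpl :: "(bool \<times> aexp) list list" and w K :: nat
  assumes w: "w \<ge> 2" and tmpl: "tmpl \<noteq> []" and length_clause: "\<And>cl. cl \<in> set tmpl \<Longrightarrow> length cl = w"
    and var_bound: "\<And>x T t P cl b a. T = Suc (poly p (length x)) \<Longrightarrow> t < T \<Longrightarrow> P < 2 * T + 1 \<Longrightarrow> cl \<in> set tmpl \<Longrightarrow>
       (b, a) \<in> set cl \<Longrightarrow> aval x (cnf_env x T t P) a < K * ((T + 2) * (2 * T + 3))"
begin

abbreviation "kk \<equiv> length tmpl"

text \<open>Expressions for the constants and functions of \<open>cnf_arrangement\<close>. Apart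
  from their arguments they mention only \<open>Var 0\<close>, the input length, and so have the
  same value at any loop depth.\<close>

definition xT :: aexp where "xT = clock p"
definition xR :: aexp where "xR = Cst 2 \<otimes> xT \<oplus> Cst 1"
definition xJ :: aexp where "xJ = Cst kk \<otimes> (xR \<otimes> xT)"
definition xVn :: aexp where "xVn = Cst K \<otimes> ((xT \<oplus> Cst 2) \<otimes> (Cst 2 \<otimes> xT \<oplus> Cst 3))"
definition xocc :: aexp where "xocc = xJ \<otimes> Cst w"
definition xrow :: "aexp \<Rightarrow> aexp" where "xrow j = j \<otimes> Cst w"
definition xB :: "aexp \<Rightarrow> aexp" where "xB j = Cst 1 \<oplus> Cst 2 \<otimes> xrow j"
definition xG :: "aexp \<Rightarrow> aexp" where "xG x = Cst 1 \<oplus> Cst 2 \<otimes> xocc \<oplus> x \<otimes> (Cst 2 \<otimes> xocc \<oplus> Cst 1)"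
definition xY :: aexp where "xY = xG xVn"
definition xN :: aexp where "xN = xY \<oplus> Cst 4"
definition xbe :: aexp where "xbe = Cst 8 \<otimes> xVn \<oplus> Cst 8 \<otimes> xJ \<oplus> Cst 16"
definition xHh :: aexp where "xHh = Cst 8 \<otimes> xY \<oplus> xbe \<oplus> Cst 8 \<otimes> xJ \<oplus> Cst 16"
definition xla :: "aexp \<Rightarrow> aexp" where "xla c = xHh \<ominus> Cst 8 \<otimes> c"
definition xeb :: "aexp \<Rightarrow> aexp" where "xeb x = xla (xG x \<oplus> Cst 2 \<otimes> xocc \<oplus> Cst 1)"
definition xZ :: aexp where "xZ = Cst 8 \<otimes> xocc \<oplus> Cst 16"
definition xTop :: aexp where "xTop = xHh \<oplus> xZ \<oplus> Cst 8 \<otimes> xJ \<oplus> Cst 16"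
definition xbase :: "aexp \<Rightarrow> aexp" where "xbase r = Cst 8 \<otimes> xocc \<ominus> Cst 8 \<otimes> r"
definition xq :: "bool \<Rightarrow> aexp \<Rightarrow> aexp \<Rightarrow> nat \<Rightarrow> aexp" where
  "xq b x j i = xG x \<oplus> (if b then Cst 0 else xocc \<oplus> Cst 1) \<oplus> (xrow j \<oplus> Cst i)"

definition emit_Top :: "nat \<Rightarrow> emitter" where
  "emit_Top m = curve_emitter m (xY \<oplus> Cst 3) (xN \<oplus> xY \<oplus> Cst 2) (\<lambda>c. ifle c (xN \<oplus> xY) xTop xbe)"

definition emit_Block :: "nat \<Rightarrow> emitter" where
  "emit_Block m = curve_emitter m (xY \<oplus> Cst 2) xN (\<lambda>c. ifle c (xY \<oplus> Cst 2) (Cst 8 \<otimes> xVn \<oplus> Cst 8 \<otimes> xJ \<oplus> Cst 8)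
     (ifless c xN (xTop \<oplus> Cst 8) xZ))"

definition emit_Guard :: "nat \<Rightarrow> aexp \<Rightarrow> emitter" where
  "emit_Guard m j = curve_emitter m (xY \<oplus> Cst 1) (xN \<oplus> xB j \<oplus> Cst (w - 2) \<oplus> Cst 1)
     (\<lambda>c. ifle c (xY \<oplus> Cst 1) (xbe \<oplus> Cst 8 \<otimes> j \<oplus> Cst 8) (ifless c xN (Cst 8 \<otimes> xVn \<oplus> Cst 8 \<otimes> j \<oplus> Cst 8)
       (ifless c (xN \<oplus> xB j \<oplus> Cst (w - 2) \<oplus> Cst 1) (xZ \<oplus> Cst 8 \<otimes> j \<oplus> Cst 8) (xbase (xrow j) \<oplus> Cst 2))))"

definition emit_Lit :: "nat \<Rightarrow> bool \<Rightarrow> aexp \<Rightarrow> aexp \<Rightarrow> nat \<Rightarrow> emitter" where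
  "emit_Lit m b x j i = curve_emitter m (xq b x j i)
     (xN \<oplus> xB j \<oplus> Cst (if i \<le> w - 2 then i else 2 * (w - 2) + 2))
     (\<lambda>c. ifle c (xq b x j i) (xeb x \<oplus> Cst 2) (ifless c xN (xla (xq b x j i)) (xbase (xrow j \<oplus> Cst i) \<oplus> Cst 6)))"

definition emit_Link :: "nat \<Rightarrow> aexp \<Rightarrow> nat \<Rightarrow> emitter" where
  "emit_Link m j i = curve_emitter m (xN \<oplus> xB j \<oplus> Cst i) (xN \<oplus> xB j \<oplus> Cst w \<oplus> Cst i)
     (\<lambda>c. ifless c (xN \<oplus> xB j \<oplus> Cst w \<oplus> Cst i) (xbase (xrow j \<oplus> Cst i) \<oplus> Cst 4) (xbase (xrow j \<oplus> Cst i \<oplus> Cst 1) \<oplus> Cst 2))"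

definition emit_Bar :: "nat \<Rightarrow> aexp \<Rightarrow> emitter" where
  "emit_Bar m x = curve_emitter m (xG x \<oplus> xocc) xN (\<lambda>c. ifle c (xG x \<oplus> xocc) (xeb x \<oplus> Cst 6)
     (ifless c xN (Cst 8 \<otimes> x \<oplus> Cst 8) xZ))"

definition emit_Var :: "nat \<Rightarrow> aexp \<Rightarrow> emitter" where
  "emit_Var m x = curve_emitter m (xG x) (xG x \<oplus> Cst 2 \<otimes> xocc) (\<lambda>c. xeb x \<oplus> Cst 4)"

text \<open>The clause with number \<open>\<kappa> + kk * (P + R * t)\<close> is the instance of the template \<open>\<kappa>\<close> at time \<open>t\<close> and position \<open>P\<close>.\<close>

definition emit_clause :: "nat \<Rightarrow> emitter" where
  "emit_clause \<kappa> = (let j = Cst kk \<otimes> (Var 3 \<oplus> xR \<otimes> Var 1) \<oplus> Cst \<kappa> in seqs (emit_Guard 5 j #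
     map (\<lambda>i. emit_Lit 5 (fst (tmpl ! \<kappa> ! i)) (restrict_vars 5 (snd (tmpl ! \<kappa> ! i))) j i) [0..<w] @
     map (emit_Link 5 j) [0..<w - 1]))"

definition emit_description :: emitter where
  "emit_description = seqs [EmitN xN, emit_Top 1, emit_Block 1, For xT (For xR (seqs (map emit_clause [0..<kk]))),
     For xVn (Seq (emit_Bar 3 (Var 1)) (emit_Var 3 (Var 1))), EmitB False,
     EmitN (Cst 0), EmitN xZ, EmitN (xY \<oplus> Cst 2), EmitN xbe]"

section \<open>Correctness of the output for a fixed input\<close>

context
  fixes x :: "bool list"
begin

definition T :: nat where "T = Suc (poly p (length x))"
definition R :: nat where "R = 2 * T + 1"
definition J :: nat where "J = kk * (R * T)"
definition Vn :: nat where "Vn = K * ((T + 2) * (2 * T + 3))"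
text \<open>Recovers template, position and time from the clause number; this is the environment
  inside the two loops of \<open>emit_description\<close>.\<close>

definition env :: "nat \<Rightarrow> nat list" where "env j = cnf_env x T (j div kk div R) (j div kk mod R)"
definition var :: "nat \<Rightarrow> nat \<Rightarrow> nat" where "var j i = aval x (env j) (snd (tmpl ! (j mod kk) ! i))"
definition pol :: "nat \<Rightarrow> nat \<Rightarrow> bool" where "pol j i = fst (tmpl ! (j mod kk) ! i)"

lemma kk_pos: "kk > 0" using tmpl by simp

lemma clause_number:
  assumes "\<kappa> < kk" "P < R" "t < T"
  shows "(kk * (P + R * t) + \<kappa>) mod kk = \<kappa>" "(kk * (P + R * t) + \<kappa>) div kk mod R = P"
    "(kk * (P + R * t) + \<kappa>) div kk div R = t" "kk * (P + R * t) + \<kappa> < J"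
proof -
  show "(kk * (P + R * t) + \<kappa>) mod kk = \<kappa>" "(kk * (P + R * t) + \<kappa>) div kk mod R = P"
    "(kk * (P + R * t) + \<kappa>) div kk div R = t" using assms tmpl by simp_all
  have "P + R * t < R * T"
    using assms mult_le_mono2[of "Suc t" T R] by simp
  then have "kk * Suc (P + R * t) \<le> kk * (R * T)" by (intro mult_le_mono2) simp
  then show "kk * (P + R * t) + \<kappa> < J" using assms by (simp add: J_def)
qed

lemma clause_number_split:
  assumes "j < J"
  shows "j mod kk < kk" "j div kk mod R < R" "j div kk div R < T"
    "j = kk * (j div kk mod R + R * (j div kk div R)) + j mod kk"
proof -
  show "j mod kk < kk" "j div kk mod R < R" using kk_pos by (simp_all add: R_def)
  have "j div kk < R * T" using assms by (intro less_mult_imp_div_less) (simp add: J_def ac_simps)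
  then have "j div kk < T * R" by (simp add: mult.commute)
  then show "j div kk div R < T" by (rule less_mult_imp_div_less)
  show "j = kk * (j div kk mod R + R * (j div kk div R)) + j mod kk" by simp
qed

lemma template_literal: "\<kappa> < kk \<Longrightarrow> i < w \<Longrightarrow> tmpl ! \<kappa> \<in> set tmpl" "\<kappa> < kk \<Longrightarrow> i < w \<Longrightarrow> tmpl ! \<kappa> ! i \<in> set (tmpl ! \<kappa>)"
  using length_clause[of "tmpl ! \<kappa>"] by auto

interpretation arr: cnf_arrangement J w Vn var pol
proof
  show "J \<ge> 1" using kk_pos by (simp add: J_def R_def T_def Suc_le_eq)
  show "w \<ge> 2" by (rule w)
  fix j i assume ji: "j < J" "i < w"
  note k = clause_number_split[OF ji(1)]
  obtain b a where ba: "tmpl ! (j mod kk) ! i = (b, a)" by fastforce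
  show "var j i < Vn" unfolding var_def env_def Vn_def
    by (rule var_bound[of T _ _ _ "tmpl ! (j mod kk)" b])
      (use k template_literal[OF k(1) ji(2)] ba in \<open>auto simp: T_def R_def\<close>)
qed

lemma satisfiable_iff_cnf_holds: "(\<exists>V. \<forall>j<J. \<exists>i<w. V (var j i) = pol j i) \<longleftrightarrow> (\<exists>V. cnf_holds x T tmpl V)"
proof -
  have "(\<forall>j<J. \<exists>i<w. V (var j i) = pol j i) \<longleftrightarrow> cnf_holds x T tmpl V" for V
  proof
    assume sat: "\<forall>j<J. \<exists>i<w. V (var j i) = pol j i"
    show "cnf_holds x T tmpl V" unfolding cnf_holds_def clause_holds_def
    proof (intro allI impI ballI)
      fix t P cl assume tP: "t < T" "P < 2 * T + 1" and cl: "cl \<in> set tmpl"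
      obtain \<kappa> where \<kappa>: "\<kappa> < kk" "cl = tmpl ! \<kappa>" using cl by (auto simp: in_set_conv_nth)
      note c = clause_number[OF \<kappa>(1) tP(2)[folded R_def] tP(1)]
      obtain i where i: "i < w" "V (var (kk * (P + R * t) + \<kappa>) i) = pol (kk * (P + R * t) + \<kappa>) i" using sat c(4) by blast
      then show "\<exists>(b, a)\<in>set cl. V (aval x (cnf_env x T t P) a) = b"
        using template_literal[OF \<kappa>(1) i(1)] \<kappa> unfolding var_def pol_def env_def c(1-3)
        by (intro bexI[of _ "tmpl ! \<kappa> ! i"]) (auto simp: case_prod_beta)
    qed
  next
    assume cnf: "cnf_holds x T tmpl V"
    show "\<forall>j<J. \<exists>i<w. V (var j i) = pol j i"
    proof (intro allI impI)
      fix j assume j: "j < J"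
      note c = clause_number_split[OF j]
      have t: "tmpl ! (j mod kk) \<in> set tmpl" using c(1) by simp
      have "\<exists>(b, a)\<in>set (tmpl ! (j mod kk)). V (aval x (env j) a) = b"
        using cnf c(2,3) t unfolding cnf_holds_def clause_holds_def env_def R_def by blast
      then obtain l where l: "l \<in> set (tmpl ! (j mod kk))" "V (aval x (env j) (snd l)) = fst l" by auto
      then obtain i where "i < w" "l = tmpl ! (j mod kk) ! i" using length_clause[OF t] by (auto simp: in_set_conv_nth)
      then show "\<exists>i<w. V (var j i) = pol j i" using l by (auto simp: var_def pol_def)
    qed
  qed
  then show ?thesis by simp
qed

lemma aval_constants [simp]:
  "aval x (length x # e) xT = T" "aval x (length x # e) xR = R" "aval x (length x # e) xJ = J" "aval x (length x # e) xVn = Vn"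
  "aval x (length x # e) xocc = arr.occ" "aval x (length x # e) xY = arr.Y" "aval x (length x # e) xN = arr.N"
  "aval x (length x # e) xbe = arr.be" "aval x (length x # e) xHh = arr.Hh" "aval x (length x # e) xZ = arr.Z"
  "aval x (length x # e) xTop = arr.Top"
  "aval x (length x # e) (xrow a) = arr.row (aval x (length x # e) a)"
  "aval x (length x # e) (xB a) = arr.B (aval x (length x # e) a)"
  "aval x (length x # e) (xG a) = arr.G (aval x (length x # e) a)"
  "aval x (length x # e) (xla a) = arr.la (aval x (length x # e) a)"
  "aval x (length x # e) (xeb a) = arr.eb (aval x (length x # e) a)"
  "aval x (length x # e) (xbase a) = arr.base (aval x (length x # e) a)"
proof -
  show T: "aval x (length x # e) xT = T" by (simp add: xT_def T_def)
  show R: "aval x (length x # e) xR = R" by (simp add: xR_def R_def T)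
  show J: "aval x (length x # e) xJ = J" by (simp add: xJ_def J_def R T)
  show Vn: "aval x (length x # e) xVn = Vn" by (simp add: xVn_def Vn_def T)
  show occ: "aval x (length x # e) xocc = arr.occ" by (simp add: xocc_def arr.occ_def J)
  have G: "aval x (length x # e) (xG a) = arr.G (aval x (length x # e) a)" for a by (simp add: xG_def arr.G_def arr.X0_def occ)
  then show "aval x (length x # e) (xG a) = arr.G (aval x (length x # e) a)" .
  show Y: "aval x (length x # e) xY = arr.Y" by (simp add: xY_def arr.Y_def G Vn)
  show N: "aval x (length x # e) xN = arr.N" by (simp add: xN_def arr.N_def Y)
  show be: "aval x (length x # e) xbe = arr.be" by (simp add: xbe_def arr.be_def Vn J)
  show Hh: "aval x (length x # e) xHh = arr.Hh" by (simp add: xHh_def arr.Hh_def Y be J)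
  show Z: "aval x (length x # e) xZ = arr.Z" by (simp add: xZ_def arr.Z_def occ)
  show "aval x (length x # e) xTop = arr.Top" by (simp add: xTop_def arr.Top_def Hh Z J)
  show row: "aval x (length x # e) (xrow a) = arr.row (aval x (length x # e) a)" by (simp add: xrow_def arr.row_def)
  show "aval x (length x # e) (xB a) = arr.B (aval x (length x # e) a)" by (simp add: xB_def arr.B_def xrow_def arr.row_def)
  have la: "aval x (length x # e) (xla a) = arr.la (aval x (length x # e) a)" for a by (simp add: xla_def arr.la_def Hh)
  then show "aval x (length x # e) (xla a) = arr.la (aval x (length x # e) a)" .
  show "aval x (length x # e) (xeb a) = arr.eb (aval x (length x # e) a)" by (simp add: xeb_def arr.eb_def la G occ)
  show "aval x (length x # e) (xbase a) = arr.base (aval x (length x # e) a)" by (simp add: xbase_def arr.base_def occ)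
qed

lemma emitted_Top: "emitted x (length x # e) (emit_Top (Suc (length e))) = True # code_list code_point (arr.chain TopC)"
  unfolding emit_Top_def arr.chain_def by (rule emitted_curve_emitter) simp_all

lemma emitted_Block: "emitted x (length x # e) (emit_Block (Suc (length e))) = True # code_list code_point (arr.chain BlockC)"
  unfolding emit_Block_def arr.chain_def by (rule emitted_curve_emitter) simp_all

lemma emitted_Guard:
  assumes "\<And>e'. aval x (length x # e @ e') aj = j"
  shows "emitted x (length x # e) (emit_Guard (Suc (length e)) aj) = True # code_list code_point (arr.chain (GuardC j))"
  using assms[of "[]"] unfolding emit_Guard_def arr.chain_def
  by (intro emitted_curve_emitter) (simp_all add: assms arr.v_def)

lemma emitted_Lit:
  assumes "\<And>e'. aval x (length x # e @ e') aj = j" "\<And>e'. aval x (length x # e @ e') ax = var j i" "b = pol j i"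
  shows "emitted x (length x # e) (emit_Lit (Suc (length e)) b ax aj i) = True # code_list code_point (arr.chain (LitC j i))"
proof -
  have q: "aval x (length x # e @ e') (xq b ax aj i) = arr.q j i" for e'
    by (simp add: xq_def arr.q_def assms)
  show ?thesis using assms(1)[of "[]"] unfolding emit_Lit_def arr.chain_def
    by (intro emitted_curve_emitter) (simp_all add: assms(1,2) arr.v_def q)
qed

lemma emitted_Link:
  assumes "\<And>e'. aval x (length x # e @ e') aj = j"
  shows "emitted x (length x # e) (emit_Link (Suc (length e)) aj i) = True # code_list code_point (arr.chain (LinkC j i))"
  using assms[of "[]"] unfolding emit_Link_def arr.chain_def
  by (intro emitted_curve_emitter) (simp_all add: assms)

lemma emitted_Bar:
  assumes "\<And>e'. aval x (length x # e @ e') ay = y"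
  shows "emitted x (length x # e) (emit_Bar (Suc (length e)) ay) = True # code_list code_point (arr.chain (BarC y))"
  using assms[of "[]"] unfolding emit_Bar_def arr.chain_def
  by (intro emitted_curve_emitter) (simp_all add: assms)

lemma emitted_Var:
  assumes "\<And>e'. aval x (length x # e @ e') ay = y"
  shows "emitted x (length x # e) (emit_Var (Suc (length e)) ay) = True # code_list code_point (arr.chain (VarC y))"
  using assms[of "[]"] unfolding emit_Var_def arr.chain_def
  by (intro emitted_curve_emitter) (simp_all add: assms)

definition clause_ids :: "nat \<Rightarrow> curve_id list" where
  "clause_ids j = GuardC j # map (LitC j) [0..<w] @ map (LinkC j) [0..<w - 1]"

definition ids :: "curve_id list" where
  "ids = [TopC, BlockC] @ concat (map (\<lambda>t. concat (map (\<lambda>P. concat (map (\<lambda>\<kappa>. clause_ids (kk * (P + R * t) + \<kappa>))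
     [0..<kk])) [0..<R])) [0..<T]) @ concat (map (\<lambda>y. [BarC y, VarC y]) [0..<Vn])"

abbreviation code_curve :: "curve_id \<Rightarrow> bool list" where
  "code_curve a \<equiv> True # code_list code_point (arr.chain a)"

lemma emitted_clause:
  assumes "\<kappa> < kk" "P < R" "t < T"
  shows "emitted x [length x, t, T - Suc t, P, R - Suc P] (emit_clause \<kappa>) =
    concat (map code_curve (clause_ids (kk * (P + R * t) + \<kappa>)))"
proof -
  let ?j = "kk * (P + R * t) + \<kappa>" and ?e = "[t, T - Suc t, P, R - Suc P]"
  let ?aj = "Cst kk \<otimes> (Var 3 \<oplus> xR \<otimes> Var 1) \<oplus> Cst \<kappa>"
  note c = clause_number[OF assms]
  have aj: "aval x (length x # ?e @ e') ?aj = ?j" for e' by simp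
  have env: "env ?j = length x # ?e" unfolding env_def c by (simp add: cnf_env_def R_def)
  have lit: "emitted x (length x # ?e) (emit_Lit 5 (fst (tmpl ! \<kappa> ! i)) (restrict_vars 5 (snd (tmpl ! \<kappa> ! i))) ?aj i) =
    code_curve (LitC ?j i)" if "i < w" for i
  proof -
    have ax: "aval x (length x # ?e @ e') (restrict_vars 5 (snd (tmpl ! \<kappa> ! i))) = var ?j i" for e'
      using aval_restrict_vars[of 5 "length x # ?e" x e' "snd (tmpl ! \<kappa> ! i)"] unfolding var_def env c by simp
    have "fst (tmpl ! \<kappa> ! i) = pol ?j i" unfolding pol_def c ..
    from emitted_Lit[OF aj ax this] show ?thesis by (simp add: numeral_eq_Suc)
  qed
  have guard: "emitted x (length x # ?e) (emit_Guard 5 ?aj) = code_curve (GuardC ?j)"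
    using emitted_Guard[OF aj] by (simp add: numeral_eq_Suc)
  have link: "emitted x (length x # ?e) (emit_Link 5 ?aj i) = code_curve (LinkC ?j i)" for i
    using emitted_Link[OF aj] by (simp add: numeral_eq_Suc)
  have lits: "map (\<lambda>i. emitted x (length x # ?e) (emit_Lit 5 (fst (tmpl ! \<kappa> ! i)) (restrict_vars 5 (snd (tmpl ! \<kappa> ! i))) ?aj i)) [0..<w]
      = map (\<lambda>i. code_curve (LitC ?j i)) [0..<w]"
    using lit by (intro map_cong) auto
  show ?thesis unfolding emit_clause_def Let_def clause_ids_def emitted_seqs
    by (simp only: list.map map_append map_map o_def concat.simps concat_append guard link lits)
qed

lemma emitted_description:
  "emitted x [length x] emit_description = code_description (arr.N, map arr.chain ids, (0, arr.Z), (arr.Y + 2, arr.be))"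
proof -
  have cc: "concat (concat xss) = concat (map concat xss)" for xss :: "bool list list list" by (induction xss) auto
  have top: "emitted x [length x] (emit_Top 1) = code_curve TopC" "emitted x [length x] (emit_Block 1) = code_curve BlockC"
    using emitted_Top[of "[]"] emitted_Block[of "[]"] by simp_all
  have clauses: "emitted x [length x] (For xT (For xR (seqs (map emit_clause [0..<kk])))) =
    concat (map code_curve (concat (map (\<lambda>t. concat (map (\<lambda>P. concat (map (\<lambda>\<kappa>. clause_ids (kk * (P + R * t) + \<kappa>))
     [0..<kk])) [0..<R])) [0..<T])))"
    unfolding emitted.simps aval_constants emitted_seqs map_map map_concat cc o_def append.simps
    by (intro arg_cong[where f = concat] map_cong refl) (simp add: emitted_clause o_def)
  have vars: "emitted x [length x] (For xVn (Seq (emit_Bar 3 (Var 1)) (emit_Var 3 (Var 1)))) =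
    concat (map code_curve (concat (map (\<lambda>y. [BarC y, VarC y]) [0..<Vn])))"
  proof -
    have "emitted x [length x, y, Vn - Suc y] (emit_Bar 3 (Var 1)) = code_curve (BarC y)"
      "emitted x [length x, y, Vn - Suc y] (emit_Var 3 (Var 1)) = code_curve (VarC y)" for y
      using emitted_Bar[of "[y, Vn - Suc y]" "Var 1" y] emitted_Var[of "[y, Vn - Suc y]" "Var 1" y]
      by (simp_all add: numeral_eq_Suc)
    then show ?thesis by (simp add: map_concat cc o_def)
  qed
  have "emitted x [length x] emit_description = code_nat arr.N @ concat (map code_curve ids) @ False #
      code_nat 0 @ code_nat arr.Z @ code_nat (arr.Y + 2) @ code_nat arr.be"
    unfolding emit_description_def emitted_seqs list.map concat.simps top clauses vars ids_def
    by simp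
  then show ?thesis unfolding code_description_def prod.case code_list_def[of "code_list code_point"]
    by (simp add: code_point_def o_def)
qed

lemma set_ids: "set ids = {a. arr.valid a}"
proof -
  have c: "a \<in> set (clause_ids j) \<longleftrightarrow> a = GuardC j \<or> (\<exists>i<w. a = LitC j i) \<or> (\<exists>i\<le>arr.v. a = LinkC j i)" for a j
    using w by (auto simp: clause_ids_def arr.v_def)
  have s: "set ids = {TopC, BlockC} \<union> (\<Union>t<T. \<Union>P<R. \<Union>\<kappa><kk. set (clause_ids (kk * (P + R * t) + \<kappa>))) \<union> (\<Union>y<Vn. {BarC y, VarC y})"
    by (auto simp: ids_def)
  have "(\<Union>t<T. \<Union>P<R. \<Union>\<kappa><kk. set (clause_ids (kk * (P + R * t) + \<kappa>))) = (\<Union>j<J. set (clause_ids j))"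
  proof (intro equalityI subsetI)
    fix a assume "a \<in> (\<Union>t<T. \<Union>P<R. \<Union>\<kappa><kk. set (clause_ids (kk * (P + R * t) + \<kappa>)))"
    then show "a \<in> (\<Union>j<J. set (clause_ids j))" using clause_number(4) by blast
  next
    fix a assume "a \<in> (\<Union>j<J. set (clause_ids j))"
    then obtain j where j: "j < J" "a \<in> set (clause_ids j)" by blast
    note k = clause_number_split[OF j(1)]
    show "a \<in> (\<Union>t<T. \<Union>P<R. \<Union>\<kappa><kk. set (clause_ids (kk * (P + R * t) + \<kappa>)))"
      by (rule UN_I[of "j div kk div R"], simp add: k(3), rule UN_I[of "j div kk mod R"], simp add: k(2),
          rule UN_I[of "j mod kk"], simp add: k(1)) (simp only: k(4)[symmetric] j(2))
  qed
  then have "a \<in> set ids \<longleftrightarrow> arr.valid a" for a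
    unfolding s by (cases a) (auto simp: c)
  then show ?thesis by blast
qed

lemma drawn_ids: "drawn_curve arr.N ` set (map arr.chain ids) = arr.arrangement"
  unfolding arr.arrangement_def set_map set_ids image_image
  by (intro image_cong) (simp_all add: arr.drawn_curve_chain)

lemma reduction_correct:
  "\<exists>I. encodes_instance (emitted x [length x] emit_description) I"
  "encodes_instance (emitted x [length x] emit_description) I \<Longrightarrow>
     (\<exists>V. cnf_holds x T tmpl V) \<longleftrightarrow> (case I of (A, a, b) \<Rightarrow> extendable A a b)"
proof -
  let ?d = "(arr.N, map arr.chain ids, (0, arr.Z), (arr.Y + 2, arr.be))"
  have gp: "wrap arr.N (grid_point (0, arr.Z)) = wrap arr.N (real 0, real arr.Z)"
    "wrap arr.N (grid_point (arr.Y + 2, arr.be)) = wrap arr.N (real (arr.Y + 2), real arr.be)"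
    by (simp_all add: grid_point_def)
  have "describes ?d arr.arrangement (wrap arr.N (real 0, real arr.Z)) (wrap arr.N (real (arr.Y + 2), real arr.be))"
    using describes_drawn[of arr.N "map arr.chain ids" "(0, arr.Z)" "(arr.Y + 2, arr.be)"] unfolding drawn_ids gp .
  with arr.extension_instance_arrangement
  have "encodes_instance (code_description ?d) (arr.arrangement, wrap arr.N (real 0, real arr.Z), wrap arr.N (real (arr.Y + 2), real arr.be))"
    unfolding encodes_instance_def prod.case by blast
  then show "\<exists>I. encodes_instance (emitted x [length x] emit_description) I"
    unfolding emitted_description by blast
  assume "encodes_instance (emitted x [length x] emit_description) I"
  then obtain A a b d where I: "I = (A, a, b)" "code_description ?d = code_description d" "describes d A a b"
    unfolding emitted_description encodes_instance_def by (cases I) auto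
  \<comment> \<open>Unique readability: every instance coded by the output is described by this very
    description, and so is homeomorphic to the drawn arrangement.\<close>
  have "d = ?d" using injD[OF inj_code_description I(2)] by simp
  with I(3) have "describes ?d A a b" by simp
  from describes_extendable_iff[OF this, unfolded drawn_ids gp]
  show "(\<exists>V. cnf_holds x T tmpl V) \<longleftrightarrow> (case I of (A, a, b) \<Rightarrow> extendable A a b)"
    using arr.extendable_iff_satisfiable satisfiable_iff_cnf_holds I(1) by simp
qed

end
end

theorem theorem6:
  "NP_hard encodes_instance (\<lambda>(A, a, b). extendable A a b)"
  unfolding NP_hard_def
proof
  fix L assume "L \<in> NP"
  then obtain p tmpl w K where t: "w \<ge> 2" "tmpl \<noteq> []" "\<And>cl. cl \<in> set tmpl \<Longrightarrow> length cl = w"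
    "\<And>x T t P cl b a. T = Suc (poly p (length x)) \<Longrightarrow> t < T \<Longrightarrow> P < 2 * T + 1 \<Longrightarrow> cl \<in> set tmpl \<Longrightarrow> (b, a) \<in> set cl \<Longrightarrow>
       aval x (cnf_env x T t P) a < K * ((T + 2) * (2 * T + 3))"
    and L: "\<And>x. x \<in> L \<longleftrightarrow> (\<exists>v. cnf_holds x (Suc (poly p (length x))) tmpl v)"
    by (rule NP_templates) blast
  interpret clause_templates p tmpl w K by unfold_locales (fact t)+
  show "\<exists>f. polytime_computable f \<and> (\<forall>x. (\<exists>I. encodes_instance (f x) I) \<and>
      (\<forall>I. encodes_instance (f x) I \<longrightarrow> (x \<in> L \<longleftrightarrow> (\<lambda>(A, a, b). extendable A a b) I)))"
    by (rule exI[of _ "\<lambda>x. emitted x [length x] emit_description"])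
      (use polytime_computable_emitted reduction_correct L in \<open>simp add: T_def\<close>)
qed

end
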